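(* Let $\mathrm{M}$ be a $\mathrm{II}_1$ factor (with separable predual). If two $E_0$-semigroups $\alpha$ and $\beta$ acting on $\mathrm{M}$ are cocycle conjugate, then the corresponding super product systems $\{H^\alpha_t\}$ and $\{H^\beta_t\}$ are isomorphic.
   Context: An $E_0$-semigroup on a von Neumann algebra $\mathrm{M}$ is a semigroup $(\alpha_t)_{t\ge 0}$ of normal unital $*$-endomorphisms of $\mathrm{M}$ with $\alpha_0=\mathrm{id}$, $\alpha_t(\mathrm{M})\ne \mathrm{M}$ for all $t>0$, and $t\mapsto\rho(\alpha_t(x))$ continuous for all $x\in\mathrm{M}$, $\rho\in\mathrm{M}_*$. A cocycle for $\alpha$ is a strongly continuous family of unitaries $(U_t)_{t\ge0}$ in $\mathrm{M}$ with $U_s\alpha_s(U_t)=U_{s+t}$ for all $s,t\ge 0$; then $\alpha^U_t(x)=U_t\alpha_t(x)U_t^*$ is an $E_0$-semigroup. $\alpha$ on $\mathrm{M}$ and $\beta$ on $\mathrm{N}$ are conjugate if there is a $*$-isomorphism $\theta:\mathrm{M}\to\mathrm{N}$ with $\beta_t=\theta\circ\alpha_t\circ\theta^{-1}$ for all $t$, and cocycle conjugate if $\beta$ is conjugate to $\alpha^U$ for some cocycle $U$ for $\alpha$. Let $\mathrm{M}$ act standardly on $L^2(\mathrm{M})$, with modular conjugation $J$ associated with the trace vector $\Omega$. The complementary $E_0$-semigroup is $\alpha'_t(x')=J\alpha_t(Jx'J)J$ on $\mathrm{M}'$. Put $E^\alpha_t=\{T\in B(L^2(\mathrm{M})):\alpha_t(m)T=Tm\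 \forall m\in\mathrm{M}\}$, $E^{\alpha'}_t=\{T\in B(L^2(\mathrm{M})):\alpha'_t(m')T=Tm'\ \forall m'\in\mathrm{M}'\}$ and $H^\alpha_t=E^\alpha_t\cap E^{\alpha'}_t$ for $t>0$. Then $H^\alpha_t$ is a Hilbert space with inner product determined by $T^*S=\langle S,T\rangle_t1$, and with the isometries $U^\alpha_{s,t}:H^\alpha_s\otimes H^\alpha_t\to H^\alpha_{s+t}$, $U^\alpha_{s,t}(X\otimes Y)=XY$, and the Borel structure on $\{(t,X):t>0,X\in H^\alpha_t\}$ inherited from $(0,\infty)\times B(L^2(\mathrm{M}))$ (weak operator Borel structure), the family $(H^\alpha_t,U^\alpha_{s,t})$ is the super product system of $\alpha$. An isomorphism between super product systems $(H^1_t,U^1_{s,t})$ and $(H^2_t,U^2_{s,t})$ is a Borel isomorphism between the total spaces $\{(t,\xi):t>0,\xi\in H^i_t\}$ ($i=1,2$) which restricts on each fibre to a unitary $V_t:H^1_t\to H^2_t$ and satisfies $V_{s+t}U^1_{s,t}=U^2_{s,t}(V_s\otimes V_t)$ for all $s,t>0$. *)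

theory Defs
  imports "HOL-Analysis.Analysis"
begin

section \<open>Complex Hilbert spaces and their bounded operators\<close>

text \<open>The inner product is linear in its first argument. The underlying real inner product is its
  real part, so norm, topology and completeness are those of the complex inner product; positive
  definiteness is inherited from \<^class>\<open>real_inner\<close>.\<close>

class chilbert_space = real_inner + complete_space +
  fixes scaleC :: "complex \<Rightarrow> 'a \<Rightarrow> 'a" (infixr "*\<^sub>C" 75)
    and cinner :: "'a \<Rightarrow> 'a \<Rightarrow> complex"
  assumes scaleC_of_real: "scaleC (complex_of_real r) x = scaleR r x"
    and scaleC_add_right: "scaleC c (x + y) = scaleC c x + scaleC c y"
    and scaleC_add_left: "scaleC (c + d) x = scaleC c x + scaleC d x"
    and scaleC_scaleC: "scaleC c (scaleC d x) = scaleC (c * d) x"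
    and cinner_add_left: "cinner (x + y) z = cinner x z + cinner y z"
    and cinner_scaleC_left: "cinner (scaleC c x) y = c * cinner x y"
    and cinner_commute: "cinner y x = cnj (cinner x y)"
    and inner_eq_Re_cinner: "inner x y = Re (cinner x y)"

text \<open>Library bounded operators are only real-linear. \<open>B(H)\<close> is the set of the complex-linear ones;
  the larger type is convenient because the antilinear conjugation \<open>J\<close> also lives in it.\<close>

type_synonym 'a op = "'a \<Rightarrow>\<^sub>L 'a"

definition bops :: "'a::chilbert_space op set" where
  "bops = {T :: 'a op. \<forall>c x. T (c *\<^sub>C x) = c *\<^sub>C T x}"

definition scalar_op :: "complex \<Rightarrow> 'a::chilbert_space op" where
  "scalar_op c = Blinfun (\<lambda>x. c *\<^sub>C x)"

definition scale_op :: "complex \<Rightarrow> 'a::chilbert_space op \<Rightarrow> 'a op" where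
  "scale_op c T = scalar_op c o\<^sub>L T"

definition adj :: "'a::chilbert_space op \<Rightarrow> 'a op" where
  "adj T = (THE S. S \<in> bops \<and> (\<forall>x y. cinner (T x) y = cinner x (S y)))"

lemma norm_scaleC: "norm (c *\<^sub>C x) = cmod c * norm (x::'a::chilbert_space)"
proof -
  have sq: "cinner z z = of_real ((norm z)\<^sup>2)" for z :: 'a
  proof (rule complex_eqI)
    show "Re (cinner z z) = Re (of_real ((norm z)\<^sup>2))"
      using inner_eq_Re_cinner[of z z] by (simp add: power2_norm_eq_inner)
    have "Im (cinner z z) = - Im (cinner z z)"
      using arg_cong[OF cinner_commute[of z z], of Im] by simp
    then show "Im (cinner z z) = Im (of_real ((norm z)\<^sup>2))" by simp
  qed
  have "cinner (c *\<^sub>C x) (c *\<^sub>C x) = c * cnj (c * cinner x x)"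
    by (metis cinner_commute cinner_scaleC_left)
  also have "\<dots> = of_real ((cmod c)\<^sup>2 * (norm x)\<^sup>2)"
    unfolding sq complex_cnj_mult complex_cnj_complex_of_real
    by (metis complex_norm_square mult.assoc of_real_mult)
  finally have "(norm (c *\<^sub>C x))\<^sup>2 = (cmod c * norm x)\<^sup>2"
    unfolding sq of_real_eq_iff by (simp add: power_mult_distrib)
  then show ?thesis
    by (simp add: power2_eq_iff_nonneg)
qed

lemma scalar_op_apply [simp]: "scalar_op c x = c *\<^sub>C x"
proof -
  have "bounded_linear (\<lambda>x::'a. c *\<^sub>C x)"
  proof (rule bounded_linear_intro)
    fix r x
    show "c *\<^sub>C (r *\<^sub>R x) = r *\<^sub>R (c *\<^sub>C (x::'a))"
      by (metis scaleC_of_real scaleC_scaleC mult.commute)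
  next
    fix x :: 'a
    show "norm (c *\<^sub>C x) \<le> norm x * cmod c" by (simp add: norm_scaleC)
  qed (rule scaleC_add_right)
  then show ?thesis unfolding scalar_op_def by (simp add: bounded_linear_Blinfun_apply)
qed

definition is_unitary :: "'a::chilbert_space op \<Rightarrow> bool" where
  "is_unitary u \<longleftrightarrow> u \<in> bops \<and> adj u o\<^sub>L u = id_blinfun \<and> u o\<^sub>L adj u = id_blinfun"


section \<open>Von Neumann algebras and \<open>II\<^sub>1\<close> factors\<close>

definition commutant :: "'a::chilbert_space op set \<Rightarrow> 'a op set" where
  "commutant M = {T \<in> bops. \<forall>x\<in>M. T o\<^sub>L x = x o\<^sub>L T}"

definition von_neumann_algebra :: "'a::chilbert_space op set \<Rightarrow> bool" where
  "von_neumann_algebra M \<longleftrightarrow>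
     M \<subseteq> bops \<and> (\<forall>x\<in>M. adj x \<in> M) \<and> commutant (commutant M) = M"

definition factor :: "'a::chilbert_space op set \<Rightarrow> bool" where
  "factor M \<longleftrightarrow> von_neumann_algebra M \<and> (id_blinfun :: 'a op) \<noteq> 0 \<and>
     M \<inter> commutant M = range scalar_op"

definition projections :: "'a::chilbert_space op set \<Rightarrow> 'a op set" where
  "projections M = {p \<in> M. adj p = p \<and> p o\<^sub>L p = p}"

definition finite_vna :: "'a::chilbert_space op set \<Rightarrow> bool" where
  "finite_vna M \<longleftrightarrow> (\<forall>v\<in>M. adj v o\<^sub>L v = id_blinfun \<longrightarrow> v o\<^sub>L adj v = id_blinfun)"

definition abelian_projection :: "'a::chilbert_space op set \<Rightarrow> 'a op \<Rightarrow> bool" where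
  "abelian_projection M p \<longleftrightarrow> p \<in> projections M \<and>
     (\<forall>x\<in>M. \<forall>y\<in>M. (p o\<^sub>L x o\<^sub>L p) o\<^sub>L (p o\<^sub>L y o\<^sub>L p) = (p o\<^sub>L y o\<^sub>L p) o\<^sub>L (p o\<^sub>L x o\<^sub>L p))"

definition type_II1_factor :: "'a::chilbert_space op set \<Rightarrow> bool" where
  "type_II1_factor M \<longleftrightarrow> factor M \<and> finite_vna M \<and> (\<forall>p. abelian_projection M p \<longrightarrow> p = 0)"

text \<open>\<open>M\<^sub>*\<close>, the ultraweakly continuous functionals on \<open>M\<close>. Functionals are total functions of which
  only the values on \<open>M\<close> matter.\<close>

definition predual :: "'a::chilbert_space op set \<Rightarrow> ('a op \<Rightarrow> complex) set" where
  "predual M = {\<rho>. \<exists>\<xi> \<eta> :: nat \<Rightarrow> 'a.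
     summable (\<lambda>n. (norm (\<xi> n))\<^sup>2) \<and> summable (\<lambda>n. (norm (\<eta> n))\<^sup>2) \<and>
     (\<forall>x\<in>M. \<rho> x = (\<Sum>n. cinner (blinfun_apply x (\<xi> n)) (\<eta> n)))}"

definition separable_predual :: "'a::chilbert_space op set \<Rightarrow> bool" where
  "separable_predual M \<longleftrightarrow> (\<exists>D. countable D \<and> D \<subseteq> predual M \<and>
     (\<forall>\<rho>\<in>predual M. \<forall>\<epsilon>>0. \<exists>\<sigma>\<in>D. \<forall>x\<in>M. norm x \<le> 1 \<longrightarrow> cmod (\<rho> x - \<sigma> x) \<le> \<epsilon>))"

text \<open>\<open>M\<close> acts standardly, i.e. the ambient Hilbert space is \<open>L\<^sup>2(M)\<close>: it is the GNS space of the
  tracial state \<open>x \<mapsto> \<langle>x\<Omega>, \<Omega>\<rangle>\<close>, with canonical cyclic vector \<open>\<Omega>\<close>.\<close>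

definition standard_trace_vector :: "'a::chilbert_space op set \<Rightarrow> 'a \<Rightarrow> bool" where
  "standard_trace_vector M \<Omega> \<longleftrightarrow> norm \<Omega> = 1 \<and>
     (\<forall>x\<in>M. \<forall>y\<in>M. cinner ((x o\<^sub>L y) \<Omega>) \<Omega> = cinner ((y o\<^sub>L x) \<Omega>) \<Omega>) \<and>
     closure ((\<lambda>x. blinfun_apply x \<Omega>) ` M) = UNIV"

text \<open>The antilinear isometry extending \<open>x\<Omega> \<mapsto> x\<^sup>*\<Omega>\<close>; it is its own inverse.\<close>

definition modular_conj :: "'a::chilbert_space op set \<Rightarrow> 'a \<Rightarrow> 'a op" where
  "modular_conj M \<Omega> = (THE J :: 'a op. \<forall>x\<in>M. blinfun_apply J (blinfun_apply x \<Omega>) = adj x \<Omega>)"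


section \<open>\<open>E\<^sub>0\<close>-semigroups\<close>

definition star_hom ::
    "'a::chilbert_space op set \<Rightarrow> 'b::chilbert_space op set \<Rightarrow> ('a op \<Rightarrow> 'b op) \<Rightarrow> bool" where
  "star_hom M N \<phi> \<longleftrightarrow> \<phi> \<in> M \<rightarrow> N \<and>
     (\<forall>x\<in>M. \<forall>y\<in>M. \<phi> (x + y) = \<phi> x + \<phi> y) \<and>
     (\<forall>c. \<forall>x\<in>M. \<phi> (scale_op c x) = scale_op c (\<phi> x)) \<and>
     (\<forall>x\<in>M. \<forall>y\<in>M. \<phi> (x o\<^sub>L y) = \<phi> x o\<^sub>L \<phi> y) \<and>
     (\<forall>x\<in>M. \<phi> (adj x) = adj (\<phi> x))"

definition star_iso ::
    "'a::chilbert_space op set \<Rightarrow> 'b::chilbert_space op set \<Rightarrow> ('a op \<Rightarrow> 'b op) \<Rightarrow> bool" where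
  "star_iso M N \<theta> \<longleftrightarrow> star_hom M N \<theta> \<and> bij_betw \<theta> M N"

definition normal_unital_endo :: "'a::chilbert_space op set \<Rightarrow> ('a op \<Rightarrow> 'a op) \<Rightarrow> bool" where
  "normal_unital_endo M \<phi> \<longleftrightarrow> star_hom M M \<phi> \<and> \<phi> id_blinfun = id_blinfun \<and>
     (\<forall>\<rho>\<in>predual M. (\<lambda>x. \<rho> (\<phi> x)) \<in> predual M)"

text \<open>Only the values \<open>\<alpha> t x\<close> with \<open>t \<ge> 0\<close> and \<open>x \<in> M\<close> are meaningful.\<close>

definition E0_semigroup :: "'a::chilbert_space op set \<Rightarrow> (real \<Rightarrow> 'a op \<Rightarrow> 'a op) \<Rightarrow> bool" where
  "E0_semigroup M \<alpha> \<longleftrightarrow>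
     (\<forall>t\<ge>0. normal_unital_endo M (\<alpha> t)) \<and>
     (\<forall>s\<ge>0. \<forall>t\<ge>0. \<forall>x\<in>M. \<alpha> s (\<alpha> t x) = \<alpha> (s + t) x) \<and>
     (\<forall>x\<in>M. \<alpha> 0 x = x) \<and>
     (\<forall>t>0. \<alpha> t ` M \<noteq> M) \<and>
     (\<forall>x\<in>M. \<forall>\<rho>\<in>predual M. continuous_on {0..} (\<lambda>t. \<rho> (\<alpha> t x)))"

definition cocycle ::
    "'a::chilbert_space op set \<Rightarrow> (real \<Rightarrow> 'a op \<Rightarrow> 'a op) \<Rightarrow> (real \<Rightarrow> 'a op) \<Rightarrow> bool" where
  "cocycle M \<alpha> U \<longleftrightarrow>
     (\<forall>t\<ge>0. U t \<in> M \<and> is_unitary (U t)) \<and>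
     continuous_map (top_of_set {0..}) strong_operator_topology U \<and>
     (\<forall>s\<ge>0. \<forall>t\<ge>0. U s o\<^sub>L \<alpha> s (U t) = U (s + t))"

definition perturb ::
    "(real \<Rightarrow> 'a op \<Rightarrow> 'a op) \<Rightarrow> (real \<Rightarrow> 'a op) \<Rightarrow> real \<Rightarrow> 'a::chilbert_space op \<Rightarrow> 'a op" where
  "perturb \<alpha> U t x = U t o\<^sub>L \<alpha> t x o\<^sub>L adj (U t)"

definition conjugate ::
    "'a::chilbert_space op set \<Rightarrow> (real \<Rightarrow> 'a op \<Rightarrow> 'a op) \<Rightarrow>
     'b::chilbert_space op set \<Rightarrow> (real \<Rightarrow> 'b op \<Rightarrow> 'b op) \<Rightarrow> bool" where
  "conjugate M \<alpha> N \<beta> \<longleftrightarrow> (\<exists>\<theta>. star_iso M N \<theta> \<and>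
     (\<forall>t\<ge>0. \<forall>y\<in>N. \<beta> t y = \<theta> (\<alpha> t (inv_into M \<theta> y))))"

definition cocycle_conjugate ::
    "'a::chilbert_space op set \<Rightarrow> (real \<Rightarrow> 'a op \<Rightarrow> 'a op) \<Rightarrow>
     'b::chilbert_space op set \<Rightarrow> (real \<Rightarrow> 'b op \<Rightarrow> 'b op) \<Rightarrow> bool" where
  "cocycle_conjugate M \<alpha> N \<beta> \<longleftrightarrow> (\<exists>U. cocycle M \<alpha> U \<and> conjugate M (perturb \<alpha> U) N \<beta>)"


section \<open>Super product systems\<close>

text \<open>\<open>mult s t\<close> is the isometry \<open>U\<^bsub>s,t\<^esub> : H\<^sub>s \<otimes> H\<^sub>t \<rightarrow> H\<^bsub>s+t\<^esub>\<close>, given by the bilinear map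
  \<open>(X, Y) \<mapsto> U\<^bsub>s,t\<^esub>(X \<otimes> Y)\<close> that determines it. The vector space operations of the fibres are those of
  the operators; \<open>total\<close> is the total space with its Borel structure (as a measurable space, its
  measure is irrelevant).\<close>

record 'x sps =
  fibre :: "real \<Rightarrow> 'x set"
  ip :: "real \<Rightarrow> 'x \<Rightarrow> 'x \<Rightarrow> complex"
  mult :: "real \<Rightarrow> real \<Rightarrow> 'x \<Rightarrow> 'x \<Rightarrow> 'x"
  total :: "(real \<times> 'x) measure"

definition weak_operator_topology :: "'a::chilbert_space op topology" where
  "weak_operator_topology =
     pullback_topology bops (\<lambda>T (x, y). cinner (blinfun_apply T x) y) euclidean"

definition weak_operator_borel :: "'a::chilbert_space op measure" where
  "weak_operator_borel = sigma bops {S. openin weak_operator_topology S}"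

definition intertwiners ::
    "'a::chilbert_space op set \<Rightarrow> ('a op \<Rightarrow> 'a op) \<Rightarrow> 'a op set" where
  "intertwiners A \<phi> = {T \<in> bops. \<forall>m\<in>A. \<phi> m o\<^sub>L T = T o\<^sub>L m}"

definition complementary ::
    "'a::chilbert_space op set \<Rightarrow> 'a \<Rightarrow> (real \<Rightarrow> 'a op \<Rightarrow> 'a op) \<Rightarrow> real \<Rightarrow> 'a op \<Rightarrow> 'a op" where
  "complementary M \<Omega> \<alpha> t x' =
     (let J = modular_conj M \<Omega> in J o\<^sub>L \<alpha> t (J o\<^sub>L x' o\<^sub>L J) o\<^sub>L J)"

definition sps_fibre ::
    "'a::chilbert_space op set \<Rightarrow> 'a \<Rightarrow> (real \<Rightarrow> 'a op \<Rightarrow> 'a op) \<Rightarrow> real \<Rightarrow> 'a op set" where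
  "sps_fibre M \<Omega> \<alpha> t =
     intertwiners M (\<alpha> t) \<inter> intertwiners (commutant M) (complementary M \<Omega> \<alpha> t)"

definition super_product_system ::
    "'a::chilbert_space op set \<Rightarrow> 'a \<Rightarrow> (real \<Rightarrow> 'a op \<Rightarrow> 'a op) \<Rightarrow> 'a op sps" where
  "super_product_system M \<Omega> \<alpha> =
     \<lparr> fibre = sps_fibre M \<Omega> \<alpha>,
       ip = (\<lambda>t S T. THE c. adj T o\<^sub>L S = scalar_op c),
       mult = (\<lambda>s t X Y. X o\<^sub>L Y),
       total = restrict_space (borel \<Otimes>\<^sub>M weak_operator_borel)
                 {(t, X). 0 < t \<and> X \<in> sps_fibre M \<Omega> \<alpha> t} \<rparr>"

definition borel_isomorphism :: "'x measure \<Rightarrow> 'y measure \<Rightarrow> ('x \<Rightarrow> 'y) \<Rightarrow> bool" where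
  "borel_isomorphism A B F \<longleftrightarrow> bij_betw F (space A) (space B) \<and>
     F \<in> measurable A B \<and> inv_into (space A) F \<in> measurable B A"

definition fibre_unitary ::
    "'a::chilbert_space op sps \<Rightarrow> 'b::chilbert_space op sps \<Rightarrow> real \<Rightarrow> ('a op \<Rightarrow> 'b op) \<Rightarrow> bool" where
  "fibre_unitary P Q t V \<longleftrightarrow> bij_betw V (fibre P t) (fibre Q t) \<and>
     (\<forall>X\<in>fibre P t. \<forall>Y\<in>fibre P t. V (X + Y) = V X + V Y) \<and>
     (\<forall>c. \<forall>X\<in>fibre P t. V (scale_op c X) = scale_op c (V X)) \<and>
     (\<forall>X\<in>fibre P t. \<forall>Y\<in>fibre P t. ip Q t (V X) (V Y) = ip P t X Y)"

text \<open>In the last clause both sides of \<open>V\<^bsub>s+t\<^esub> U\<^bsub>s,t\<^esub> = U\<^bsub>s,t\<^esub> (V\<^sub>s \<otimes> V\<^sub>t)\<close>, which are bounded linear on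
  \<open>H\<^sub>s \<otimes> H\<^sub>t\<close>, are evaluated at the elementary tensors \<open>X \<otimes> Y\<close>.\<close>

definition sps_isomorphism ::
    "'a::chilbert_space op sps \<Rightarrow> 'b::chilbert_space op sps \<Rightarrow>
     (real \<times> 'a op \<Rightarrow> real \<times> 'b op) \<Rightarrow> bool" where
  "sps_isomorphism P Q F \<longleftrightarrow> borel_isomorphism (total P) (total Q) F \<and>
     (\<exists>V. (\<forall>t>0. fibre_unitary P Q t (V t)) \<and>
          (\<forall>t>0. \<forall>X\<in>fibre P t. F (t, X) = (t, V t X)) \<and>
          (\<forall>s>0. \<forall>t>0. \<forall>X\<in>fibre P s. \<forall>Y\<in>fibre P t.
             V (s + t) (mult P s t X Y) = mult Q s t (V s X) (V t Y)))"

definition sps_isomorphic :: "'a::chilbert_space op sps \<Rightarrow> 'b::chilbert_space op sps \<Rightarrow> bool" where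
  "sps_isomorphic P Q \<longleftrightarrow> (\<exists>F. sps_isomorphism P Q F)"

end

(* Write tau for the trace of M. A star-automorphism theta of the factor M preserves tau. Indeed, for
   x in M the vector of least norm in the closed convex hull of the unitary orbit of x, viewed in L^2(M),
   is fixed by all unitary conjugations, so it is a multiple of Omega: averages of unitary conjugates of x
   converge to tau(x) in the 2-norm. It remains to see that theta respects such limits, i.e. that theta is normal.
   If 0 <= y_k <= 1 and the sum of the tau(y_k) is finite, the inverses (1 + y_n + ... + y_N)^(-1) decrease
   with N and their limits increase with n to 1; since theta is an order isomorphism the same holds for
   their images, and this forces tau(theta(y_k)) to tend to 0.

   Hence theta = Ad W for a unitary W commuting with J. If beta is the image under theta of the
   perturbation of alpha by U, put A_t = W U_t (J U_t J); then V_t X = A_t X W* is the isomorphism.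
   Multiplicativity uses both intertwining relations of X: X U_t (J U_t J) = a (J a J) X with
   a = alpha_s(U_t). For the Borel structures, separability of the predual makes the Hilbert space
   separable, so that the weak operator Borel structure is generated by countably many coefficients,
   and A_t is strongly continuous. *)

theory Submission
  imports Defs
begin

section \<open>Complex Hilbert spaces\<close>

text \<open>\<open>star_iso\<close> is purely algebraic: nothing ties \<theta> to a weak topology or
  to \<Omega>, while the isomorphism to be built is spatial. Order is the bridge, since the algebra
  can see it. The classical route through suprema of tails meets an obstacle: partial sums whose
  traces are bounded need not be bounded in norm. Passing from S to 1 - 1/(1 + S) keeps everything
  between 0 and 1, and in the state of \<Omega> the result is still at most S. Inverses replace
  functional calculus elsewhere too: positivity is read off from invertible shifts, and unitaries
  are produced as Cayley transforms.

  The factor J U_t J in A_t serves the two halves of a fibre at once. The relation with the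
  complementary semigroup says that J X J intertwines the given semigroup as well, and A_t commutes
  with J, so each computation for X also holds for J X J.\<close>

lemma cinner_Im: "Im (cinner x y) = inner x (\<i> *\<^sub>C (y::'a::chilbert_space))"
proof -
  have "cinner x (\<i> *\<^sub>C y) = cnj (\<i> * cinner y x)"
    by (metis cinner_commute cinner_scaleC_left)
  also have "\<dots> = - \<i> * cinner x y"
    by (metis cinner_commute complex_cnj_i complex_cnj_mult)
  finally show ?thesis by (simp add: inner_eq_Re_cinner)
qed

lemma cinner_eq_inner:
  "cinner x y = Complex (inner x y) (inner x (\<i> *\<^sub>C (y::'a::chilbert_space)))"
  by (simp add: complex_eq_iff cinner_Im inner_eq_Re_cinner)

lemma cinner_self: "cinner x x = of_real ((norm (x::'a::chilbert_space))\<^sup>2)"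
proof (rule complex_eqI)
  show "Re (cinner x x) = Re (of_real ((norm x)\<^sup>2))"
    by (simp add: inner_eq_Re_cinner[symmetric] power2_norm_eq_inner)
  show "Im (cinner x x) = Im (of_real ((norm x)\<^sup>2))"
    using arg_cong[OF cinner_commute[of x x], of Im] by simp
qed

lemma cinner_scaleC_right: "cinner x (c *\<^sub>C y) = cnj c * cinner x (y::'a::chilbert_space)"
  by (metis cinner_commute cinner_scaleC_left complex_cnj_mult)

lemma cinner_add_right: "cinner x (y + z) = cinner x y + cinner x (z::'a::chilbert_space)"
  by (metis cinner_commute cinner_add_left complex_cnj_add)

lemma inner_i_left: "inner (\<i> *\<^sub>C x) (y::'a::chilbert_space) = - inner x (\<i> *\<^sub>C y)"
  by (simp add: inner_eq_Re_cinner cinner_scaleC_left cinner_scaleC_right)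

lemma scaleC_i_i [simp]: "\<i> *\<^sub>C \<i> *\<^sub>C (x::'a::chilbert_space) = - x"
  using scaleC_of_real[of "-1" x] by (simp add: scaleC_scaleC)

lemma scaleC_decomp: "c *\<^sub>C (x::'a::chilbert_space) = Re c *\<^sub>R x + Im c *\<^sub>R (\<i> *\<^sub>C x)"
proof -
  have "c *\<^sub>C x = (of_real (Re c) + of_real (Im c) * \<i>) *\<^sub>C x"
    by (metis complex_eq mult.commute)
  then show ?thesis by (simp only: scaleC_add_left scaleC_of_real scaleC_scaleC[symmetric])
qed

lemma scaleC_one [simp]: "1 *\<^sub>C (x::'a::chilbert_space) = x"
  using scaleC_of_real[of 1 x] by simp

lemma scaleC_zero_left [simp]: "0 *\<^sub>C (x::'a::chilbert_space) = 0"
  using scaleC_of_real[of 0 x] by simp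

lemma bounded_linear_scaleC: "bounded_linear (\<lambda>x::'a::chilbert_space. c *\<^sub>C x)"
  using blinfun.bounded_linear_right[of "scalar_op c"] by simp

lemmas scaleC_simps = linear_diff[OF bounded_linear.linear[OF bounded_linear_scaleC]]
  linear_neg[OF bounded_linear.linear[OF bounded_linear_scaleC]]
  linear_0[OF bounded_linear.linear[OF bounded_linear_scaleC]]
  linear_scale[OF bounded_linear.linear[OF bounded_linear_scaleC]]

lemma cinner_diff_left: "cinner (x - y) z = cinner x z - cinner y (z::'a::chilbert_space)"
  using cinner_add_left[of "x - y" y z] by simp

lemma cinner_diff_right: "cinner x (y - z) = cinner x y - cinner x (z::'a::chilbert_space)"
  using cinner_add_right[of x "y - z" z] by simp

lemma norm_cinner: "cmod (cinner x y) \<le> norm x * norm (y::'a::chilbert_space)"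
proof (cases "cinner x y = 0")
  case False
  \<comment> \<open>The phase that makes the inner product real and nonnegative, so that the real
    Cauchy-Schwarz inequality applies.\<close>
  define c where "c = cnj (cinner x y) / cmod (cinner x y)"
  have c: "cmod c = 1" using False by (simp add: c_def norm_divide)
  have "complex_of_real (cmod (cinner x y)) = cinner (c *\<^sub>C x) y"
    using False complex_norm_square[of "cinner x y"]
    by (simp add: c_def cinner_scaleC_left field_simps power2_eq_square)
  then have "cmod (cinner x y) = inner (c *\<^sub>C x) y"
    by (metis Re_complex_of_real inner_eq_Re_cinner)
  also have "\<dots> \<le> norm (c *\<^sub>C x) * norm y" by (rule norm_cauchy_schwarz)
  finally show ?thesis by (simp add: norm_scaleC c)
qed simp

lemma cinner_zero [simp]: "cinner 0 (y::'a::chilbert_space) = 0" "cinner y 0 = 0"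
  using norm_cinner[of 0 y] norm_cinner[of y 0] by auto

lemma cinner_eqI:
  assumes "\<And>z. cinner z x = cinner z (y::'a::chilbert_space)" shows "x = y"
  using assms[of "x - y"] cinner_self[of "x - y"] by (simp add: cinner_diff_right)

lemma inner_eqI:
  assumes "\<And>z. inner z x = inner z (y::'a::real_inner)" shows "x = y"
  using assms[of "x - y"] by (metis inner_diff_right inner_eq_zero_iff right_minus_eq)

lemma bounded_bilinear_cinner: "bounded_bilinear (cinner :: 'a::chilbert_space \<Rightarrow> 'a \<Rightarrow> complex)"
proof
  show "\<exists>K. \<forall>a b::'a. norm (cinner a b) \<le> norm a * norm b * K"
    by (rule exI[of _ 1]) (use norm_cinner in auto)
  show "cinner (r *\<^sub>R a) b = r *\<^sub>R cinner a b" for r and a b :: 'a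
    by (metis cinner_scaleC_left scaleC_of_real scaleR_conv_of_real)
  show "cinner a (r *\<^sub>R b) = r *\<^sub>R cinner a b" for r and a b :: 'a
    by (metis cinner_scaleC_right complex_cnj_complex_of_real scaleC_of_real scaleR_conv_of_real)
qed (rule cinner_add_left cinner_add_right)+

lemmas tendsto_cinner [tendsto_intros] = bounded_bilinear.tendsto[OF bounded_bilinear_cinner]
lemmas tendsto_scaleC [tendsto_intros] = bounded_linear.tendsto[OF bounded_linear_scaleC]

section \<open>Closed convex sets, Riesz representation and adjoints\<close>

lemma parallelogram: "(norm (x + y))\<^sup>2 + (norm (x - y))\<^sup>2 = 2 * (norm x)\<^sup>2 + 2 * (norm (y::'a::real_inner))\<^sup>2"
  by (simp add: power2_norm_eq_inner algebra_simps inner_commute)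

text \<open>The midpoint of x and y lies in \<open>C\<close>, so its norm is at least
  \<open>d\<close>; the parallelogram law does the rest. Vectors of nearly minimal norm are thus
  close together, which yields both existence and uniqueness of a minimiser.\<close>

lemma convex_norm_gap:
  fixes C :: "'a::real_inner set"
  assumes "convex C" "x \<in> C" "y \<in> C" and d: "\<And>z. z \<in> C \<Longrightarrow> d \<le> norm z" and "0 \<le> d"
  shows "(norm (x - y))\<^sup>2 \<le> 2 * (norm x)\<^sup>2 + 2 * (norm y)\<^sup>2 - 4 * d\<^sup>2"
proof -
  have "(1/2) *\<^sub>R x + (1/2) *\<^sub>R y \<in> C" using assms by (intro convexD) auto
  then have "d \<le> norm ((1/2) *\<^sub>R (x + y))" using d by (simp add: scaleR_add_right)
  then have "2 * d \<le> norm (x + y)" by simp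
  then have "(2*d)\<^sup>2 \<le> (norm (x + y))\<^sup>2" using \<open>0 \<le> d\<close> by (intro power_mono) auto
  then show ?thesis using parallelogram[of x y] by (simp add: power_mult_distrib)
qed

lemma min_norm_unique:
  fixes C :: "'a::real_inner set"
  assumes "convex C" "x \<in> C" "y \<in> C" "\<And>z. z \<in> C \<Longrightarrow> norm x \<le> norm z" "norm y = norm x"
  shows "y = x"
proof -
  have "(norm (x - y))\<^sup>2 \<le> 0"
    using convex_norm_gap[OF assms(1-4) norm_ge_zero] assms(5) by simp
  then show ?thesis by simp
qed

lemma min_norm_exists:
  fixes C :: "'a::{real_inner,complete_space} set"
  assumes C: "convex C" "closed C" "C \<noteq> {}"
  obtains x where "x \<in> C" "\<And>z. z \<in> C \<Longrightarrow> norm x \<le> norm z"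
proof -
  define d where "d = Inf (norm ` C)"
  have bdd: "bdd_below (norm ` C)" by (rule bdd_belowI[of _ 0]) auto
  have d: "d \<le> norm z" if "z \<in> C" for z using that bdd unfolding d_def by (auto intro: cInf_lower)
  have d0: "0 \<le> d" unfolding d_def using C by (intro cInf_greatest) auto
  have "\<exists>z\<in>C. norm z < d + 1 / Suc n" for n
    using cInf_lessD[of "norm ` C" "d + 1 / Suc n"] C by (auto simp: d_def)
  then obtain z where z: "\<And>n. z n \<in> C" "\<And>n. norm (z n) < d + 1 / Suc n" by metis
  have lim: "(\<lambda>n. norm (z n)) \<longlonglongrightarrow> d"
  proof (rule tendsto_sandwich[of "\<lambda>_. d"])
    show "\<forall>\<^sub>F n in sequentially. norm (z n) \<le> d + 1 / Suc n" by (intro always_eventually allI less_imp_le z)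
    show "(\<lambda>n. d + 1 / Suc n) \<longlonglongrightarrow> d"
      using tendsto_add[OF tendsto_const[of d] LIMSEQ_Suc[OF lim_1_over_n]] by simp
  qed (use d z in auto)
  have "Cauchy z"
  proof (rule metric_CauchyI)
    fix e :: real assume e: "e > 0"
    have "(\<lambda>n. (norm (z n))\<^sup>2) \<longlonglongrightarrow> d\<^sup>2" by (intro tendsto_power lim)
    \<comment> \<open>Slack e^2/4 in each of the two squares leaves exactly e^2 in
      \<open>convex_norm_gap\<close>.\<close>
    then have "\<forall>\<^sub>F n in sequentially. (norm (z n))\<^sup>2 < d\<^sup>2 + e\<^sup>2 / 4"
      using e by (intro order_tendstoD(2)) auto
    then obtain N where N: "\<And>n. n \<ge> N \<Longrightarrow> (norm (z n))\<^sup>2 < d\<^sup>2 + e\<^sup>2 / 4"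
      by (auto simp: eventually_sequentially)
    show "\<exists>N. \<forall>m\<ge>N. \<forall>n\<ge>N. dist (z m) (z n) < e"
    proof (intro exI[of _ N] allI impI)
      fix m n assume "m \<ge> N" "n \<ge> N"
      then have "(norm (z m - z n))\<^sup>2 < e\<^sup>2"
        using convex_norm_gap[OF C(1) z(1)[of m] z(1)[of n] d d0] N[of m] N[of n] by simp
      then show "dist (z m) (z n) < e" using e by (simp add: dist_norm power2_less_imp_less)
    qed
  qed
  then obtain x where x: "z \<longlonglongrightarrow> x" using Cauchy_convergent convergent_def by blast
  have "x \<in> C" using closed_sequentially[OF C(2) z(1) x] .
  moreover have "norm x = d" using LIMSEQ_unique[OF tendsto_norm[OF x] lim] .
  ultimately show ?thesis using that d by auto
qed

text \<open>The vector of least norm on the hyperplane f = 1 is orthogonal to the kernel of f, and a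
  multiple of it represents f. The real version is enough, as complex adjoints are recovered from
  real ones.\<close>

lemma riesz_representation:
  fixes f :: "'a::{real_inner,complete_space} \<Rightarrow> real"
  assumes "bounded_linear f"
  obtains z where "\<And>x. f x = inner x z"
proof (cases "\<forall>x. f x = 0")
  case True then show ?thesis using that[of 0] by simp
next
  case False
  interpret f: bounded_linear f by fact
  define C where "C = {x. f x = 1}"
  have "closed C" unfolding C_def
    by (intro closed_Collect_eq continuous_intros f.continuous_on)
  moreover have "convex C" unfolding C_def convex_alt by (auto simp: f.add f.scaleR)
  moreover obtain a where "f a \<noteq> 0" using False by auto
  then have "(1 / f a) *\<^sub>R a \<in> C" by (simp add: C_def f.scaleR)
  then have "C \<noteq> {}" by auto
  ultimately obtain z where z: "z \<in> C" "\<And>y. y \<in> C \<Longrightarrow> norm z \<le> norm y"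
    using min_norm_exists by metis
  have fz: "f z = 1" using z by (simp add: C_def)
  then have z0: "z \<noteq> 0" using f.zero by auto
  have orth: "inner x z = 0" if "f x = 0" for x
  proof (rule ccontr)
    assume n: "inner x z \<noteq> 0"
    then have xx: "inner x x > 0" by auto
    \<comment> \<open>The minimiser of the norm of z - r x; a nonzero \<open>inner x z\<close> would
      push that norm below the minimum.\<close>
    define r where "r = inner x z / inner x x"
    have "z - r *\<^sub>R x \<in> C" using fz that by (simp add: C_def f.diff f.scaleR)
    then have "(norm z)\<^sup>2 \<le> (norm (z - r *\<^sub>R x))\<^sup>2" using z(2) by (intro power_mono) auto
    also have "\<dots> = (norm z)\<^sup>2 - 2 * r * inner x z + r * (r * inner x x)"
      by (simp add: power2_norm_eq_inner inner_diff inner_commute algebra_simps)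
    also have "r * inner x x = inner x z" using xx by (simp add: r_def)
    finally have "r * inner x z \<le> 0" by simp
    moreover have "r * inner x z > 0" using n xx
      by (simp add: r_def mult_pos_pos zero_less_divide_iff) (metis not_real_square_gt_zero)
    ultimately show False by simp
  qed
  have "f x = inner x ((1 / inner z z) *\<^sub>R z)" for x
  proof -
    have "inner (x - f x *\<^sub>R z) z = 0" by (rule orth) (simp add: f.diff f.scaleR fz)
    then show ?thesis using z0 by (simp add: inner_diff_left)
  qed
  then show ?thesis by (rule that)
qed

lemma bops_scaleC: "T \<in> bops \<Longrightarrow> blinfun_apply T (c *\<^sub>C x) = c *\<^sub>C T x"
  by (simp add: bops_def)

text \<open>Real-linearity is built into the type, so commuting with \<i> suffices.\<close>

lemma bopsI: "(\<And>x. blinfun_apply T (\<i> *\<^sub>C x) = \<i> *\<^sub>C T x) \<Longrightarrow> T \<in> bops"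
  unfolding bops_def
proof (safe)
  fix c x assume "\<And>x. blinfun_apply T (\<i> *\<^sub>C x) = \<i> *\<^sub>C T x"
  then show "blinfun_apply T (c *\<^sub>C x) = c *\<^sub>C blinfun_apply T x"
    by (subst (1 2) scaleC_decomp) (simp add: blinfun.add_right blinfun.scaleR_right)
qed

lemma real_adjoint_exists:
  fixes T :: "'a::{real_inner,complete_space} \<Rightarrow>\<^sub>L 'a"
  obtains S :: "'a \<Rightarrow>\<^sub>L 'a" where "\<And>x y. inner (T x) y = inner x (S y)"
proof -
  have "\<exists>z. \<forall>x. inner (T x) y = inner x z" for y
    using riesz_representation[of "\<lambda>x. inner (T x) y"]
    by (metis bounded_linear_compose[OF bounded_linear_inner_left blinfun.bounded_linear_right])
  then obtain g where g: "\<And>x y. inner (T x) y = inner x (g y)" by metis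
  have "bounded_linear g"
  proof (rule bounded_linear_intro)
    show "g (x + y) = g x + g y" for x y
      by (rule inner_eqI) (simp add: inner_add_right g[symmetric])
    show "g (r *\<^sub>R x) = r *\<^sub>R g x" for r x
      by (rule inner_eqI) (simp add: g[symmetric])
    show "norm (g x) \<le> norm x * norm T" for x
    proof (cases "g x = 0")
      case False
      have "norm (g x) * norm (g x) = inner (T (g x)) x"
        by (simp add: g power2_norm_eq_inner[symmetric] power2_eq_square)
      also have "\<dots> \<le> norm (T (g x)) * norm x" by (rule norm_cauchy_schwarz)
      also have "\<dots> \<le> (norm T * norm (g x)) * norm x"
        by (intro mult_right_mono norm_blinfun) auto
      finally show ?thesis using False by (simp add: mult.commute mult.left_commute)
    qed simp
  qed
  then show ?thesis using that[of "Blinfun g"] g by (simp add: bounded_linear_Blinfun_apply)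
qed

lemma adj_unique:
  assumes "S \<in> bops" "\<And>x y. cinner (blinfun_apply T x) y = cinner x (blinfun_apply S y)"
  shows "adj T = S"
  unfolding adj_def
proof (rule the_equality)
  fix R assume "R \<in> bops \<and> (\<forall>x y. cinner (blinfun_apply T x) y = cinner x (blinfun_apply R y))"
  then show "R = S" by (intro blinfun_eqI cinner_eqI) (metis assms(2))
qed (use assms in auto)

text \<open>\<open>adj\<close> is a definite description, so a complex adjoint has to be produced.
  The real adjoint is complex-linear because \<i> is skew for the real inner product; it is then the
  complex adjoint because \<open>cinner\<close> is determined by \<open>inner\<close>.\<close>

lemma adj_props:
  fixes T :: "'a::chilbert_space op"
  assumes "T \<in> bops"
  shows "adj T \<in> bops" and adj_cinner: "cinner (T x) y = cinner x (adj T y)"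
proof -
  obtain S :: "'a op" where S: "\<And>x y. inner (T x) y = inner x (S y)"
    using real_adjoint_exists by metis
  have *: "S \<in> bops"
  proof (rule bopsI, rule inner_eqI)
    fix x z
    have "inner z (blinfun_apply S (\<i> *\<^sub>C x)) = - inner (\<i> *\<^sub>C T z) x"
      by (simp add: S[symmetric] inner_i_left)
    also have "\<dots> = inner z (\<i> *\<^sub>C S x)"
      by (simp add: bops_scaleC[OF assms, symmetric] S inner_i_left)
    finally show "inner z (blinfun_apply S (\<i> *\<^sub>C x)) = inner z (\<i> *\<^sub>C blinfun_apply S x)" .
  qed
  have **: "cinner (T x) y = cinner x (S y)" for x y
    by (simp add: cinner_eq_inner S bops_scaleC[OF *])
  show "adj T \<in> bops" "cinner (T x) y = cinner x (adj T y)"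
    using * ** adj_unique[OF * **] by auto
qed

lemma adj_inner: "T \<in> bops \<Longrightarrow> inner (blinfun_apply T x) y = inner x (blinfun_apply (adj T) y)"
  by (simp add: inner_eq_Re_cinner adj_cinner)

lemma adj_cinner2: "T \<in> bops \<Longrightarrow> cinner x (blinfun_apply T y) = cinner (blinfun_apply (adj T) x) y"
  by (metis adj_cinner cinner_commute)

lemma adj_inner2: "T \<in> bops \<Longrightarrow> inner x (blinfun_apply T y) = inner (blinfun_apply (adj T) x) y"
  by (simp add: inner_eq_Re_cinner adj_cinner2)

lemma adj_uniqueR:
  assumes "S \<in> bops" "T \<in> bops" "\<And>x y. inner (blinfun_apply T x) y = inner x (blinfun_apply S y)"
  shows "adj T = S"
  using assms by (intro adj_unique) (simp_all add: cinner_eq_inner bops_scaleC)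

lemma scalar_op_bops [simp]: "scalar_op c \<in> bops"
  by (rule bopsI) (simp add: scaleC_scaleC mult.commute)

lemma bops_compose [simp]: "S \<in> bops \<Longrightarrow> T \<in> bops \<Longrightarrow> S o\<^sub>L T \<in> bops"
  by (rule bopsI) (simp add: bops_scaleC)
lemma bops_add [simp]: "S \<in> bops \<Longrightarrow> T \<in> bops \<Longrightarrow> S + T \<in> bops"
  by (rule bopsI) (simp add: bops_scaleC blinfun.add_left scaleC_add_right)
lemma bops_diff [simp]: "S \<in> bops \<Longrightarrow> T \<in> bops \<Longrightarrow> S - T \<in> bops"
  by (rule bopsI) (simp add: bops_scaleC blinfun.diff_left scaleC_simps)
lemma bops_id [simp]: "id_blinfun \<in> bops" by (rule bopsI) simp
lemma bops_scale_op [simp]: "T \<in> bops \<Longrightarrow> scale_op c T \<in> bops"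
  by (simp add: scale_op_def)

lemma scale_op_apply [simp]: "blinfun_apply (scale_op c T) x = c *\<^sub>C T x"
  by (simp add: scale_op_def)

lemma adj_adj [simp]: "T \<in> bops \<Longrightarrow> adj (adj T) = T"
  by (rule adj_unique) (simp_all add: adj_cinner2)
lemma adj_compose: "S \<in> bops \<Longrightarrow> T \<in> bops \<Longrightarrow> adj (S o\<^sub>L T) = adj T o\<^sub>L adj S"
  by (rule adj_unique) (simp_all add: adj_cinner adj_props)
lemma adj_add: "S \<in> bops \<Longrightarrow> T \<in> bops \<Longrightarrow> adj (S + T) = adj S + adj T"
  by (rule adj_unique)
    (simp_all add: adj_cinner adj_props blinfun.add_left cinner_add_left cinner_add_right)
lemma adj_diff: "S \<in> bops \<Longrightarrow> T \<in> bops \<Longrightarrow> adj (S - T) = adj S - adj T"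
  by (rule adj_unique)
    (simp_all add: adj_cinner adj_props blinfun.diff_left cinner_diff_left cinner_diff_right)
lemma adj_id [simp]: "adj id_blinfun = id_blinfun"
  by (rule adj_unique) simp_all
lemma adj_scale_op: "T \<in> bops \<Longrightarrow> adj (scale_op c T) = scale_op (cnj c) (adj T)"
  by (rule adj_unique) (simp_all add: adj_cinner adj_props cinner_scaleC_left cinner_scaleC_right)

lemma unitary_bops: "is_unitary u \<Longrightarrow> u \<in> bops" by (simp add: is_unitary_def)

lemma unitary_apply:
  assumes "is_unitary u"
  shows "blinfun_apply (adj u) (u x) = x" "blinfun_apply u (adj u x) = x"
  using assms unfolding is_unitary_def
  by (metis blinfun_apply_blinfun_compose id_blinfun.rep_eq id_apply)+

lemma unitary_norm: assumes "is_unitary u" shows "norm (blinfun_apply u x) = norm x"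
  using assms by (simp add: norm_eq_sqrt_inner adj_inner unitary_bops unitary_apply)

lemma unitary_adj: "is_unitary u \<Longrightarrow> is_unitary (adj u)"
  by (auto simp: is_unitary_def adj_props)

section \<open>Density arguments\<close>

lemma linear_apply_vector: "linear (\<lambda>T. blinfun_apply T v)"
  by (rule linearI) (auto simp: blinfun.add_left blinfun.scaleR_left)

lemma scaleR_eq_scale_op: "r *\<^sub>R T = scale_op (of_real r) T"
  by (rule blinfun_eqI) (simp add: scaleC_of_real blinfun.scaleR_left)

lemma dense_sequence:
  assumes "closure S = (UNIV :: 'a::real_normed_vector set)"
  obtains u where "\<And>n. u n \<in> S" "u \<longlonglongrightarrow> x"
  using assms closure_sequential[of x S] by auto

lemma blinfun_eq_dense:
  assumes "closure S = UNIV" "\<And>s. s \<in> S \<Longrightarrow> blinfun_apply A s = blinfun_apply B s"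
  shows "A = B"
proof (rule blinfun_eqI)
  fix x
  obtain u where u: "\<And>n. u n \<in> S" "u \<longlonglongrightarrow> x" using dense_sequence[OF assms(1)] by metis
  have "(\<lambda>n. A (u n)) \<longlonglongrightarrow> A x" "(\<lambda>n. B (u n)) \<longlonglongrightarrow> B x"
    by (intro tendsto_intros u)+
  then show "A x = B x" using u assms(2) LIMSEQ_unique by auto
qed

text \<open>The bound forces g to depend on f x only and makes the induced map Lipschitz on a dense
  subspace. The separate parameter space accommodates maps such as x \<Omega> \<mapsto> \<theta> x
  \<Omega>, where g is additive only on \<open>M\<close>.\<close>

lemma blinfun_extension:
  fixes f :: "'c::real_vector \<Rightarrow> 'a::real_normed_vector" and g :: "'c \<Rightarrow> 'b::{real_normed_vector,complete_space}"
  assumes M: "subspace M" and f: "linear f"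
    and g_add: "\<And>x y. x \<in> M \<Longrightarrow> y \<in> M \<Longrightarrow> g (x + y) = g x + g y"
    and g_scale: "\<And>r x. x \<in> M \<Longrightarrow> g (r *\<^sub>R x) = r *\<^sub>R g x"
    and le: "\<And>x. x \<in> M \<Longrightarrow> norm (g x) \<le> C * norm (f x)" and "0 \<le> C"
    and dense: "closure (f ` M) = UNIV"
  obtains T where "\<And>x. x \<in> M \<Longrightarrow> blinfun_apply T (f x) = g x"
proof -
  have g_diff: "g (x - y) = g x - g y" if "x \<in> M" "y \<in> M" for x y
  proof -
    have "g (x + (-1) *\<^sub>R y) = g x + (-1) *\<^sub>R g y"
      using that M by (metis g_add g_scale subspace_scale)
    then show ?thesis by simp
  qed
  have gd: "dist (g x) (g y) \<le> C * dist (f x) (f y)" if "x \<in> M" "y \<in> M" for x y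
    using le[of "x - y"] that M by (simp add: dist_norm g_diff subspace_diff linear_diff[OF f])
  \<comment> \<open>An arbitrary preimage; \<open>hf\<close> shows that the choice is
    immaterial.\<close>
  define h where "h = (\<lambda>y. g (SOME x. x \<in> M \<and> f x = y))"
  have hf: "h (f x) = g x" if "x \<in> M" for x
  proof -
    define z where "z = (SOME z. z \<in> M \<and> f z = f x)"
    have "z \<in> M \<and> f z = f x" unfolding z_def by (rule someI[of _ x]) (use that in auto)
    then have "dist (g z) (g x) \<le> 0" using gd[of z x] that by simp
    then show ?thesis by (simp add: h_def z_def)
  qed
  have "uniformly_continuous_on (f ` M) h"
    unfolding uniformly_continuous_on_def
  proof (intro allI impI)
    fix e :: real assume e: "e > 0"
    show "\<exists>d>0. \<forall>x\<in>f ` M. \<forall>x'\<in>f ` M. dist x' x < d \<longrightarrow> dist (h x') (h x) < e"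
    proof (intro exI[of _ "e / (C + 1)"] conjI ballI impI)
      show "e / (C + 1) > 0" using e \<open>0 \<le> C\<close> by simp
      fix x x' assume "x \<in> f ` M" "x' \<in> f ` M" and d: "dist x' x < e / (C + 1)"
      then obtain y y' where y: "y \<in> M" "y' \<in> M" "x = f y" "x' = f y'" by auto
      have "dist (h x') (h x) \<le> C * dist x' x" using gd[of y' y] y by (simp add: hf)
      also have "\<dots> \<le> (C + 1) * dist x' x" by (intro mult_right_mono) auto
      also have "\<dots> < e" using d \<open>0 \<le> C\<close> by (simp add: field_simps)
      finally show "dist (h x') (h x) < e" .
    qed
  qed
  then obtain k where k: "uniformly_continuous_on (closure (f ` M)) k"
      "\<And>x. x \<in> f ` M \<Longrightarrow> h x = k x"
    using uniformly_continuous_on_extension_on_closure[of "f ` M" h] by metis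
  have kf: "k (f x) = g x" if "x \<in> M" for x using k(2)[of "f x"] hf that by auto
  have cont: "isCont k x" for x
    using uniformly_continuous_imp_continuous[OF k(1)] dense
    by (simp add: continuous_on_eq_continuous_at)
  have app: "\<exists>u. (\<forall>n. u n \<in> M) \<and> (\<lambda>n. f (u n)) \<longlonglongrightarrow> x \<and> (\<lambda>n. g (u n)) \<longlonglongrightarrow> k x" for x
  proof -
    obtain v where v: "\<And>n. v n \<in> f ` M" "v \<longlonglongrightarrow> x" using dense_sequence[OF dense] by metis
    then have "\<forall>n. \<exists>w. w \<in> M \<and> v n = f w" by auto
    then obtain u where u: "\<And>n. u n \<in> M" "\<And>n. v n = f (u n)" by metis
    have "(\<lambda>n. k (v n)) \<longlonglongrightarrow> k x" by (rule isCont_tendsto_compose[OF cont v(2)])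
    moreover have "v = (\<lambda>n. f (u n))" using u by auto
    ultimately show ?thesis using u v by (intro exI[of _ u]) (simp add: kf)
  qed
  have "bounded_linear k"
  proof (rule bounded_linear_intro)
    fix x y
    obtain u v where u: "\<And>n. u n \<in> M" "(\<lambda>n. f (u n)) \<longlonglongrightarrow> x" "(\<lambda>n. g (u n)) \<longlonglongrightarrow> k x"
      and v: "\<And>n. v n \<in> M" "(\<lambda>n. f (v n)) \<longlonglongrightarrow> y" "(\<lambda>n. g (v n)) \<longlonglongrightarrow> k y"
      using app by metis
    have "(\<lambda>n. k (f (u n + v n))) \<longlonglongrightarrow> k (x + y)"
      by (rule isCont_tendsto_compose[OF cont])
        (use tendsto_add[OF u(2) v(2)] in \<open>simp add: linear_add[OF f]\<close>)
    moreover have "(\<lambda>n. k (f (u n + v n))) \<longlonglongrightarrow> k x + k y"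
      using tendsto_add[OF u(3) v(3)] u v M by (simp add: kf subspace_add g_add)
    ultimately show "k (x + y) = k x + k y" by (rule LIMSEQ_unique)
    fix r
    have "(\<lambda>n. k (f (r *\<^sub>R u n))) \<longlonglongrightarrow> k (r *\<^sub>R x)"
      by (rule isCont_tendsto_compose[OF cont])
        (use tendsto_scaleR[OF tendsto_const u(2)] in \<open>simp add: linear_scale[OF f]\<close>)
    moreover have "(\<lambda>n. k (f (r *\<^sub>R u n))) \<longlonglongrightarrow> r *\<^sub>R k x"
      using tendsto_scaleR[OF tendsto_const u(3)] u M by (simp add: kf subspace_scale g_scale)
    ultimately show "k (r *\<^sub>R x) = r *\<^sub>R k x" by (rule LIMSEQ_unique)
    show "norm (k x) \<le> norm x * C"
    proof (rule LIMSEQ_le[OF tendsto_norm[OF u(3)]])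
      show "(\<lambda>n. norm (f (u n)) * C) \<longlonglongrightarrow> norm x * C" by (intro tendsto_intros u)
      show "\<exists>N. \<forall>n\<ge>N. norm (g (u n)) \<le> norm (f (u n)) * C"
        using le u by (auto simp: mult.commute)
    qed
  qed
  then show ?thesis
    using that[of "Blinfun k"] kf by (simp add: bounded_linear_Blinfun_apply)
qed

section \<open>Positive operators\<close>

definition hermitian :: "'a::chilbert_space op \<Rightarrow> bool" where
  "hermitian T \<longleftrightarrow> T \<in> bops \<and> adj T = T"

text \<open>Hermitian has to be demanded separately: \<open>inner\<close> is only a real part, and
  the form of a skew-adjoint operator vanishes under it.\<close>

definition nonneg_op :: "'a::chilbert_space op \<Rightarrow> bool" where
  "nonneg_op T \<longleftrightarrow> hermitian T \<and> (\<forall>x. 0 \<le> inner (blinfun_apply T x) x)"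

lemma hermitian_inner: "hermitian T \<Longrightarrow> inner (blinfun_apply T x) y = inner x (blinfun_apply T y)"
  by (metis adj_inner hermitian_def)

lemma hermitianI:
  "T \<in> bops \<Longrightarrow> (\<And>x y. inner (blinfun_apply T x) y = inner x (blinfun_apply T y)) \<Longrightarrow> hermitian T"
  by (simp add: hermitian_def adj_uniqueR)

lemma hermitian_bops: "hermitian T \<Longrightarrow> T \<in> bops" by (simp add: hermitian_def)

lemma hermitian_simps [simp]:
  "hermitian S \<Longrightarrow> hermitian T \<Longrightarrow> hermitian (S + T)"
  "hermitian S \<Longrightarrow> hermitian T \<Longrightarrow> hermitian (S - T)"
  "hermitian id_blinfun"
  by (auto simp: hermitian_def adj_add adj_diff)

lemma bops_scaleR [simp]: "T \<in> bops \<Longrightarrow> r *\<^sub>R T \<in> bops"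
  by (rule bopsI) (simp add: bops_scaleC blinfun.scaleR_left scaleC_simps)

lemma bops_zero [simp]: "0 \<in> bops" by (rule bopsI) (simp add: scaleC_simps)

lemma hermitian_scaleR [simp]: "hermitian T \<Longrightarrow> hermitian (r *\<^sub>R T)"
  by (rule hermitianI) (auto simp: hermitian_bops blinfun.scaleR_left hermitian_inner)

lemma nonneg_opD:
  assumes "nonneg_op T" shows "hermitian T" "T \<in> bops" "0 \<le> inner (blinfun_apply T x) x"
  using assms by (auto simp: nonneg_op_def hermitian_def)

lemma nonneg_op_zero [simp]: "nonneg_op 0"
  by (auto simp: nonneg_op_def intro!: hermitianI)

lemma nonneg_op_id [simp]: "nonneg_op id_blinfun"
  by (auto simp: nonneg_op_def)

lemma nonneg_op_add: "nonneg_op S \<Longrightarrow> nonneg_op T \<Longrightarrow> nonneg_op (S + T)"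
  by (auto simp: nonneg_op_def blinfun.add_left inner_add_left)

lemma nonneg_op_scaleR: "nonneg_op T \<Longrightarrow> 0 \<le> r \<Longrightarrow> nonneg_op (r *\<^sub>R T)"
  by (auto simp: nonneg_op_def blinfun.scaleR_left)

lemma nonneg_op_sum: "(\<And>i. i \<in> I \<Longrightarrow> nonneg_op (f i)) \<Longrightarrow> nonneg_op (sum f I)"
  by (induction I rule: infinite_finite_induct) (auto intro: nonneg_op_add)

lemma nonneg_op_adj_comp: "x \<in> bops \<Longrightarrow> nonneg_op (adj x o\<^sub>L x)"
  by (simp add: nonneg_op_def hermitian_def adj_compose adj_props adj_inner2[symmetric] inner_commute[of "blinfun_apply (adj x) _"])
    (simp add: adj_inner[symmetric])

lemma norm_sq_diff_scaleR:
  "(norm (x - r *\<^sub>R y))\<^sup>2 = (norm x)\<^sup>2 - 2 * r * inner x y + r\<^sup>2 * (norm (y::'a::real_inner))\<^sup>2"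
  unfolding power2_norm_eq_inner
  by (simp add: inner_diff inner_commute power2_eq_square algebra_simps)

text \<open>Cauchy-Schwarz for the form of T without square roots: evaluate the form at
  \<open>x - (1/K) *\<^sub>R T x\<close>. With step 1/K the quadratic term costs at most half of the
  linear gain.\<close>

lemma nonneg_norm_sq:
  assumes T: "nonneg_op T" and K: "\<And>y. inner (blinfun_apply T y) y \<le> K * (norm y)\<^sup>2" "K > 0"
  shows "(norm (blinfun_apply T x))\<^sup>2 \<le> K * inner (blinfun_apply T x) x"
proof -
  have "0 \<le> inner (T (x - (1/K) *\<^sub>R T x)) (x - (1/K) *\<^sub>R T x)" using T by (rule nonneg_opD)
  also have "\<dots> = inner (T x) x - 2 / K * (norm (T x))\<^sup>2 + (1/K)\<^sup>2 * inner (T (T x)) (T x)"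
    using hermitian_inner[OF nonneg_opD(1)[OF T], of x "T x"]
    unfolding power2_norm_eq_inner
    by (simp add: blinfun.diff_right blinfun.scaleR_right inner_diff
        power2_eq_square inner_commute algebra_simps)
  also have "(1/K)\<^sup>2 * inner (T (T x)) (T x) \<le> (1/K)\<^sup>2 * (K * (norm (T x))\<^sup>2)"
    by (intro mult_left_mono K) auto
  finally have "0 \<le> inner (T x) x - (norm (T x))\<^sup>2 / K"
    using K(2) by (simp add: field_simps power2_eq_square)
  then show ?thesis using K(2) by (simp add: field_simps)
qed

lemma nonneg_contraction_norm_sq:
  assumes "nonneg_op T" "nonneg_op (id_blinfun - T)"
  shows "(norm (blinfun_apply T x))\<^sup>2 \<le> inner (blinfun_apply T x) x"
proof -
  have "inner (T y) y \<le> 1 * (norm y)\<^sup>2" for y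
    using nonneg_opD(3)[OF assms(2), of y]
    by (simp add: blinfun.diff_left inner_diff_left power2_norm_eq_inner)
  from nonneg_norm_sq[OF assms(1) this] show ?thesis by simp
qed

lemma blinfun_inner_le: "inner (blinfun_apply T x) x \<le> norm T * (norm (x::'a::real_inner))\<^sup>2"
proof -
  have "inner (T x) x \<le> norm (T x) * norm x" by (rule norm_cauchy_schwarz)
  also have "\<dots> \<le> (norm T * norm x) * norm x" by (intro mult_right_mono norm_blinfun) auto
  finally show ?thesis by (simp add: power2_eq_square)
qed

text \<open>A case of the quadratic bound with K = \<open>norm T + 1\<close>; the summand 1 keeps K
  positive when T = 0.\<close>

lemma nonneg_kernel:
  assumes "nonneg_op T" "inner (blinfun_apply T x) x = 0" shows "blinfun_apply T x = 0"
proof -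
  have "inner (T y) y \<le> (norm T + 1) * (norm y)\<^sup>2" for y
    by (rule order_trans[OF blinfun_inner_le mult_right_mono]) auto
  from nonneg_norm_sq[OF assms(1) this, of x] show ?thesis
    using assms(2) by (simp add: add_nonneg_pos)
qed

text \<open>Lax-Milgram: T x = y is solved by the fixed point of x \<mapsto> x - (T x - y) / k,
  which is a contraction for large k.\<close>

lemma coercive_inverse:
  fixes T :: "'a::chilbert_space op"
  assumes T: "T \<in> bops" and c: "\<And>x. inner (T x) x \<ge> c * (norm x)\<^sup>2" "c > 0"
  obtains S where "S \<in> bops" "T o\<^sub>L S = id_blinfun" "S o\<^sub>L T = id_blinfun"
proof -
  \<comment> \<open>The squared contraction factor is at most 1 - 2 c / k + (norm T)^2 / k^2, hence
    at most 1 - c / k once (norm T)^2 \<le> k c. The extra c^2 gives k \<ge> c > 0, so that 1 - c /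
    k lies in [0, 1).\<close>
  define k where "k = ((norm T)\<^sup>2 + c\<^sup>2) / c"
  have s: "(norm T)\<^sup>2 + c\<^sup>2 > 0" using c(2) by (intro add_nonneg_pos) auto
  have k: "k > 0" "(norm T)\<^sup>2 \<le> k * c" using s c(2) by (auto simp: k_def)
  moreover have "c \<le> k" using c(2) by (simp add: k_def field_simps power2_eq_square)
  ultimately have k: "k > 0" "(norm T)\<^sup>2 \<le> k * c" "c / k \<le> 1" by auto
  define q where "q = sqrt (1 - c / k)"
  have q: "0 \<le> q" "q < 1" using k c(2) by (auto simp: q_def)
  have contr: "norm (x - (1/k) *\<^sub>R T x) \<le> q * norm x" for x
  proof (rule power2_le_imp_le)
    have "(norm (x - (1/k) *\<^sub>R T x))\<^sup>2 = (norm x)\<^sup>2 - 2 / k * inner (T x) x + (1/k)\<^sup>2 * (norm (T x))\<^sup>2"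
      by (simp add: norm_sq_diff_scaleR inner_commute)
    also have "\<dots> \<le> (norm x)\<^sup>2 - 2 / k * (c * (norm x)\<^sup>2) + (1/k)\<^sup>2 * (k * c * (norm x)\<^sup>2)"
    proof (intro add_mono diff_mono mult_left_mono c)
      have "(norm (T x))\<^sup>2 \<le> (norm T * norm x)\<^sup>2" by (intro power_mono norm_blinfun) auto
      also have "\<dots> \<le> k * c * (norm x)\<^sup>2"
        by (simp add: power_mult_distrib mult_right_mono k)
      finally show "(norm (T x))\<^sup>2 \<le> k * c * (norm x)\<^sup>2" .
    qed (use k in auto)
    also have "\<dots> = (q * norm x)\<^sup>2"
      using k by (simp add: q_def power_mult_distrib field_simps power2_eq_square)
    finally show "(norm (x - (1/k) *\<^sub>R T x))\<^sup>2 \<le> (q * norm x)\<^sup>2" .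
  qed (use q in auto)
  have "\<exists>!x. x - (1/k) *\<^sub>R (T x - y) = x" for y
  proof (rule banach_fix_type[OF q], intro allI)
    fix x z
    show "dist (x - (1/k) *\<^sub>R (T x - y)) (z - (1/k) *\<^sub>R (T z - y)) \<le> q * dist x z"
      using contr[of "x - z"] by (simp add: dist_norm blinfun.diff_right algebra_simps)
  qed
  then have ex: "\<exists>!x. T x = y" for y using k by simp
  define g where "g y = (THE x. T x = y)" for y
  have Tg: "T (g y) = y" for y using theI'[OF ex] by (simp add: g_def)
  have gT: "g (T x) = x" for x using ex Tg by metis
  have bl: "bounded_linear g"
  proof (rule bounded_linear_intro)
    show "g (x + y) = g x + g y" for x y
      using gT[of "g x + g y"] by (simp add: blinfun.add_right Tg)
    show "g (r *\<^sub>R x) = r *\<^sub>R g x" for r x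
      using gT[of "r *\<^sub>R g x"] by (simp add: blinfun.scaleR_right Tg)
    show "norm (g x) \<le> norm x * (1 / c)" for x
    proof (cases "g x = 0")
      case False
      have "c * (norm (g x))\<^sup>2 \<le> inner (T (g x)) (g x)" by (rule c)
      also have "\<dots> \<le> norm x * norm (g x)" by (simp add: Tg norm_cauchy_schwarz)
      finally show ?thesis using False c(2) by (simp add: field_simps power2_eq_square)
    qed (use c in auto)
  qed
  have "Blinfun g \<in> bops"
  proof (rule bopsI)
    fix x
    show "blinfun_apply (Blinfun g) (\<i> *\<^sub>C x) = \<i> *\<^sub>C blinfun_apply (Blinfun g) x"
      using gT[of "\<i> *\<^sub>C g x"] by (simp add: bounded_linear_Blinfun_apply[OF bl] bops_scaleC[OF T] Tg)
  qed
  then show ?thesis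
    by (rule that) (auto intro!: blinfun_eqI simp: bounded_linear_Blinfun_apply[OF bl] Tg gT)
qed

text \<open>The variational formula for the quadratic form of an inverse; it makes inversion antitone.\<close>

lemma inverse_variational:
  assumes a: "nonneg_op a" and r: "a o\<^sub>L r = id_blinfun"
  shows "2 * inner x y - inner (blinfun_apply a y) y \<le> inner (blinfun_apply r x) x"
proof -
  have ar: "a (r x) = x" for x using r by (metis blinfun_apply_blinfun_compose id_blinfun.rep_eq id_apply)
  have "0 \<le> inner (a (y - r x)) (y - r x)" using a by (rule nonneg_opD)
  also have "\<dots> = inner (a y) y - 2 * inner x y + inner (r x) x"
    using nonneg_opD(1)[OF a]
    by (simp add: blinfun.diff_right inner_diff hermitian_inner ar inner_commute)
  finally show ?thesis by simp
qed

text \<open>The case of equality, y = r x, of the variational formula.\<close>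

lemma inverse_attained:
  assumes r: "a o\<^sub>L r = id_blinfun"
  shows "inner (blinfun_apply r x) x = 2 * inner x (blinfun_apply r x) - inner (blinfun_apply a (r x)) (r x)"
proof -
  have ar: "a (r x) = x" for x using r by (metis blinfun_apply_blinfun_compose id_blinfun.rep_eq id_apply)
  show ?thesis by (simp add: ar inner_commute)
qed

lemma inverse_hermitian:
  assumes a: "hermitian a" and r: "a o\<^sub>L r = id_blinfun" "r \<in> bops"
  shows "hermitian r"
proof (rule hermitianI[OF r(2)])
  have ar: "a (r x) = x" for x using r by (metis blinfun_apply_blinfun_compose id_blinfun.rep_eq id_apply)
  fix x y
  show "inner (r x) y = inner x (r y)" using hermitian_inner[OF a, of "r x" "r y"] by (simp add: ar)
qed

text \<open>Test the formula for \<open>ra\<close> with y = \<open>rb x\<close>, where the one for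
  \<open>rb\<close> is attained; replacing b by the smaller a only raises the value.\<close>

lemma inverse_antimono:
  assumes a: "nonneg_op a" "a o\<^sub>L ra = id_blinfun" "ra \<in> bops"
    and b: "nonneg_op (b - a)" "b o\<^sub>L rb = id_blinfun" "rb \<in> bops"
  shows "nonneg_op (ra - rb)"
proof -
  have "hermitian b" using hermitian_simps(1)[OF nonneg_opD(1)[OF b(1)] nonneg_opD(1)[OF a(1)]] by simp
  then have "hermitian (ra - rb)"
    by (intro hermitian_simps(2) inverse_hermitian[OF nonneg_opD(1)[OF a(1)] a(2,3)]
        inverse_hermitian[OF _ b(2,3)])
  moreover have "inner (rb x) x \<le> inner (ra x) x" for x
    using inverse_variational[OF a(1,2), of x "rb x"] nonneg_opD(3)[OF b(1), of "rb x"]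
      inverse_attained[OF b(2), of x]
    by (simp add: blinfun.diff_left inner_diff_left)
  ultimately show ?thesis by (simp add: nonneg_op_def blinfun.diff_left inner_diff_left)
qed

text \<open>For numbers, y \<le> 3 y / (1 + y) when 0 \<le> y \<le> 1. The optimal constant is 2;
  with 3, the substitution x = e + y e turns the claim into 2 <y e, e> + |y e|^2 - <y (y e), y e>
  \<ge> 0, which is immediate from 0 \<le> y \<le> 1.\<close>

lemma inverse_one_plus:
  assumes y: "nonneg_op y" "nonneg_op (id_blinfun - y)"
    and r: "r o\<^sub>L (id_blinfun + y) = id_blinfun" "(id_blinfun + y) o\<^sub>L r = id_blinfun" "r \<in> bops"
  shows "nonneg_op (3 *\<^sub>R (id_blinfun - r) - y)"
proof -
  have "hermitian r"
    by (rule inverse_hermitian[OF _ r(2,3)]) (use y in \<open>auto simp: nonneg_op_def\<close>)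
  then have "hermitian (3 *\<^sub>R (id_blinfun - r) - y)" using y by (simp add: nonneg_op_def)
  moreover have "0 \<le> inner (blinfun_apply (3 *\<^sub>R (id_blinfun - r) - y) x) x" for x
  proof -
    define e where "e = r x"
    have x: "x = e + y e"
      using arg_cong[OF r(2), of "\<lambda>f. blinfun_apply f x"] by (simp add: blinfun.add_left e_def)
    have "inner (blinfun_apply (3 *\<^sub>R (id_blinfun - r) - y) x) x = 3 * inner (x - e) x - inner (y x) x"
      by (simp add: blinfun.diff_left blinfun.scaleR_left inner_diff_left e_def)
    also have "\<dots> = 3 * inner (y e) (e + y e) - inner (y e + y (y e)) (e + y e)"
      by (simp add: x blinfun.add_right)
    finally have eq: "inner (blinfun_apply (3 *\<^sub>R (id_blinfun - r) - y) x) x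
      = 3 * inner (y e) (e + y e) - inner (y e + y (y e)) (e + y e)" .
    have h: "inner (y u) v = inner u (y v)" for u v using y by (simp add: nonneg_op_def hermitian_inner)
    have "inner (y (y e)) (y e) \<le> inner (y e) (y e)"
      using nonneg_opD(3)[OF y(2), of "y e"] by (simp add: blinfun.diff_left inner_diff_left)
    moreover have "0 \<le> inner (y e) e" using y(1) by (rule nonneg_opD)
    ultimately show ?thesis
      unfolding eq by (simp add: inner_add h inner_commute)
  qed
  ultimately show ?thesis by (simp add: nonneg_op_def)
qed

text \<open>The infimum of the form over unit vectors is an approximate eigenvalue of b. Were it
  some m < 0, then b - m would not be bounded below, although the hypothesis for e = -m gives it a
  left inverse.\<close>

lemma nonneg_of_invertible:
  assumes b: "hermitian b"
    and inv: "\<And>e. e > 0 \<Longrightarrow> \<exists>S. S o\<^sub>L (b + e *\<^sub>R id_blinfun) = id_blinfun"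
  shows "nonneg_op b"
proof (rule ccontr)
  assume "\<not> nonneg_op b"
  then obtain x0 where x0: "inner (b x0) x0 < 0" using b by (auto simp: nonneg_op_def not_le)
  then have x00: "x0 \<noteq> 0" by auto
  define N where "N = (\<lambda>x. inner (b x) x) ` {x. norm x = 1}"
  have bdd: "bdd_below N"
  proof (rule bdd_belowI)
    fix v assume "v \<in> N"
    then obtain x where x: "v = inner (b x) x" "norm x = 1" by (auto simp: N_def)
    show "- norm b \<le> v" using blinfun_inner_le[of "- b" x] x by (simp add: blinfun.minus_left)
  qed
  define m where "m = Inf N"
  define u where "u = (1 / norm x0) *\<^sub>R x0"
  have u: "norm u = 1" "inner (b u) u < 0"
    using x0 x00 by (auto simp: u_def blinfun.scaleR_right mult_pos_neg divide_less_0_iff)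
  have "m \<le> inner (b u) u" unfolding m_def by (rule cInf_lower[OF _ bdd]) (use u in \<open>auto simp: N_def\<close>)
  then have m0: "m < 0" using u by simp
  define T where "T = b + (- m) *\<^sub>R id_blinfun"
  have T: "inner (T x) x = inner (b x) x - m * (norm x)\<^sup>2" for x
    by (simp add: T_def blinfun.add_left blinfun.diff_left blinfun.scaleR_left inner_diff_left power2_norm_eq_inner)
  have "nonneg_op T" unfolding nonneg_op_def
  proof (intro conjI allI)
    show "hermitian T" unfolding T_def using b by (intro hermitian_simps hermitian_scaleR)
    fix x
    show "0 \<le> inner (T x) x"
    proof (cases "x = 0")
      case False
      have "m \<le> inner (b ((1 / norm x) *\<^sub>R x)) ((1 / norm x) *\<^sub>R x)"
        unfolding m_def
        by (rule cInf_lower[OF _ bdd], unfold N_def, rule imageI) (use False in simp)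
      then show ?thesis using False by (simp add: T blinfun.scaleR_right field_simps power2_eq_square)
    qed simp
  qed
  moreover have "inner (T y) y \<le> (norm T + 1) * (norm y)\<^sup>2" for y
    by (rule order_trans[OF blinfun_inner_le mult_right_mono]) auto
  ultimately have sq: "(norm (T x))\<^sup>2 \<le> (norm T + 1) * inner (T x) x" for x
    by (rule nonneg_norm_sq) (simp add: add_nonneg_pos)
  obtain S where S: "S o\<^sub>L T = id_blinfun" using inv[of "- m"] m0 by (auto simp: T_def)
  have STx: "S (T x) = x" for x using S by (metis blinfun_apply_blinfun_compose id_blinfun.rep_eq id_apply)
  \<comment> \<open>By the left inverse and the quadratic bound for T, \<open>inner (T x) x\<close>
    is at least \<open>d\<close> on the unit sphere, so m + d would be a lower bound above the
    infimum.\<close>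
  define d where "d = 1 / (((norm S)\<^sup>2 + 1) * (norm T + 1))"
  have pos: "0 < ((norm S)\<^sup>2 + 1) * (norm T + 1)"
    by (intro mult_pos_pos add_nonneg_pos) auto
  then have d: "d > 0" by (simp add: d_def)
  have "m + d \<le> v" if vN: "v \<in> N" for v
  proof -
    obtain x where x: "v = inner (b x) x" "norm x = 1" using vN by (auto simp: N_def)
    have "norm x \<le> norm S * norm (T x)" using norm_blinfun[of S "T x"] by (simp add: STx)
    then have "1 \<le> (norm S * norm (T x))\<^sup>2" using x by (simp add: one_le_power)
    also have "\<dots> \<le> ((norm S)\<^sup>2 + 1) * ((norm T + 1) * inner (T x) x)"
      unfolding power_mult_distrib by (intro mult_mono sq) auto
    finally have "d \<le> inner (T x) x" using pos by (simp add: d_def field_simps)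
    then show ?thesis using x by (simp add: T)
  qed
  moreover have "N \<noteq> {}" using u by (auto simp: N_def)
  ultimately have "m + d \<le> m" unfolding m_def by (intro cInf_greatest)
  then show False using d by simp
qed

text \<open>Vigier's theorem between 0 and 1. The forms converge, being bounded and monotone; each
  difference \<open>d n - d m\<close> with m \<le> n is again between 0 and 1, so its value at x has
  squared norm at most the difference of the forms.\<close>

lemma monotone_strong_limit:
  fixes d :: "nat \<Rightarrow> 'a::chilbert_space op"
  assumes d: "\<And>n. nonneg_op (d n)" "\<And>n. nonneg_op (id_blinfun - d n)"
    and mono: "\<And>n. nonneg_op (d (Suc n) - d n)"
  obtains D where "\<And>x. (\<lambda>n. d n x) \<longlonglongrightarrow> blinfun_apply D x" "nonneg_op D"
    "nonneg_op (id_blinfun - D)" "\<And>n. nonneg_op (D - d n)"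
proof -
  have inc: "nonneg_op (d n - d m)" if "m \<le> n" for m n
    using that
  proof (induction n rule: dec_induct)
    case (step n) then show ?case using nonneg_op_add[OF mono[of n] step.IH] by simp
  qed simp
  have mono_form: "inner (d m x) x \<le> inner (d n x) x" if "m \<le> n" for m n x
    using nonneg_opD(3)[OF inc[OF that], of x] by (simp add: blinfun.diff_left inner_diff_left)
  have le1: "inner (d n x) x \<le> (norm x)\<^sup>2" for n x
    using nonneg_opD(3)[OF d(2)[of n], of x]
    by (simp add: blinfun.diff_left inner_diff_left power2_norm_eq_inner)
  have gap: "(norm (d n x - d m x))\<^sup>2 \<le> inner (d n x) x - inner (d m x) x" if "m \<le> n" for m n x
  proof -
    have "nonneg_op (id_blinfun - (d n - d m))"
      using nonneg_op_add[OF d(2)[of n] d(1)[of m]] by (simp add: algebra_simps)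
    from nonneg_contraction_norm_sq[OF inc[OF that] this, of x] show ?thesis
      by (simp add: blinfun.diff_left inner_diff_left)
  qed
  have "convergent (\<lambda>n. d n x)" for x
  proof -
    have "convergent (\<lambda>n. inner (d n x) x)"
      by (rule Bseq_monoseq_convergent)
        (auto simp: monoseq_def mono_form nonneg_opD(3)[OF d(1)] le1 intro!: BseqI'[of _ "(norm x)\<^sup>2"])
    then have c: "Cauchy (\<lambda>n. inner (d n x) x)" by (rule convergent_Cauchy)
    have "Cauchy (\<lambda>n. d n x)"
    proof (rule metric_CauchyI)
      fix e :: real assume e: "e > 0"
      then obtain N where N: "\<And>m n. m \<ge> N \<Longrightarrow> n \<ge> N \<Longrightarrow> dist (inner (d m x) x) (inner (d n x) x) < e\<^sup>2"
        using metric_CauchyD[OF c, of "e\<^sup>2"] by auto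
      have *: "dist (d n x) (d m x) < e" if "N \<le> m" "m \<le> n" for m n
      proof -
        have "(norm (d n x - d m x))\<^sup>2 < e\<^sup>2"
          using gap[OF that(2), of x] N[of m n] that by (auto simp: dist_real_def)
        then show ?thesis using e by (simp add: dist_norm power2_less_imp_less)
      qed
      show "\<exists>N. \<forall>m\<ge>N. \<forall>n\<ge>N. dist (d m x) (d n x) < e"
        by (rule exI[of _ N]) (metis * dist_commute nle_le)
    qed
    then show ?thesis by (rule Cauchy_convergent)
  qed
  then obtain g where g: "\<And>x. (\<lambda>n. d n x) \<longlonglongrightarrow> g x" unfolding convergent_def by metis
  have bl: "bounded_linear g"
  proof (rule bounded_linear_intro)
    fix x y r
    have "(\<lambda>n. d n x + d n y) \<longlonglongrightarrow> g x + g y" by (intro tendsto_intros g)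
    then show "g (x + y) = g x + g y" using g[of "x + y"] LIMSEQ_unique by (auto simp: blinfun.add_right)
    have "(\<lambda>n. r *\<^sub>R d n x) \<longlonglongrightarrow> r *\<^sub>R g x" by (intro tendsto_intros g)
    then show "g (r *\<^sub>R x) = r *\<^sub>R g x" using g[of "r *\<^sub>R x"] LIMSEQ_unique by (auto simp: blinfun.scaleR_right)
    have "norm (d n x) \<le> norm x" for n
    proof (rule power2_le_imp_le)
      show "(norm (d n x))\<^sup>2 \<le> (norm x)\<^sup>2"
        using nonneg_contraction_norm_sq[OF d, of n x] le1[of n x] by linarith
    qed simp
    then show "norm (g x) \<le> norm x * 1"
      using LIMSEQ_le_const2[OF tendsto_norm[OF g]] by auto
  qed
  define D where "D = Blinfun g"
  have D: "(\<lambda>n. d n x) \<longlonglongrightarrow> D x" for x using g bl by (simp add: D_def bounded_linear_Blinfun_apply)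
  have "D \<in> bops"
  proof (rule bopsI)
    fix x
    have "(\<lambda>n. d n (\<i> *\<^sub>C x)) \<longlonglongrightarrow> \<i> *\<^sub>C D x"
      using tendsto_scaleC[OF D, of \<i> x] nonneg_opD(2)[OF d(1)] by (simp add: bops_scaleC)
    then show "D (\<i> *\<^sub>C x) = \<i> *\<^sub>C D x" using D LIMSEQ_unique by blast
  qed
  then have her: "hermitian D"
  proof (rule hermitianI)
    fix x y
    have "(\<lambda>n. inner (d n x) y) \<longlonglongrightarrow> inner (D x) y" by (intro tendsto_intros D)
    moreover have "(\<lambda>n. inner x (d n y)) \<longlonglongrightarrow> inner x (D y)" by (intro tendsto_intros D)
    ultimately show "inner (D x) y = inner x (D y)"
      using LIMSEQ_unique hermitian_inner[OF nonneg_opD(1)[OF d(1)]] by simp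
  qed
  have lim: "(\<lambda>n. inner (d n x) x) \<longlonglongrightarrow> inner (D x) x" for x by (intro tendsto_intros D)
  have ge: "inner (d n x) x \<le> inner (D x) x" for n x
    by (rule LIMSEQ_le_const[OF lim]) (use mono_form in auto)
  have dD: "nonneg_op (D - d n)" for n
    using her nonneg_opD(1)[OF d(1)] ge by (simp add: nonneg_op_def blinfun.diff_left inner_diff_left)
  have "inner (D x) x \<le> inner x x" for x
    by (rule LIMSEQ_le_const2[OF lim]) (use le1 in \<open>auto simp: power2_norm_eq_inner\<close>)
  then have "nonneg_op (id_blinfun - D)"
    using her by (simp add: nonneg_op_def blinfun.diff_left inner_diff_left)
  moreover have "nonneg_op D" using nonneg_op_add[OF dD[of 0] d(1)[of 0]] by simp
  ultimately show ?thesis using that D dD by blast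
qed

section \<open>Von Neumann algebras\<close>

lemma blinfun_eq_iff: "S = T \<longleftrightarrow> (\<forall>v. blinfun_apply S v = blinfun_apply T v)"
  by (auto intro: blinfun_eqI)

lemma commutant_iff:
  "T \<in> commutant M \<longleftrightarrow> T \<in> bops \<and> (\<forall>x\<in>M. \<forall>v. blinfun_apply T (x v) = x (T v))"
  by (auto simp: commutant_def blinfun_eq_iff)

lemma commutantD: "T \<in> commutant M \<Longrightarrow> x \<in> M \<Longrightarrow> blinfun_apply T (blinfun_apply x v) = x (T v)"
  by (simp add: commutant_iff)

lemma commutant_bops: "T \<in> commutant M \<Longrightarrow> T \<in> bops"
  by (simp add: commutant_iff)

locale vna =
  fixes M :: "'h::chilbert_space op set"
  assumes vna: "von_neumann_algebra M"
begin

lemma M_bops: "x \<in> M \<Longrightarrow> x \<in> bops"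
  using vna by (auto simp: von_neumann_algebra_def)

text \<open>The double commutant property as a membership test, through which closure properties of
  \<open>M\<close> become commutation with \<open>commutant M\<close>.\<close>

lemma M_iff: "x \<in> M \<longleftrightarrow> x \<in> bops \<and> (\<forall>T\<in>commutant M. \<forall>v. blinfun_apply x (blinfun_apply T v) = T (x v))"
  using vna commutant_iff[of x "commutant M"] by (auto simp: von_neumann_algebra_def)

lemma M_adj [simp]: "x \<in> M \<Longrightarrow> adj x \<in> M"
  using vna by (auto simp: von_neumann_algebra_def)

lemma M_add [simp]: "x \<in> M \<Longrightarrow> y \<in> M \<Longrightarrow> x + y \<in> M"
  by (auto simp: M_iff blinfun.add_left blinfun.add_right)

lemma M_diff [simp]: "x \<in> M \<Longrightarrow> y \<in> M \<Longrightarrow> x - y \<in> M"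
  by (auto simp: M_iff blinfun.diff_left blinfun.diff_right)

lemma M_comp [simp]: "x \<in> M \<Longrightarrow> y \<in> M \<Longrightarrow> x o\<^sub>L y \<in> M"
  by (auto simp: M_iff)

lemma M_scale [simp]: "x \<in> M \<Longrightarrow> scale_op c x \<in> M"
  by (auto simp: M_iff bops_scaleC commutant_bops)

lemma M_scaleR [simp]: "x \<in> M \<Longrightarrow> r *\<^sub>R x \<in> M"
  by (auto simp: M_iff blinfun.scaleR_left blinfun.scaleR_right)

lemma M_id [simp]: "id_blinfun \<in> M"
  by (auto simp: M_iff)

lemma M_uminus [simp]: "x \<in> M \<Longrightarrow> - x \<in> M"
  using M_scaleR[of x "-1"] by simp

lemma M_zero [simp]: "0 \<in> M"
  by (auto simp: M_iff)

lemma M_scalar [simp]: "scalar_op c \<in> M"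
  by (auto simp: M_iff bops_scaleC commutant_bops)

lemma M_sum [simp]: "(\<And>i. i \<in> I \<Longrightarrow> f i \<in> M) \<Longrightarrow> sum f I \<in> M"
  by (induction I rule: infinite_finite_induct) auto

lemma subspace_M: "subspace M"
  by (auto simp: subspace_def)

lemma M_limit:
  assumes "\<And>n. x n \<in> M" "\<And>v. (\<lambda>n. blinfun_apply (x n) v) \<longlonglongrightarrow> blinfun_apply y v" "y \<in> bops"
  shows "y \<in> M"
  unfolding M_iff
proof (intro conjI ballI allI assms)
  fix T v assume T: "T \<in> commutant M"
  have "(\<lambda>n. x n (T v)) \<longlonglongrightarrow> T (y v)"
    using blinfun.tendsto[OF tendsto_const assms(2), of T v]
      commutantD[OF T assms(1)] by simp
  then show "y (T v) = T (y v)" using assms(2) LIMSEQ_unique by blast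
qed

lemma M_inverse:
  assumes "x \<in> M" "S \<in> bops" "x o\<^sub>L S = id_blinfun" "S o\<^sub>L x = id_blinfun"
  shows "S \<in> M"
  unfolding M_iff
proof (intro conjI ballI allI assms)
  fix T v assume T: "T \<in> commutant M"
  have xS: "x (S u) = u" for u using assms(3) by (metis blinfun_apply_blinfun_compose id_blinfun.rep_eq id_apply)
  have Sx: "S (x u) = u" for u using assms(4) by (metis blinfun_apply_blinfun_compose id_blinfun.rep_eq id_apply)
  show "S (T v) = T (S v)"
    using Sx[of "T (S v)"] commutantD[OF T assms(1), of "S v"] by (simp add: xS)
qed

lemma M_coercive_inverse:
  assumes "x \<in> M" "\<And>v. inner (blinfun_apply x v) v \<ge> c * (norm v)\<^sup>2" "c > 0"
  obtains S where "S \<in> M" "x o\<^sub>L S = id_blinfun" "S o\<^sub>L x = id_blinfun"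
  using coercive_inverse[OF M_bops[OF assms(1)] assms(2,3)] M_inverse[OF assms(1)] by metis

lemma vna_commutant: "von_neumann_algebra (commutant M)"
  unfolding von_neumann_algebra_def
proof (intro conjI ballI)
  show "commutant M \<subseteq> bops" by (auto simp: commutant_bops)
  show "commutant (commutant (commutant M)) = commutant M"
    using vna by (simp add: von_neumann_algebra_def)
  fix T assume T: "T \<in> commutant M"
  note Tb = commutant_bops[OF T]
  show "adj T \<in> commutant M"
    unfolding commutant_iff
  proof (intro conjI ballI allI)
    show "adj T \<in> bops" using Tb by (rule adj_props)
    fix x v assume x: "x \<in> M"
    show "adj T (x v) = x (adj T v)"
    proof (rule cinner_eqI)
      fix z
      have "cinner z (adj T (x v)) = cinner (adj x (T z)) v"
        by (simp add: adj_cinner[OF Tb, symmetric] adj_cinner2[OF M_bops[OF x]])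
      also have "\<dots> = cinner (T (adj x z)) v" using commutantD[OF T M_adj[OF x]] by simp
      also have "\<dots> = cinner z (x (adj T v))"
        by (simp add: adj_cinner[OF Tb] adj_cinner[OF M_bops[OF M_adj[OF x]]] M_bops[OF x])
      finally show "cinner z (adj T (x v)) = cinner z (x (adj T v))" .
    qed
  qed
qed

lemma commutant_adj [simp]: "T \<in> commutant M \<Longrightarrow> adj T \<in> commutant M"
  using vna.M_adj[OF vna.intro[OF vna_commutant]] .

lemma commutant_comp [simp]:
  "S \<in> commutant M \<Longrightarrow> T \<in> commutant M \<Longrightarrow> S o\<^sub>L T \<in> commutant M"
  using vna.M_comp[OF vna.intro[OF vna_commutant]] .

end

section \<open>Automorphisms\<close>

lemma star_iso_inv:
  assumes "vna M" "star_iso M M \<theta>" shows "star_iso M M (inv_into M \<theta>)"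
proof -
  interpret vna M by fact
  define i where "i = inv_into M \<theta>"
  have b: "bij_betw \<theta> M M" and h: "star_hom M M \<theta>" using assms by (auto simp: star_iso_def)
  have bi: "bij_betw i M M" unfolding i_def using b by (rule bij_betw_inv_into)
  have i: "i x \<in> M" "\<theta> (i x) = x" if "x \<in> M" for x
    using that b bij_betwE[OF bi] by (auto simp: i_def bij_betw_inv_into_right)
  have e: "i y = x" if "x \<in> M" "\<theta> x = y" for x y
    using that b by (auto simp: i_def bij_betw_inv_into_left)
  have "star_hom M M i" unfolding star_hom_def
    by (intro conjI ballI allI Pi_I) (use h i in \<open>auto intro!: e simp: star_hom_def\<close>)
  then show ?thesis using bi by (simp add: star_iso_def i_def)
qed

text \<open>No continuity of \<theta> is assumed. The situation is symmetric in \<theta> and its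
  inverse (\<open>inv_aut\<close>), which the normality argument exploits.\<close>

locale vna_aut = vna M for M :: "'h::chilbert_space op set" +
  fixes \<theta> :: "'h op \<Rightarrow> 'h op"
  assumes iso: "star_iso M M \<theta>"
begin

abbreviation \<theta>i where "\<theta>i \<equiv> inv_into M \<theta>"

lemma \<theta>_hom: "star_hom M M \<theta>" and \<theta>_bij: "bij_betw \<theta> M M"
  using iso by (auto simp: star_iso_def)

lemma \<theta>_in [simp]: "x \<in> M \<Longrightarrow> \<theta> x \<in> M"
  and \<theta>_add [simp]: "x \<in> M \<Longrightarrow> y \<in> M \<Longrightarrow> \<theta> (x + y) = \<theta> x + \<theta> y"
  and \<theta>_comp [simp]: "x \<in> M \<Longrightarrow> y \<in> M \<Longrightarrow> \<theta> (x o\<^sub>L y) = \<theta> x o\<^sub>L \<theta> y"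
  and \<theta>_scale [simp]: "x \<in> M \<Longrightarrow> \<theta> (scale_op c x) = scale_op c (\<theta> x)"
  and \<theta>_adj [simp]: "x \<in> M \<Longrightarrow> \<theta> (adj x) = adj (\<theta> x)"
  using \<theta>_hom by (auto simp: star_hom_def)

lemma \<theta>i_in [simp]: "x \<in> M \<Longrightarrow> \<theta>i x \<in> M"
  and \<theta>_\<theta>i [simp]: "x \<in> M \<Longrightarrow> \<theta> (\<theta>i x) = x"
  and \<theta>i_\<theta> [simp]: "x \<in> M \<Longrightarrow> \<theta>i (\<theta> x) = x"
  using \<theta>_bij bij_betw_inv_into[OF \<theta>_bij]
  by (auto simp: bij_betw_inv_into_left bij_betw_inv_into_right bij_betw_def)

lemma \<theta>_scaleR [simp]: "x \<in> M \<Longrightarrow> \<theta> (r *\<^sub>R x) = r *\<^sub>R \<theta> x"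
  by (simp add: scaleR_eq_scale_op)

lemma \<theta>_diff [simp]: "x \<in> M \<Longrightarrow> y \<in> M \<Longrightarrow> \<theta> (x - y) = \<theta> x - \<theta> y"
  using \<theta>_add[of x "- y"] \<theta>_scaleR[of y "-1"] by simp

text \<open>\<open>star_hom\<close> says nothing about the unit; surjectivity supplies it, since
  \<open>\<theta> id_blinfun\<close> is a unit for everything in the range.\<close>

lemma \<theta>_id [simp]: "\<theta> id_blinfun = id_blinfun"
proof -
  have "\<theta> id_blinfun = \<theta> (id_blinfun o\<^sub>L \<theta>i id_blinfun)"
    by (subst \<theta>_comp) (simp_all add: blinfun_eq_iff)
  also have "id_blinfun o\<^sub>L \<theta>i id_blinfun = \<theta>i id_blinfun" by (simp add: blinfun_eq_iff)
  finally show ?thesis by simp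
qed

lemma \<theta>_hermitian: "x \<in> M \<Longrightarrow> hermitian x \<Longrightarrow> hermitian (\<theta> x)"
  by (metis \<theta>_adj \<theta>_in hermitian_def M_bops)

text \<open>Positivity of a hermitian element is an algebraic property, namely invertibility of all its
  shifts to the right, so no square roots are needed.\<close>

lemma \<theta>_nonneg:
  assumes "x \<in> M" "nonneg_op x" shows "nonneg_op (\<theta> x)"
proof (rule nonneg_of_invertible)
  show "hermitian (\<theta> x)" using assms \<theta>_hermitian by (simp add: nonneg_op_def)
  fix e :: real assume e: "e > 0"
  let ?a = "x + e *\<^sub>R id_blinfun"
  have "inner (?a v) v \<ge> e * (norm v)\<^sup>2" for v
    using nonneg_opD(3)[OF assms(2), of v]
    by (simp add: blinfun.add_left blinfun.scaleR_left inner_add_left power2_norm_eq_inner)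
  then obtain S where S: "S \<in> M" "S o\<^sub>L ?a = id_blinfun"
    using M_coercive_inverse[of ?a e] assms e by (metis M_add M_id M_scaleR)
  have "\<theta> (S o\<^sub>L ?a) = \<theta> S o\<^sub>L (\<theta> x + e *\<^sub>R id_blinfun)"
    using S assms by (subst \<theta>_comp) auto
  then show "\<exists>S. S o\<^sub>L (\<theta> x + e *\<^sub>R id_blinfun) = id_blinfun"
    using S by (intro exI[of _ "\<theta> S"]) simp
qed

lemma inv_aut: "vna_aut M \<theta>i"
  by unfold_locales (rule star_iso_inv[OF vna_axioms iso])

end

section \<open>The tracial vector and the modular conjugation\<close>

locale trace_vna = vna M for M :: "'h::chilbert_space op set" +
  fixes \<Omega> :: 'h
  assumes trace_vector: "standard_trace_vector M \<Omega>"
begin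

lemma trace: "x \<in> M \<Longrightarrow> y \<in> M \<Longrightarrow> cinner (blinfun_apply x (blinfun_apply y \<Omega>)) \<Omega> = cinner (y (x \<Omega>)) \<Omega>"
  using trace_vector by (simp add: standard_trace_vector_def)

lemma cyclic: "closure ((\<lambda>x. blinfun_apply x \<Omega>) ` M) = UNIV"
  using trace_vector by (simp add: standard_trace_vector_def)

lemma norm_\<Omega>: "norm \<Omega> = 1"
  using trace_vector by (simp add: standard_trace_vector_def)

lemma eq_on_cyclic: "(\<And>x. x \<in> M \<Longrightarrow> blinfun_apply A (blinfun_apply x \<Omega>) = blinfun_apply B (x \<Omega>)) \<Longrightarrow> A = B"
  by (rule blinfun_eq_dense[OF cyclic]) auto

text \<open>The trace property in vector form; it is what makes the map sending
  \<open>x \<Omega>\<close> to \<open>adj x \<Omega>\<close> isometric.\<close>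

lemma cinner_adj:
  assumes "x \<in> M" "y \<in> M"
  shows "cinner (blinfun_apply x \<Omega>) (blinfun_apply y \<Omega>) = cinner (adj y \<Omega>) (adj x \<Omega>)"
proof -
  have "cinner (x \<Omega>) (y \<Omega>) = cinner (adj y (x \<Omega>)) \<Omega>"
    using assms by (simp add: adj_cinner2 M_bops)
  also have "\<dots> = cinner (x (adj y \<Omega>)) \<Omega>" using assms by (simp add: trace)
  also have "\<dots> = cinner (adj y \<Omega>) (adj x \<Omega>)" using assms by (simp add: adj_cinner M_bops)
  finally show ?thesis .
qed

lemma norm_adj_\<Omega>: "x \<in> M \<Longrightarrow> norm (adj x \<Omega>) = norm (blinfun_apply x \<Omega>)"
  using cinner_adj[of x x] by (simp add: norm_eq_sqrt_inner inner_eq_Re_cinner)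

text \<open>By the trace property \<open>x (y \<Omega>)\<close> has the norm of
  \<open>adj y (adj x \<Omega>)\<close>, and \<open>adj x \<Omega>\<close> vanishes together with
  \<open>x \<Omega>\<close>.\<close>

lemma separating:
  assumes "x \<in> M" "blinfun_apply x \<Omega> = 0" shows "x = 0"
proof (rule eq_on_cyclic)
  fix y assume y: "y \<in> M"
  have "norm (x (y \<Omega>)) = norm (adj (x o\<^sub>L y) \<Omega>)"
    using norm_adj_\<Omega>[of "x o\<^sub>L y"] assms y by simp
  also have "\<dots> = norm (adj y (adj x \<Omega>))" using assms y by (simp add: adj_compose M_bops)
  also have "adj x \<Omega> = 0" using norm_adj_\<Omega>[OF assms(1)] assms(2) by simp
  finally show "x (y \<Omega>) = blinfun_apply 0 (y \<Omega>)" by simp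
qed

lemma M_eqI: "x \<in> M \<Longrightarrow> y \<in> M \<Longrightarrow> blinfun_apply x \<Omega> = blinfun_apply y \<Omega> \<Longrightarrow> x = y"
  using separating[of "x - y"] by (simp add: blinfun.diff_left)

abbreviation J where "J \<equiv> modular_conj M \<Omega>"

text \<open>\<open>modular_conj\<close> is a definite description: existence comes from isometric
  extension, uniqueness from cyclicity.\<close>

lemma J_\<Omega>: assumes "x \<in> M" shows "blinfun_apply J (blinfun_apply x \<Omega>) = adj x \<Omega>"
proof -
  obtain T :: "'h op" where T: "\<And>x. x \<in> M \<Longrightarrow> blinfun_apply T (x \<Omega>) = adj x \<Omega>"
  proof (rule blinfun_extension[OF subspace_M, of "\<lambda>x. x \<Omega>" "\<lambda>x. adj x \<Omega>" 1])
    show "linear (\<lambda>x. blinfun_apply x \<Omega>)" by (rule linear_apply_vector)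
    show "adj (x + y) \<Omega> = adj x \<Omega> + adj y \<Omega>" if "x \<in> M" "y \<in> M" for x y
      using that by (simp add: adj_add M_bops blinfun.add_left)
    show "adj (r *\<^sub>R x) \<Omega> = r *\<^sub>R adj x \<Omega>" if "x \<in> M" for r x
      using that by (simp add: scaleR_eq_scale_op adj_scale_op M_bops scaleC_of_real)
  qed (auto simp: norm_adj_\<Omega> cyclic)
  then have "J = T" unfolding modular_conj_def
    by (intro the_equality) (auto intro!: eq_on_cyclic)
  then show ?thesis using T assms by simp
qed

lemma J_J [simp]: "blinfun_apply J (blinfun_apply J v) = v"
proof -
  have "J o\<^sub>L J = id_blinfun"
    by (rule eq_on_cyclic) (simp add: J_\<Omega> M_bops)
  then show ?thesis by (metis blinfun_apply_blinfun_compose id_blinfun.rep_eq id_apply)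
qed

lemma J_scaleC: "blinfun_apply J (c *\<^sub>C v) = cnj c *\<^sub>C J v"
proof -
  have "J o\<^sub>L scalar_op c = scalar_op (cnj c) o\<^sub>L J"
  proof (rule eq_on_cyclic)
    fix x assume "x \<in> M"
    then show "(J o\<^sub>L scalar_op c) (x \<Omega>) = (scalar_op (cnj c) o\<^sub>L J) (x \<Omega>)"
      using J_\<Omega>[of "scale_op c x"] by (simp add: adj_scale_op M_bops J_\<Omega>)
  qed
  then show ?thesis by (metis blinfun_apply_blinfun_compose scalar_op_apply)
qed

lemma norm_J [simp]: "norm (blinfun_apply J v) = norm v"
proof -
  obtain u where u: "\<And>n. u n \<in> (\<lambda>x. blinfun_apply x \<Omega>) ` M" "u \<longlonglongrightarrow> v"
    using dense_sequence[OF cyclic] by metis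
  have "norm (J (u n)) = norm (u n)" for n using u(1)[of n] by (auto simp: J_\<Omega> norm_adj_\<Omega>)
  moreover have "(\<lambda>n. norm (J (u n))) \<longlonglongrightarrow> norm (J v)" by (intro tendsto_intros u)
  ultimately show ?thesis using LIMSEQ_unique[OF _ tendsto_norm[OF u(2)]] by simp
qed

lemma inner_J: "inner (blinfun_apply J u) v = inner u (blinfun_apply J v)"
proof -
  have "inner (J u) (J w) = inner u w" for w
    using norm_J[of "u + w"] norm_J[of u] norm_J[of w]
    by (simp add: norm_eq_sqrt_inner blinfun.add_right inner_add inner_commute)
  from this[of "J v"] show ?thesis by simp
qed

lemma conj_J_bops: "x \<in> bops \<Longrightarrow> J o\<^sub>L x o\<^sub>L J \<in> bops"
  by (rule bopsI) (simp add: J_scaleC bops_scaleC)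

lemma adj_conj_J: "x \<in> bops \<Longrightarrow> adj (J o\<^sub>L x o\<^sub>L J) = J o\<^sub>L adj x o\<^sub>L J"
  by (rule adj_uniqueR) (simp_all add: conj_J_bops adj_props inner_J adj_inner)

text \<open>On the vectors \<open>z \<Omega>\<close>, J x J is right multiplication by
  \<open>adj x\<close>, which commutes with left multiplications.\<close>

lemma conj_J_commutant: assumes "x \<in> M" shows "J o\<^sub>L x o\<^sub>L J \<in> commutant M"
  unfolding commutant_iff
proof (intro conjI ballI allI)
  show "J o\<^sub>L x o\<^sub>L J \<in> bops" using assms by (simp add: conj_J_bops M_bops)
  fix y v assume y: "y \<in> M"
  have "(J o\<^sub>L x o\<^sub>L J) o\<^sub>L y = y o\<^sub>L (J o\<^sub>L x o\<^sub>L J)"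
  proof (rule eq_on_cyclic)
    fix z assume z: "z \<in> M"
    have "J (x (J (y (z \<Omega>)))) = y (z (adj x \<Omega>))"
      using J_\<Omega>[of "y o\<^sub>L z"] J_\<Omega>[of "x o\<^sub>L adj (y o\<^sub>L z)"] assms y z
      by (simp add: adj_compose M_bops)
    moreover have "J (x (J (z \<Omega>))) = z (adj x \<Omega>)"
      using J_\<Omega>[of z] J_\<Omega>[of "x o\<^sub>L adj z"] assms z by (simp add: adj_compose M_bops)
    ultimately show "((J o\<^sub>L x o\<^sub>L J) o\<^sub>L y) (z \<Omega>) = (y o\<^sub>L (J o\<^sub>L x o\<^sub>L J)) (z \<Omega>)" by simp
  qed
  then show "(J o\<^sub>L x o\<^sub>L J) (y v) = y ((J o\<^sub>L x o\<^sub>L J) v)" by (metis blinfun_apply_blinfun_compose)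
qed

text \<open>Seen by testing against the dense vectors \<open>y \<Omega>\<close>. It lets \<Omega>
  and J play the same role for \<open>commutant M\<close> as for \<open>M\<close>.\<close>

lemma J_commutant_\<Omega>: assumes T: "T \<in> commutant M" shows "blinfun_apply J (blinfun_apply T \<Omega>) = adj T \<Omega>"
proof -
  have *: "inner (blinfun_apply y \<Omega>) (J (T \<Omega>)) = inner (blinfun_apply y \<Omega>) (adj T \<Omega>)" if y: "y \<in> M" for y
  proof -
    have "inner (y \<Omega>) (J (T \<Omega>)) = inner (adj y \<Omega>) (T \<Omega>)" using y by (simp add: inner_J[symmetric] J_\<Omega>)
    also have "\<dots> = inner \<Omega> (y (T \<Omega>))" using y by (simp add: adj_inner M_bops)
    also have "\<dots> = inner (T (y \<Omega>)) \<Omega>" using commutantD[OF T y, of \<Omega>] by (simp add: inner_commute)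
    also have "\<dots> = inner (y \<Omega>) (adj T \<Omega>)" using T by (simp add: adj_inner commutant_bops)
    finally show ?thesis .
  qed
  show ?thesis
  proof (rule inner_eqI)
    fix z
    obtain u where u: "\<And>n. u n \<in> (\<lambda>x. blinfun_apply x \<Omega>) ` M" "u \<longlonglongrightarrow> z"
      using dense_sequence[OF cyclic] by metis
    have "(\<lambda>n. inner (u n) (J (T \<Omega>))) \<longlonglongrightarrow> inner z (J (T \<Omega>))" by (intro tendsto_intros u)
    moreover have "(\<lambda>n. inner (u n) (adj T \<Omega>)) \<longlonglongrightarrow> inner z (adj T \<Omega>)" by (intro tendsto_intros u)
    moreover have "inner (u n) (J (T \<Omega>)) = inner (u n) (adj T \<Omega>)" for n using u(1)[of n] * by auto
    ultimately show "inner z (J (T \<Omega>)) = inner z (adj T \<Omega>)" using LIMSEQ_unique by auto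
  qed
qed

text \<open>Every \<open>x \<Omega>\<close> equals \<open>J (adj x (J \<Omega>))\<close>, the value
  at \<Omega> of an element of the commutant.\<close>

lemma cyclic_commutant: "closure ((\<lambda>x. blinfun_apply x \<Omega>) ` commutant M) = UNIV"
proof -
  have "(\<lambda>x. blinfun_apply x \<Omega>) ` M \<subseteq> (\<lambda>x. blinfun_apply x \<Omega>) ` commutant M"
  proof
    fix v assume "v \<in> (\<lambda>x. blinfun_apply x \<Omega>) ` M"
    then obtain x where x: "x \<in> M" "v = x \<Omega>" by auto
    have "J \<Omega> = \<Omega>" using J_\<Omega>[OF M_id] by simp
    then have "(J o\<^sub>L adj x o\<^sub>L J) \<Omega> = v" using x J_\<Omega>[of "adj x"] by (simp add: M_bops)
    then show "v \<in> (\<lambda>x. blinfun_apply x \<Omega>) ` commutant M"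
      using conj_J_commutant[of "adj x"] x by (metis M_adj imageI)
  qed
  from closure_mono[OF this] show ?thesis using cyclic by auto
qed

text \<open>The mirror image of \<open>conj_J_commutant\<close>: J a J is right multiplication on
  the dense vectors \<open>c \<Omega>\<close> with c in the commutant, so it commutes with the
  commutant and lies in \<open>M\<close>.\<close>

lemma conj_J_M: assumes a: "a \<in> commutant M" shows "J o\<^sub>L a o\<^sub>L J \<in> M"
  unfolding M_iff
proof (intro conjI ballI allI)
  show "J o\<^sub>L a o\<^sub>L J \<in> bops" using assms by (simp add: conj_J_bops commutant_bops)
  fix b v assume b: "b \<in> commutant M"
  have "(J o\<^sub>L a o\<^sub>L J) o\<^sub>L b = b o\<^sub>L (J o\<^sub>L a o\<^sub>L J)"
  proof (rule blinfun_eq_dense[OF cyclic_commutant])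
    fix w assume "w \<in> (\<lambda>x. blinfun_apply x \<Omega>) ` commutant M"
    then obtain c where c: "c \<in> commutant M" "w = c \<Omega>" by auto
    have "J (a (J (b (c \<Omega>)))) = b (c (adj a \<Omega>))"
      using J_commutant_\<Omega>[of "b o\<^sub>L c"] J_commutant_\<Omega>[of "a o\<^sub>L adj (b o\<^sub>L c)"] a b c
      by (simp add: adj_compose commutant_bops adj_props)
    moreover have "J (a (J (c \<Omega>))) = c (adj a \<Omega>)"
      using J_commutant_\<Omega>[of c] J_commutant_\<Omega>[of "a o\<^sub>L adj c"] a c
      by (simp add: adj_compose commutant_bops adj_props)
    ultimately show "((J o\<^sub>L a o\<^sub>L J) o\<^sub>L b) w = (b o\<^sub>L (J o\<^sub>L a o\<^sub>L J)) w" using c by simp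
  qed
  then show "(J o\<^sub>L a o\<^sub>L J) (b v) = b ((J o\<^sub>L a o\<^sub>L J) v)" by (metis blinfun_apply_blinfun_compose)
qed

end

section \<open>Automatic normality\<close>

locale trace_aut = trace_vna M \<Omega> + vna_aut M \<theta> for M :: "'h::chilbert_space op set" and \<Omega> \<theta>
begin

lemma nonneg_trace_zero:
  assumes "x \<in> M" "nonneg_op x" "inner (blinfun_apply x \<Omega>) \<Omega> = 0" shows "x = 0"
  using assms separating nonneg_kernel by blast

text \<open>The inverses of \<open>1\<close> plus the partial sums of the tails of \<open>\<Sum>y\<^sub>k\<close> play the role of
  suprema of the tails.\<close>

lemma automatic_normality:
  assumes y: "\<And>k. y k \<in> M" "\<And>k. nonneg_op (y k)" "\<And>k. nonneg_op (id_blinfun - y k)"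
    and sm: "summable (\<lambda>k. inner (blinfun_apply (y k) \<Omega>) \<Omega>)"
  shows "(\<lambda>k. inner (blinfun_apply (\<theta> (y k)) \<Omega>) \<Omega>) \<longlonglongrightarrow> 0"
proof -
  define S where "S n N = (\<Sum>k=n..<n+N. y k)" for n N
  have S: "S n N \<in> M" "nonneg_op (S n N)" for n N
    unfolding S_def by (intro M_sum nonneg_op_sum y)+
  define A where "A n N = id_blinfun + S n N" for n N
  have A: "A n N \<in> M" "nonneg_op (A n N)" for n N
    using S by (auto simp: A_def intro: nonneg_op_add)
  have "\<exists>R. R \<in> M \<and> A n N o\<^sub>L R = id_blinfun \<and> R o\<^sub>L A n N = id_blinfun" for n N
  proof -
    have "inner (A n N v) v \<ge> 1 * (norm v)\<^sup>2" for v
      using nonneg_opD(3)[OF S(2)[of n N], of v]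
      by (simp add: A_def blinfun.add_left inner_add_left power2_norm_eq_inner)
    then show ?thesis using M_coercive_inverse[OF A(1), of 1 n N] by (metis zero_less_one)
  qed
  then obtain R where R: "\<And>n N. R n N \<in> M" "\<And>n N. A n N o\<^sub>L R n N = id_blinfun"
      "\<And>n N. R n N o\<^sub>L A n N = id_blinfun" by metis
  have id1: "id_blinfun o\<^sub>L id_blinfun = (id_blinfun :: 'h op)" by (simp add: blinfun_eq_iff)
  \<comment> \<open>\<open>d\<close> stands in for \<open>S\<close>: it is monotone in
    \<open>S\<close> by \<open>inverse_antimono\<close>, but stays between 0 and 1.\<close>
  define d where "d n N = id_blinfun - R n N" for n N
  have antimono: "nonneg_op (d m N' - d n N)" if "nonneg_op (S m N' - S n N)" for m n N N'
    using inverse_antimono[OF A(2)[of n N] R(2)[of n N] M_bops[OF R(1)] _ R(2)[of m N'] M_bops[OF R(1)]] that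
    by (simp add: A_def d_def)
  have d: "d n N \<in> M" "nonneg_op (d n N)" "nonneg_op (id_blinfun - d n N)" for n N
  proof -
    show "d n N \<in> M" using R by (simp add: d_def)
    show "nonneg_op (d n N)" unfolding d_def
      using inverse_antimono[OF nonneg_op_id id1 bops_id _ R(2)[of n N] M_bops[OF R(1)]] S by (simp add: A_def)
    have "hermitian (R n N)"
      by (rule inverse_hermitian[OF nonneg_opD(1)[OF A(2)] R(2) M_bops[OF R(1)]])
    moreover have "0 \<le> inner (R n N v) v" for v
      using inverse_variational[OF A(2)[of n N] R(2)[of n N], of v 0] by simp
    ultimately show "nonneg_op (id_blinfun - d n N)" by (simp add: d_def nonneg_op_def)
  qed
  define t where "t n = (\<Sum>k. inner (y (k + n) \<Omega>) \<Omega>)" for n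
  have t: "t \<longlonglongrightarrow> 0" unfolding t_def using sm by (rule suminf_exist_split2)
  have S_t: "inner (S n N \<Omega>) \<Omega> \<le> t n" for n N
  proof -
    have "inner (S n N \<Omega>) \<Omega> = (\<Sum>k=n..<n+N. inner (y k \<Omega>) \<Omega>)"
      by (simp add: S_def blinfun.sum_left inner_sum_left)
    also have "\<dots> = (\<Sum>k<N. inner (y (k + n) \<Omega>) \<Omega>)"
      by (rule sum.reindex_bij_witness[of _ "\<lambda>k. k + n" "\<lambda>k. k - n"]) auto
    also have "\<dots> \<le> t n" unfolding t_def
    proof (rule sum_le_suminf)
      show "summable (\<lambda>k. inner (y (k + n) \<Omega>) \<Omega>)" by (rule summable_ignore_initial_segment[OF sm])
    qed (use nonneg_opD(3)[OF y(2)] in auto)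
    finally show ?thesis .
  qed
  \<comment> \<open>The variational formula at y = \<Omega> gives 1/(1 + S) \<ge> 1 - S in the state
    of \<Omega>.\<close>
  have d_t: "inner (d n N \<Omega>) \<Omega> \<le> t n" for n N
    using inverse_variational[OF A(2)[of n N] R(2)[of n N], of \<Omega> \<Omega>] S_t[of n N]
    by (simp add: d_def A_def blinfun.diff_left blinfun.add_left inner_diff_left inner_add_left)
  have "\<exists>D. (\<forall>v. (\<lambda>N. d n N v) \<longlonglongrightarrow> blinfun_apply D v) \<and> nonneg_op D \<and>
    nonneg_op (id_blinfun - D) \<and> (\<forall>N. nonneg_op (D - d n N))" for n
  proof -
    have "nonneg_op (d n (Suc N) - d n N)" for N
      by (rule antimono) (simp add: S_def y)
    then show ?thesis using monotone_strong_limit[of "d n", OF d(2,3)] by metis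
  qed
  then obtain D where D: "\<And>n v. (\<lambda>N. d n N v) \<longlonglongrightarrow> blinfun_apply (D n) v" "\<And>n. nonneg_op (D n)"
    "\<And>n. nonneg_op (id_blinfun - D n)" "\<And>n N. nonneg_op (D n - d n N)" by metis
  have DM: "D n \<in> M" for n by (rule M_limit[OF d(1) D(1) nonneg_opD(2)[OF D(2)]])
  \<comment> \<open>\<open>S n (Suc N)\<close> is \<open>y n + S (Suc n) N\<close>, whence the shift
    in the number of terms.\<close>
  have D_mono: "nonneg_op (D n - D (Suc n))" for n
  proof -
    have "inner (D (Suc n) v) v \<le> inner (D n v) v" for v
    proof (rule LIMSEQ_le_const2)
      show "(\<lambda>N. inner (d (Suc n) N v) v) \<longlonglongrightarrow> inner (D (Suc n) v) v" by (intro tendsto_intros D)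
      have "inner (d (Suc n) N v) v \<le> inner (D n v) v" for N
      proof -
        have "{n..<n + Suc N} = insert n {Suc n..<Suc n + N}" by auto
        then have "nonneg_op (d n (Suc N) - d (Suc n) N)"
          by (intro antimono) (simp add: S_def y)
        from nonneg_opD(3)[OF nonneg_op_add[OF this D(4)[of n "Suc N"]], of v]
        show ?thesis by (simp add: blinfun.diff_left inner_diff_left)
      qed
      then show "\<exists>N. \<forall>n'\<ge>N. inner (d (Suc n) n' v) v \<le> inner (D n v) v" by auto
    qed
    then show ?thesis using nonneg_opD(1)[OF D(2)]
      by (simp add: nonneg_op_def blinfun.diff_left inner_diff_left)
  qed
  have D_t: "inner (D n \<Omega>) \<Omega> \<le> t n" for n
  proof (rule LIMSEQ_le_const2)
    show "(\<lambda>N. inner (d n N \<Omega>) \<Omega>) \<longlonglongrightarrow> inner (D n \<Omega>) \<Omega>" by (intro tendsto_intros D)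
  qed (use d_t in auto)
  \<comment> \<open>Recovers \<open>y n\<close> from the one-term tail: \<open>y n\<close> is at
    most 3 times \<open>d n 1\<close>, and \<open>d n 1\<close> is at most
    \<open>D n\<close>.\<close>
  have D_y: "nonneg_op (3 *\<^sub>R D n - y n)" for n
  proof -
    have "A n 1 = id_blinfun + y n" by (simp add: A_def S_def)
    then have "nonneg_op (3 *\<^sub>R d n 1 - y n)" unfolding d_def
      by (intro inverse_one_plus y) (use R[of n 1] R(2,3)[of n 1] M_bops[OF R(1)] in simp_all)
    from nonneg_op_add[OF this nonneg_op_scaleR[OF D(4)[of n 1], of 3]]
    show ?thesis by (simp add: scaleR_diff_right)
  qed
  \<comment> \<open>Only inequalities between elements of \<open>M\<close> are carried over by
    \<theta>; the limit \<open>s\<close> of the images is taken afresh.\<close>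
  define e where "e n = id_blinfun - \<theta> (D n)" for n
  have eM: "e n \<in> M" for n using DM by (simp add: e_def)
  have e: "nonneg_op (e n)" "nonneg_op (id_blinfun - e n)" "nonneg_op (e (Suc n) - e n)" for n
    using \<theta>_nonneg[OF _ D(3)[of n]] \<theta>_nonneg[OF _ D(2)[of n]] \<theta>_nonneg[OF _ D_mono[of n]] DM
    by (auto simp: e_def)
  obtain s where s: "\<And>v. (\<lambda>n. e n v) \<longlonglongrightarrow> blinfun_apply s v" "nonneg_op s"
    "nonneg_op (id_blinfun - s)" "\<And>n. nonneg_op (s - e n)" using monotone_strong_limit[of e, OF e] by metis
  have sM: "s \<in> M" by (rule M_limit[OF eM s(1) nonneg_opD(2)[OF s(2)]])
  interpret i: vna_aut M \<theta>i by (rule inv_aut)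
  \<comment> \<open>The pullback of 1 - s is nonnegative and below every \<open>D n\<close>, so its
    trace is below every \<open>t n\<close> and is 0. Thus \<theta> preserves this limit although it
    is not known to be normal.\<close>
  define z where "z = id_blinfun - \<theta>i s"
  have z: "z \<in> M" "nonneg_op z" using sM i.\<theta>_nonneg[OF _ s(3)] by (auto simp: z_def)
  have "nonneg_op (D n - z)" for n
    using i.\<theta>_nonneg[OF _ s(4)[of n]] sM eM[of n] DM[of n] by (simp add: z_def e_def algebra_simps)
  then have "inner (z \<Omega>) \<Omega> \<le> t n" for n
    using nonneg_opD(3)[of "D n - z" \<Omega>] D_t[of n] by (auto simp: blinfun.diff_left inner_diff_left intro: order_trans)
  then have "inner (z \<Omega>) \<Omega> \<le> 0" using LIMSEQ_le_const[OF t] by auto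
  then have "z = 0" using nonneg_opD(3)[OF z(2), of \<Omega>] by (intro nonneg_trace_zero z) auto
  then have "\<theta>i s = id_blinfun" by (simp add: z_def)
  then have s_id: "s = id_blinfun" using \<theta>_\<theta>i[OF sM] by simp
  have "(\<lambda>n. 3 * (inner \<Omega> \<Omega> - inner (e n \<Omega>) \<Omega>)) \<longlonglongrightarrow> 3 * (inner \<Omega> \<Omega> - inner (s \<Omega>) \<Omega>)"
    by (intro tendsto_intros s)
  then have lim: "(\<lambda>n. 3 * (inner \<Omega> \<Omega> - inner (e n \<Omega>) \<Omega>)) \<longlonglongrightarrow> 0" by (simp add: s_id)
  show ?thesis
  proof (rule tendsto_sandwich[OF _ _ tendsto_const lim])
    show "\<forall>\<^sub>F n in sequentially. 0 \<le> inner (\<theta> (y n) \<Omega>) \<Omega>"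
      using nonneg_opD(3)[OF \<theta>_nonneg[OF y(1,2)]] by (intro always_eventually) auto
    have "inner (\<theta> (y n) \<Omega>) \<Omega> \<le> 3 * (inner \<Omega> \<Omega> - inner (e n \<Omega>) \<Omega>)" for n
      using nonneg_opD(3)[OF \<theta>_nonneg[OF _ D_y[of n]], of \<Omega>] DM[of n] y(1)[of n]
      by (simp add: e_def blinfun.diff_left blinfun.scaleR_left inner_diff_left)
    then show "\<forall>\<^sub>F n in sequentially. inner (\<theta> (y n) \<Omega>) \<Omega> \<le> 3 * (inner \<Omega> \<Omega> - inner (e n \<Omega>) \<Omega>)"
      by (intro always_eventually) auto
  qed
qed

end

section \<open>Uniqueness of the trace\<close>

lemma blinfun_comp_idD: "S o\<^sub>L T = id_blinfun \<Longrightarrow> blinfun_apply S (blinfun_apply T v) = v"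
  by (metis blinfun_apply_blinfun_compose id_blinfun.rep_eq id_apply)

section \<open>Unitaries determine the commutant\<close>

context vna begin

text \<open>The Cayley transform \<open>(h - \<i>) / (h + \<i>)\<close>, with \<open>R = 1 / (h\<^sup>2 + 1)\<close>.\<close>

lemma cayley_unitary:
  assumes h: "h \<in> M" "hermitian h"
  obtains u where "u \<in> M" "is_unitary u"
    "\<And>T v. T \<in> bops \<Longrightarrow> (\<And>v. blinfun_apply T (blinfun_apply u v) = blinfun_apply u (T v)) \<Longrightarrow> blinfun_apply T (blinfun_apply h v) = h (T v)"
proof -
  define a where "a = id_blinfun + (h o\<^sub>L h)"
  have aM: "a \<in> M" using h by (simp add: a_def)
  have ha: "h (a v) = a (h v)" for v by (simp add: a_def blinfun.add_left blinfun.add_right)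
  have "inner (a v) v \<ge> 1 * (norm v)\<^sup>2" for v
    using hermitian_inner[OF h(2), of "h v" v]
    by (simp add: a_def blinfun.add_left inner_add_left power2_norm_eq_inner)
  then obtain R where R: "R \<in> M" "a o\<^sub>L R = id_blinfun" "R o\<^sub>L a = id_blinfun"
    using M_coercive_inverse[OF aM] by (metis zero_less_one)
  note aR = blinfun_comp_idD[OF R(2)] and Ra = blinfun_comp_idD[OF R(3)]
  have "hermitian a"
    by (rule hermitianI) (use h in \<open>simp_all add: a_def M_bops blinfun.add_left inner_add hermitian_inner\<close>)
  then have adjR: "adj R = R" using inverse_hermitian R M_bops by (metis hermitian_def)
  define k where "k = h - scalar_op \<i>"
  define k' where "k' = h + scalar_op \<i>"
  have kM: "k \<in> M" "k' \<in> M" using h by (auto simp: k_def k'_def)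
  have "adj (scalar_op \<i>) = (scalar_op (- \<i>) :: 'h op)"
    by (rule adj_unique) (simp_all add: cinner_scaleC_left cinner_scaleC_right)
  moreover have "scalar_op (- \<i>) = - (scalar_op \<i> :: 'h op)"
    by (rule blinfun_eqI) (metis blinfun.minus_left add.right_inverse scalar_op_apply add_eq_0_iff scaleC_add_left scaleC_zero_left)
  ultimately have adjk: "adj k = k'"
    using h by (simp add: k_def k'_def adj_diff M_bops hermitian_def)
  have hi: "h (\<i> *\<^sub>C v) = \<i> *\<^sub>C h v" for v using h by (simp add: bops_scaleC M_bops)
  have k'k: "k' (k v) = a v" and kk': "k (k' v) = a v" for v
    by (simp_all add: k_def k'_def a_def blinfun.diff_left blinfun.add_left blinfun.diff_right
        blinfun.add_right hi scaleC_simps scaleC_add_right)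
  have ai: "a (\<i> *\<^sub>C v) = \<i> *\<^sub>C a v" for v using aM by (simp add: bops_scaleC M_bops)
  have ka: "k (a v) = a (k v)" and k'a: "k' (a v) = a (k' v)" for v
    by (simp_all add: k_def k'_def ha ai blinfun.diff_left blinfun.add_left blinfun.diff_right blinfun.add_right)
  have Rk: "R (k v) = k (R v)" for v using Ra[of "k (R v)"] by (simp add: ka[symmetric] aR)
  have Rk': "R (k' v) = k' (R v)" for v using Ra[of "k' (R v)"] by (simp add: k'a[symmetric] aR)
  \<comment> \<open>As \<open>a\<close> is k' k, this is k / k' expressed through R.\<close>
  define u where "u = k o\<^sub>L k o\<^sub>L R"
  have uM: "u \<in> M" using kM R by (simp add: u_def)
  have adju: "adj u = R o\<^sub>L (k' o\<^sub>L k')"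
    using kM R by (simp add: u_def adj_compose M_bops adjk adjR)
  have "is_unitary u" unfolding is_unitary_def
  proof (intro conjI blinfun_eqI)
    show "u \<in> bops" using uM by (rule M_bops)
    fix v
    show "(adj u o\<^sub>L u) v = id_blinfun v" by (simp add: adju, simp add: u_def k'k k'a Ra aR)
    show "(u o\<^sub>L adj u) v = id_blinfun v" by (simp add: adju, simp add: u_def kk' ka Rk' aR)
  qed
  moreover have "T (h v) = h (T v)" if T: "T \<in> bops" and Tu: "\<And>v. T (u v) = u (T v)" for T :: "'h op" and v
  proof -
    \<comment> \<open>k R is 1 / (h + \<i>) and u is 1 - 2 \<i> / (h + \<i>). Hence whatever
      commutes with u commutes with k R, and then with its inverse k' = h + \<i>.\<close>
    have kR: "k (R w) = (- \<i> / 2) *\<^sub>C (w - u w)" for w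
    proof -
      have "w - u w = a (R w) - k (k (R w))" by (simp add: u_def aR)
      also have "\<dots> = 2 *\<^sub>R (R w + \<i> *\<^sub>C h (R w))"
        unfolding scaleR_2
        by (simp only: a_def k_def blinfun.diff_left blinfun.add_left blinfun.diff_right hi scaleC_simps
            scalar_op_apply scaleC_i_i id_blinfun.rep_eq id_apply blinfun_apply_blinfun_compose) simp
      also have "\<dots> = (2 * \<i>) *\<^sub>C k (R w)"
        by (simp add: k_def blinfun.diff_left scaleC_simps scaleC_scaleC[symmetric] scaleC_of_real[of 2, simplified] scaleR_add_right add.commute)
      finally have "w - u w = (2 * \<i>) *\<^sub>C k (R w)" .
      then have "(- \<i> / 2) *\<^sub>C (w - u w) = ((- \<i> / 2) * (2 * \<i>)) *\<^sub>C k (R w)" by (simp only: scaleC_scaleC)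
      then show ?thesis by simp
    qed
    have TkR: "T (k (R w)) = k (R (T w))" for w
      by (simp add: kR bops_scaleC[OF T] blinfun.diff_right Tu)
    have "T (k' v) = k' (k (R (T (k' v))))" by (simp add: k'k aR)
    also have "\<dots> = k' (T v)" by (simp add: TkR[symmetric] Rk' kk' aR)
    finally show ?thesis by (simp add: k'_def blinfun.add_left blinfun.add_right bops_scaleC[OF T])
  qed
  ultimately show ?thesis using that uM by blast
qed

text \<open>x is a combination of the hermitian elements \<open>x + adj x\<close> and
  \<open>scale_op \<i> (x - adj x)\<close>, and commuting with a hermitian element follows from
  commuting with its Cayley transform.\<close>

lemma commutes_unitaries:
  assumes T: "T \<in> bops" and Tu: "\<And>u v. u \<in> M \<Longrightarrow> is_unitary u \<Longrightarrow> blinfun_apply T (blinfun_apply u v) = u (T v)"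
  shows "T \<in> commutant M"
  unfolding commutant_iff
proof (intro conjI ballI allI T)
  fix x v assume x: "x \<in> M"
  have herm: "T (h w) = h (T w)" if h: "h \<in> M" "hermitian h" for h :: "'h op" and w
    using cayley_unitary[OF h] Tu T by metis
  define h where "h = x + adj x"
  define g where "g = scale_op \<i> (x - adj x)"
  have h: "h \<in> M" "hermitian h" using x by (auto simp: h_def hermitian_def adj_add M_bops add.commute)
  have "- \<i> *\<^sub>C w = - (\<i> *\<^sub>C w)" for w :: 'h
    by (metis add.right_inverse add_eq_0_iff scaleC_add_left scaleC_zero_left)
  then have "adj g = g" using x
    by (simp add: g_def adj_scale_op adj_diff M_bops blinfun_eq_iff blinfun.diff_left scaleC_simps)
  then have g: "g \<in> M" "hermitian g" using x by (auto simp: g_def hermitian_def M_bops)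
  have x_eq: "x w = (1/2) *\<^sub>R (h w - \<i> *\<^sub>C g w)" for w
    by (simp add: h_def g_def blinfun.add_left blinfun.diff_left scaleR_2[symmetric] scaleR_add_right scaleR_diff_right)
  show "T (x v) = x (T v)"
    by (simp add: x_eq blinfun.scaleR_right blinfun.diff_right bops_scaleC[OF T] herm[OF h] herm[OF g])
qed

end

section \<open>Averaging over the unitary group in the 2-norm\<close>

context trace_vna begin

lemma norm_le_on_commutant_cyclic:
  assumes y: "\<And>n. y n \<in> M" "\<And>n. norm (y n) \<le> K" and lim: "(\<lambda>n. blinfun_apply (y n) \<Omega>) \<longlonglongrightarrow> \<xi>"
    and T: "T \<in> commutant M"
  shows "norm (blinfun_apply T \<xi>) \<le> K * norm (blinfun_apply T \<Omega>)"
proof (rule LIMSEQ_le_const2)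
  show "(\<lambda>n. norm (T (y n \<Omega>))) \<longlonglongrightarrow> norm (T \<xi>)" by (intro tendsto_intros lim)
  have "norm (T (y n \<Omega>)) \<le> K * norm (T \<Omega>)" for n
  proof -
    have "norm (T (y n \<Omega>)) = norm (y n (T \<Omega>))" using commutantD[OF T y(1)] by simp
    also have "\<dots> \<le> norm (y n) * norm (T \<Omega>)" by (rule norm_blinfun)
    also have "\<dots> \<le> K * norm (T \<Omega>)" by (intro mult_right_mono y) auto
    finally show ?thesis .
  qed
  then show "\<exists>N. \<forall>n\<ge>N. norm (T (y n \<Omega>)) \<le> K * norm (T \<Omega>)" by auto
qed

text \<open>The candidate is T \<Omega> \<mapsto> T \<xi> on the dense vectors from the commutant:
  the norm bound makes it bounded, and it commutes with the commutant. So 2-norm limits of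
  norm-bounded sequences still come from \<open>M\<close>.\<close>

lemma bounded_vector_in_M:
  assumes y: "\<And>n. y n \<in> M" "\<And>n. norm (y n) \<le> K" and lim: "(\<lambda>n. blinfun_apply (y n) \<Omega>) \<longlonglongrightarrow> \<xi>"
  obtains z where "z \<in> M" "blinfun_apply z \<Omega> = \<xi>"
proof -
  interpret c: vna "commutant M" by unfold_locales (rule vna_commutant)
  have "0 \<le> K" using order_trans[OF norm_ge_zero y(2)] .
  obtain z where z: "\<And>T. T \<in> commutant M \<Longrightarrow> blinfun_apply z (blinfun_apply T \<Omega>) = blinfun_apply T \<xi>"
  proof (rule blinfun_extension[OF c.subspace_M, of "\<lambda>T. T \<Omega>" "\<lambda>T. T \<xi>" K])
    show "linear (\<lambda>x. blinfun_apply x \<Omega>)" by (rule linear_apply_vector)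
  qed (use norm_le_on_commutant_cyclic[OF y lim] cyclic_commutant \<open>0 \<le> K\<close> in \<open>auto simp: blinfun.add_left blinfun.scaleR_left\<close>)
  have comm: "z (S v) = S (z v)" if S: "S \<in> commutant M" for S v
  proof -
    have "z o\<^sub>L S = S o\<^sub>L z"
    proof (rule blinfun_eq_dense[OF cyclic_commutant])
      fix w assume "w \<in> (\<lambda>x. blinfun_apply x \<Omega>) ` commutant M"
      then obtain T where T: "T \<in> commutant M" "w = T \<Omega>" by auto
      show "(z o\<^sub>L S) w = (S o\<^sub>L z) w" using z[of "S o\<^sub>L T"] z[of T] S T by simp
    qed
    then show ?thesis by (metis blinfun_apply_blinfun_compose)
  qed
  have "z \<in> bops" by (rule bopsI) (use comm[of "scalar_op \<i>"] in simp)
  then have "z \<in> M" using comm by (simp add: M_iff)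
  moreover have "z \<Omega> = \<xi>" using z[of id_blinfun] by simp
  ultimately show ?thesis by (rule that)
qed

text \<open>An \<open>L\<^sup>2\<close> version of Dixmier's averaging theorem: the element of least norm in the closed convex
  hull of the unitary orbit of \<open>x\<close> is fixed by all unitary conjugations, hence central.\<close>

lemma dixmier_averaging:
  assumes factor: "factor M" and x: "x \<in> M"
  obtains y c where "\<And>n. y n \<in> convex hull {u o\<^sub>L x o\<^sub>L adj u |u. u \<in> M \<and> is_unitary u}"
    "(\<lambda>n. blinfun_apply (y n) \<Omega>) \<longlonglongrightarrow> c *\<^sub>C \<Omega>"
proof -
  define Orb where "Orb = {u o\<^sub>L x o\<^sub>L adj u |u. u \<in> M \<and> is_unitary u}"
  define C where "C = convex hull Orb"
  define D where "D = closure ((\<lambda>y. blinfun_apply y \<Omega>) ` C)"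
  have lin: "linear (\<lambda>x. blinfun_apply x \<Omega>)" by (rule linear_apply_vector)
  have "is_unitary (id_blinfun :: 'h op)" by (simp add: is_unitary_def blinfun_eq_iff)
  then have "x \<in> Orb" using M_id unfolding Orb_def by (auto intro!: exI[of _ id_blinfun] simp: blinfun_eq_iff)
  then have "x \<in> C" unfolding C_def by (rule hull_inc)
  then have "D \<noteq> {}" unfolding D_def by auto
  moreover have "closed D" "convex D" unfolding D_def C_def
    by (auto intro!: convex_closure convex_linear_image[OF lin])
  ultimately obtain \<xi> where \<xi>: "\<xi> \<in> D" "\<And>z. z \<in> D \<Longrightarrow> norm \<xi> \<le> norm z"
    using min_norm_exists[of D] by metis
  \<comment> \<open>The norm bound is what lets \<open>bounded_vector_in_M\<close> turn the minimal
    vector into an operator.\<close>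
  have CM: "C \<subseteq> M \<inter> cball 0 (norm x)" unfolding C_def
  proof (rule hull_minimal)
    show "convex (M \<inter> cball 0 (norm x))" by (intro convex_Int convex_cball subspace_imp_convex subspace_M)
    show "Orb \<subseteq> M \<inter> cball 0 (norm x)"
    proof
      fix y assume "y \<in> Orb"
      then obtain u where u: "u \<in> M" "is_unitary u" "y = u o\<^sub>L x o\<^sub>L adj u" by (auto simp: Orb_def)
      have "norm y \<le> norm x"
        using u norm_blinfun[of x "adj u _"]
        by (intro norm_blinfun_bound) (auto simp: unitary_norm unitary_adj intro: order_trans[OF norm_blinfun])
      then show "y \<in> M \<inter> cball 0 (norm x)" using u x by simp
    qed
  qed
  have Cu: "u o\<^sub>L y o\<^sub>L adj u \<in> C" if u: "u \<in> M" "is_unitary u" and y: "y \<in> C" for u y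
  proof -
    have "linear (\<lambda>y. u o\<^sub>L y o\<^sub>L adj u)"
      by (rule linearI) (auto simp: blinfun_eq_iff blinfun.add_left blinfun.add_right blinfun.scaleR_left blinfun.scaleR_right)
    then have "(\<lambda>y. u o\<^sub>L y o\<^sub>L adj u) ` C = convex hull ((\<lambda>y. u o\<^sub>L y o\<^sub>L adj u) ` Orb)"
      unfolding C_def by (rule convex_hull_linear_image)
    also have "(\<lambda>y. u o\<^sub>L y o\<^sub>L adj u) ` Orb \<subseteq> Orb"
    proof
      fix z assume "z \<in> (\<lambda>y. u o\<^sub>L y o\<^sub>L adj u) ` Orb"
      then obtain w where w: "w \<in> M" "is_unitary w" "z = u o\<^sub>L (w o\<^sub>L x o\<^sub>L adj w) o\<^sub>L adj u" by (auto simp: Orb_def)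
      have ad: "adj (u o\<^sub>L w) = adj w o\<^sub>L adj u" using u w by (simp add: adj_compose M_bops)
      then have "is_unitary (u o\<^sub>L w)" using u w
        by (auto simp: is_unitary_def[of "u o\<^sub>L w"] blinfun_eq_iff unitary_apply M_bops)
      moreover have "z = (u o\<^sub>L w) o\<^sub>L x o\<^sub>L adj (u o\<^sub>L w)" by (simp add: w ad blinfun_eq_iff)
      ultimately show "z \<in> Orb" using u w unfolding Orb_def
        by (intro CollectI exI[of _ "u o\<^sub>L w"]) simp
    qed
    then have "convex hull ((\<lambda>y. u o\<^sub>L y o\<^sub>L adj u) ` Orb) \<subseteq> C" unfolding C_def by (rule hull_mono)
    finally show ?thesis using y by auto
  qed
  \<comment> \<open>On vectors, conjugation by u is the operator u J u J, which makes sense at \<xi>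
    before \<xi> is known to come from \<open>M\<close>.\<close>
  have conj_\<Omega>: "u (J (u (J (y \<Omega>)))) = u (y (adj u \<Omega>))" if "u \<in> M" "y \<in> M" for u y
    using that J_\<Omega>[of y] J_\<Omega>[of "u o\<^sub>L adj y"] by (simp add: adj_compose M_bops)
  have fixed: "u (J (u (J \<xi>))) = \<xi>" if u: "u \<in> M" "is_unitary u" for u
  proof -
    define L where "L = u o\<^sub>L (J o\<^sub>L (u o\<^sub>L J))"
    have "L v \<in> D" if v: "v \<in> (\<lambda>y. blinfun_apply y \<Omega>) ` C" for v
    proof -
      obtain y where y: "y \<in> C" "v = y \<Omega>" using v by auto
      then have "L v = (u o\<^sub>L y o\<^sub>L adj u) \<Omega>" using conj_\<Omega>[OF u(1), of y] CM by (auto simp: L_def)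
      then have "L v \<in> (\<lambda>y. blinfun_apply y \<Omega>) ` C" using Cu[OF u y(1)] by (metis imageI)
      then show ?thesis unfolding D_def by (rule closure_subset[THEN subsetD])
    qed
    then have "L ` D \<subseteq> D" unfolding D_def
      by (intro image_closure_subset linear_continuous_on blinfun.bounded_linear_right) auto
    \<comment> \<open>An isometry mapping \<open>D\<close> into itself fixes its unique vector of
      least norm.\<close>
    then have "L \<xi> \<in> D" using \<xi> by auto
    moreover have "norm (L \<xi>) = norm \<xi>" by (simp add: L_def unitary_norm[OF u(2)])
    ultimately have "L \<xi> = \<xi>" using min_norm_unique[OF \<open>convex D\<close> \<xi>(1) _ \<xi>(2)] by blast
    then show ?thesis by (simp add: L_def)
  qed
  obtain v where v: "\<And>n. v n \<in> (\<lambda>y. blinfun_apply y \<Omega>) ` C" "v \<longlonglongrightarrow> \<xi>"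
    using \<xi>(1) unfolding D_def closure_sequential by auto
  then have "\<forall>n. \<exists>y. y \<in> C \<and> v n = y \<Omega>" by auto
  then obtain y where y: "\<And>n. y n \<in> C" "\<And>n. v n = y n \<Omega>" by metis
  have lim: "(\<lambda>n. y n \<Omega>) \<longlonglongrightarrow> \<xi>" using v(2) by (simp add: y(2)[symmetric])
  have "y n \<in> M" "norm (y n) \<le> norm x" for n using CM y(1)[of n] by auto
  from bounded_vector_in_M[OF this lim] obtain z where z: "z \<in> M" "z \<Omega> = \<xi>" by metis
  have "z \<in> commutant M"
  proof (rule commutes_unitaries)
    fix u w assume u: "u \<in> M" "is_unitary u"
    have "u o\<^sub>L z o\<^sub>L adj u = z"
      by (rule M_eqI) (use u z fixed[OF u] conj_\<Omega>[OF u(1) z(1)] in auto)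
    from arg_cong[OF this, of "\<lambda>f. blinfun_apply f (u w)"]
    show "z (u w) = u (z w)" by (simp add: unitary_apply[OF u(2)])
  qed (use z M_bops in auto)
  then obtain c where "z = scalar_op c" using factor z by (auto simp: factor_def)
  then have "\<xi> = c *\<^sub>C \<Omega>" using z by simp
  then show ?thesis using that[of y c] y(1) lim by (simp add: C_def Orb_def)
qed

end

section \<open>Invariance of the trace and unitary implementation\<close>

context trace_aut begin

lemma \<theta>_scalar: "\<theta> (scalar_op c) = scalar_op c"
proof -
  have "scalar_op c = scale_op c (id_blinfun :: 'h op)" by (rule blinfun_eqI) simp
  then show ?thesis by simp
qed

text \<open>\<open>automatic_normality\<close> is applied to the operators
  \<open>adj (w n) o\<^sub>L w n\<close>, scaled into the unit interval; their values at \<Omega>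
  are squared 2-norms.\<close>

lemma \<theta>_strong_null:
  assumes w: "\<And>n. w n \<in> M" "\<And>n. norm (w n) \<le> K" and sm: "summable (\<lambda>n. (norm (blinfun_apply (w n) \<Omega>))\<^sup>2)"
  shows "(\<lambda>n. blinfun_apply (\<theta> (w n)) \<Omega>) \<longlonglongrightarrow> 0"
proof -
  \<comment> \<open>At least K^2, and strictly positive whatever K is.\<close>
  define k where "k = (\<bar>K\<bar> + 1)\<^sup>2"
  have k: "k > 0" by (simp add: k_def)
  define y where "y n = (1/k) *\<^sub>R (adj (w n) o\<^sub>L w n)" for n
  have yM: "y n \<in> M" for n using w by (simp add: y_def)
  have y_inner: "inner (y n v) v = (norm (w n v))\<^sup>2 / k" for n v
    using w adj_inner2[of "w n" "w n v" v] M_bops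
    by (simp add: y_def blinfun.scaleR_left power2_norm_eq_inner)
  have y: "nonneg_op (y n)" for n
    unfolding y_def using w k M_bops by (intro nonneg_op_scaleR nonneg_op_adj_comp) auto
  have y1: "nonneg_op (id_blinfun - y n)" for n
  proof -
    have "inner (y n v) v \<le> inner v v" for v
    proof -
      have "norm (w n v) \<le> norm (w n) * norm v" by (rule norm_blinfun)
      also have "\<dots> \<le> (\<bar>K\<bar> + 1) * norm v" using w(2)[of n] by (intro mult_right_mono) auto
      finally have "(norm (w n v))\<^sup>2 \<le> ((\<bar>K\<bar> + 1) * norm v)\<^sup>2" by (intro power_mono) auto
      then have "(norm (w n v))\<^sup>2 \<le> k * inner v v"
        by (simp only: k_def power_mult_distrib power2_norm_eq_inner)
      then show ?thesis using k by (simp add: y_inner field_simps)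
    qed
    then show ?thesis using nonneg_opD(1)[OF y] by (simp add: nonneg_op_def blinfun.diff_left inner_diff_left)
  qed
  have "(\<lambda>n. inner (\<theta> (y n) \<Omega>) \<Omega>) \<longlonglongrightarrow> 0"
    by (rule automatic_normality[OF yM y y1]) (use summable_divide[OF sm] in \<open>simp add: y_inner\<close>)
  moreover have "inner (\<theta> (y n) \<Omega>) \<Omega> = (norm (\<theta> (w n) \<Omega>))\<^sup>2 / k" for n
    using w adj_inner2[of "\<theta> (w n)" "\<theta> (w n) \<Omega>" \<Omega>] M_bops
    by (simp add: y_def blinfun.scaleR_left power2_norm_eq_inner)
  ultimately have "(\<lambda>n. (norm (\<theta> (w n) \<Omega>))\<^sup>2 / k * k) \<longlonglongrightarrow> 0 * k" by (intro tendsto_mult) auto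
  then have "(\<lambda>n. sqrt ((norm (\<theta> (w n) \<Omega>))\<^sup>2)) \<longlonglongrightarrow> sqrt 0" using k by (intro tendsto_real_sqrt) simp
  then show ?thesis by (simp add: tendsto_norm_zero_iff)
qed

text \<open>The functional tau o \<theta> is tracial and linear, hence constant on the unitary orbit
  of x and on the convex hull of the orbit.\<close>

lemma trace_hull:
  assumes x: "x \<in> M" and y: "y \<in> convex hull {u o\<^sub>L x o\<^sub>L adj u |u. u \<in> M \<and> is_unitary u}"
  shows "y \<in> M" "norm y \<le> norm x" "cinner (blinfun_apply (\<theta> y) \<Omega>) \<Omega> = cinner (blinfun_apply (\<theta> x) \<Omega>) \<Omega>"
proof -
  let ?S = "{y \<in> M. norm y \<le> norm x \<and> cinner (\<theta> y \<Omega>) \<Omega> = cinner (\<theta> x \<Omega>) \<Omega>}"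
  have "convex hull {u o\<^sub>L x o\<^sub>L adj u |u. u \<in> M \<and> is_unitary u} \<subseteq> ?S"
  proof (rule hull_minimal)
    show "convex ?S"
    proof (rule convexI)
      fix y z and a b :: real assume yz: "y \<in> ?S" "z \<in> ?S" and ab: "0 \<le> a" "0 \<le> b" "a + b = 1"
      have "norm (a *\<^sub>R y + b *\<^sub>R z) \<le> a * norm y + b * norm z"
        using norm_triangle_ineq[of "a *\<^sub>R y" "b *\<^sub>R z"] ab by simp
      also have "\<dots> \<le> a * norm x + b * norm x" using yz ab by (intro add_mono mult_left_mono) auto
      also have "\<dots> = norm x" using ab by (metis distrib_right mult_1)
      finally have "norm (a *\<^sub>R y + b *\<^sub>R z) \<le> norm x" .
      moreover have "cinner (\<theta> (a *\<^sub>R y + b *\<^sub>R z) \<Omega>) \<Omega> = (of_real a + of_real b) * cinner (\<theta> x \<Omega>) \<Omega>"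
        using yz by (simp add: blinfun.add_left blinfun.scaleR_left cinner_add_left
            scaleC_of_real[symmetric] cinner_scaleC_left distrib_right)
      then have "cinner (\<theta> (a *\<^sub>R y + b *\<^sub>R z) \<Omega>) \<Omega> = cinner (\<theta> x \<Omega>) \<Omega>"
        using ab by (metis mult_1 of_real_1 of_real_add)
      ultimately show "a *\<^sub>R y + b *\<^sub>R z \<in> ?S" using yz by simp
    qed
    show "{u o\<^sub>L x o\<^sub>L adj u |u. u \<in> M \<and> is_unitary u} \<subseteq> ?S"
    proof clarsimp
      fix u assume u: "u \<in> M" "is_unitary u"
      have "norm (u o\<^sub>L x o\<^sub>L adj u) \<le> norm x"
        using u norm_blinfun[of x "adj u _"]
        by (intro norm_blinfun_bound) (auto simp: unitary_norm unitary_adj intro: order_trans[OF norm_blinfun])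
      moreover have "adj (\<theta> u) o\<^sub>L \<theta> u = id_blinfun"
      proof -
        have "adj (\<theta> u) o\<^sub>L \<theta> u = \<theta> (adj u o\<^sub>L u)" using u by simp
        also have "adj u o\<^sub>L u = id_blinfun" using u by (simp add: is_unitary_def)
        finally show ?thesis by simp
      qed
      then have "cinner (\<theta> u (\<theta> x (adj (\<theta> u) \<Omega>))) \<Omega> = cinner (\<theta> x \<Omega>) \<Omega>"
        using trace[of "\<theta> u" "\<theta> x o\<^sub>L adj (\<theta> u)"] u x by (simp add: blinfun_comp_idD)
      ultimately show "u o\<^sub>L x o\<^sub>L adj u \<in> M \<and> norm (u o\<^sub>L x o\<^sub>L adj u) \<le> norm x \<and>
          cinner (\<theta> (u o\<^sub>L x o\<^sub>L adj u) \<Omega>) \<Omega> = cinner (\<theta> x \<Omega>) \<Omega>"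
        using u x by simp
    qed
  qed
  then show "y \<in> M" "norm y \<le> norm x" "cinner (\<theta> y \<Omega>) \<Omega> = cinner (\<theta> x \<Omega>) \<Omega>" using y by auto
qed

lemma trace_invariant:
  assumes factor: "factor M" and x: "x \<in> M"
  shows "cinner (blinfun_apply (\<theta> x) \<Omega>) \<Omega> = cinner (blinfun_apply x \<Omega>) \<Omega>"
proof -
  obtain y c where y: "\<And>n. y n \<in> convex hull {u o\<^sub>L x o\<^sub>L adj u |u. u \<in> M \<and> is_unitary u}"
    and lim: "(\<lambda>n. blinfun_apply (y n) \<Omega>) \<longlonglongrightarrow> c *\<^sub>C \<Omega>"
    by (rule dixmier_averaging[OF factor x]) (rule that)
  \<comment> \<open>The identity is an automorphism as well; its instance of
    \<open>trace_hull\<close> identifies c as the trace of x.\<close>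
  have id: "trace_aut M \<Omega> (\<lambda>x. x)"
    by unfold_locales (auto simp: star_iso_def star_hom_def bij_betw_def)
  note yM = trace_hull(1)[OF x y]
  have cc: "cinner (c *\<^sub>C \<Omega>) \<Omega> = c" by (simp add: cinner_scaleC_left cinner_self norm_\<Omega>)
  have "(\<lambda>n. cinner (y n \<Omega>) \<Omega>) \<longlonglongrightarrow> cinner (c *\<^sub>C \<Omega>) \<Omega>" by (intro tendsto_intros lim)
  then have "(\<lambda>n. cinner (x \<Omega>) \<Omega>) \<longlonglongrightarrow> c" by (simp only: trace_aut.trace_hull(3)[OF id x y] cc)
  then have c: "c = cinner (x \<Omega>) \<Omega>" by (rule LIMSEQ_unique[OF _ tendsto_const])
  \<comment> \<open>A geometric rate along a selection of averages, because
    \<open>\<theta>_strong_null\<close> asks for summable squares.\<close>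
  have "\<exists>n. norm (y n \<Omega> - c *\<^sub>C \<Omega>) < (1/2) ^ m" for m :: nat
    using LIMSEQ_D[OF lim, of "(1/2) ^ m"] by auto
  then obtain r where r: "\<And>m. norm (y (r m) \<Omega> - c *\<^sub>C \<Omega>) < (1/2) ^ m" by metis
  define w where "w m = y (r m) - scalar_op c" for m
  have wM: "w m \<in> M" for m using yM by (simp add: w_def)
  have "(\<lambda>m. \<theta> (w m) \<Omega>) \<longlonglongrightarrow> 0"
  proof (rule \<theta>_strong_null[OF wM])
    show "norm (w m) \<le> norm x + norm (scalar_op c :: 'h op)" for m
      unfolding w_def using trace_hull(2)[OF x y] by (intro order_trans[OF norm_triangle_ineq4] add_mono) auto
    have "summable (\<lambda>m. (1/4::real) ^ m)" by (rule summable_geometric) simp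
    then show "summable (\<lambda>m. (norm (w m \<Omega>))\<^sup>2)"
    proof (rule summable_comparison_test'[of _ 0])
      fix m :: nat
      have "(norm (w m \<Omega>))\<^sup>2 \<le> ((1/2) ^ m)\<^sup>2"
        using r[of m] by (intro power_mono) (auto simp: w_def blinfun.diff_left)
      then show "norm ((norm (w m \<Omega>))\<^sup>2) \<le> (1/4::real) ^ m"
        by (simp add: power2_eq_square power_mult_distrib[symmetric])
    qed
  qed
  then have "(\<lambda>m. cinner (\<theta> (w m) \<Omega>) \<Omega>) \<longlonglongrightarrow> cinner 0 \<Omega>" by (intro tendsto_intros)
  moreover have "cinner (\<theta> (w m) \<Omega>) \<Omega> = cinner (\<theta> x \<Omega>) \<Omega> - c" for m
    using yM[of "r m"] trace_hull(3)[OF x y, of "r m"] cc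
    by (simp add: w_def \<theta>_scalar blinfun.diff_left cinner_diff_left)
  ultimately have "(\<lambda>m::nat. cinner (\<theta> x \<Omega>) \<Omega> - c) \<longlonglongrightarrow> 0" by simp
  from LIMSEQ_unique[OF this tendsto_const] show ?thesis using c by simp
qed

lemma isometric_extension:
  assumes factor: "factor M"
  obtains W where "W \<in> bops" "\<And>x. x \<in> M \<Longrightarrow> blinfun_apply W (blinfun_apply x \<Omega>) = blinfun_apply (\<theta> x) \<Omega>"
proof -
  have nrm: "norm (\<theta> x \<Omega>) = norm (x \<Omega>)" if x: "x \<in> M" for x
  proof -
    have "cinner (\<theta> x \<Omega>) (\<theta> x \<Omega>) = cinner (x \<Omega>) (x \<Omega>)"
      using trace_invariant[OF factor, of "adj x o\<^sub>L x"] x by (simp add: adj_cinner2 M_bops)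
    then show ?thesis by (simp add: norm_eq_sqrt_inner inner_eq_Re_cinner)
  qed
  obtain W :: "'h op" where W: "\<And>x. x \<in> M \<Longrightarrow> blinfun_apply W (x \<Omega>) = \<theta> x \<Omega>"
  proof (rule blinfun_extension[OF subspace_M, of "\<lambda>x. x \<Omega>" "\<lambda>x. \<theta> x \<Omega>" 1])
    show "linear (\<lambda>x. blinfun_apply x \<Omega>)" by (rule linear_apply_vector)
  qed (auto simp: nrm cyclic blinfun.add_left blinfun.scaleR_left)
  have "W \<in> bops"
  proof (rule bopsI)
    fix v
    have "W o\<^sub>L scalar_op \<i> = scalar_op \<i> o\<^sub>L W"
      by (rule eq_on_cyclic) (use W W[of "scale_op \<i> _"] in simp)
    then show "W (\<i> *\<^sub>C v) = \<i> *\<^sub>C W v" by (metis blinfun_apply_blinfun_compose scalar_op_apply)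
  qed
  then show ?thesis using W by (rule that)
qed

text \<open>The extension for \<theta> has the one for \<open>\<theta>i\<close> as its inverse, and
  invariance of the trace makes it preserve inner products. Both commutation rules are read off on
  the vectors \<open>x \<Omega>\<close>; the one with J reflects that \<theta> respects
  adjoints.\<close>

lemma implementing_unitary:
  assumes factor: "factor M"
  obtains W where "is_unitary W" "\<And>x v. x \<in> M \<Longrightarrow> blinfun_apply W (blinfun_apply x v) = blinfun_apply (\<theta> x) (W v)"
    "\<And>v. blinfun_apply W (J v) = J (W v)"
proof -
  interpret i: trace_aut M \<Omega> \<theta>i
    by (rule trace_aut.intro[OF trace_vna_axioms inv_aut])
  obtain W where W: "W \<in> bops" "\<And>x. x \<in> M \<Longrightarrow> blinfun_apply W (blinfun_apply x \<Omega>) = \<theta> x \<Omega>"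
    using isometric_extension[OF factor] by metis
  obtain V where V: "V \<in> bops" "\<And>x. x \<in> M \<Longrightarrow> blinfun_apply V (blinfun_apply x \<Omega>) = \<theta>i x \<Omega>"
    using i.isometric_extension[OF factor] by metis
  have WV: "W o\<^sub>L V = id_blinfun" by (rule eq_on_cyclic) (simp add: W V)
  have VW: "V o\<^sub>L W = id_blinfun" by (rule eq_on_cyclic) (simp add: W V)
  have "adj W o\<^sub>L W = id_blinfun"
  proof (rule eq_on_cyclic)
    fix x assume x: "x \<in> M"
    have "inner (blinfun_apply y \<Omega>) (adj W (W (x \<Omega>))) = inner (blinfun_apply y \<Omega>) (x \<Omega>)" if y: "y \<in> M" for y
    proof -
      have "cinner (\<theta> y \<Omega>) (\<theta> x \<Omega>) = cinner (y \<Omega>) (x \<Omega>)"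
        using trace_invariant[OF factor, of "adj x o\<^sub>L y"] x y by (simp add: adj_cinner2 M_bops)
      moreover have "inner (y \<Omega>) (adj W (W (x \<Omega>))) = inner (W (y \<Omega>)) (W (x \<Omega>))"
        using W(1) by (simp add: adj_inner)
      ultimately show ?thesis using x y W(2) by (simp add: inner_eq_Re_cinner)
    qed
    note * = this
    show "(adj W o\<^sub>L W) (x \<Omega>) = id_blinfun (x \<Omega>)"
    proof (rule inner_eqI)
      fix z
      obtain u where u: "\<And>n. u n \<in> (\<lambda>x. blinfun_apply x \<Omega>) ` M" "u \<longlonglongrightarrow> z"
        using dense_sequence[OF cyclic] by metis
      have "(\<lambda>n. inner (u n) (adj W (W (x \<Omega>)))) \<longlonglongrightarrow> inner z (adj W (W (x \<Omega>)))" by (intro tendsto_intros u)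
      moreover have "(\<lambda>n. inner (u n) (x \<Omega>)) \<longlonglongrightarrow> inner z (x \<Omega>)" by (intro tendsto_intros u)
      moreover have "inner (u n) (adj W (W (x \<Omega>))) = inner (u n) (x \<Omega>)" for n using u(1)[of n] * by auto
      ultimately show "inner z ((adj W o\<^sub>L W) (x \<Omega>)) = inner z (id_blinfun (x \<Omega>))" using LIMSEQ_unique by auto
    qed
  qed
  moreover from this have "adj W = V"
    using WV by (metis blinfun_comp_idD blinfun_eqI)
  ultimately have "is_unitary W" using W WV by (simp add: is_unitary_def)
  moreover have "W (x v) = \<theta> x (W v)" if x: "x \<in> M" for x v
  proof -
    have "W o\<^sub>L x = \<theta> x o\<^sub>L W"
      by (rule eq_on_cyclic) (use x W W(2)[of "x o\<^sub>L _"] in simp)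
    then show ?thesis by (metis blinfun_apply_blinfun_compose)
  qed
  moreover have "W (J v) = J (W v)" for v
  proof -
    have "W o\<^sub>L J = J o\<^sub>L W" by (rule eq_on_cyclic) (simp add: W J_\<Omega>)
    then show ?thesis by (metis blinfun_apply_blinfun_compose)
  qed
  ultimately show ?thesis by (rule that)
qed

end

section \<open>Separability and the weak operator Borel structure\<close>

context trace_vna begin

text \<open>On norm-bounded subsets of \<open>M\<close> the \<open>L\<^sup>2\<close>-norm is controlled by the predual norm:
  \<open>\<parallel>w\<Omega>\<parallel>\<^sup>2 = \<rho>\<^sub>w w \<le> \<parallel>w\<parallel> \<parallel>\<rho>\<^sub>w\<parallel>\<close>.\<close>

lemma separable_space:
  assumes "separable_predual M"
  obtains e :: "nat \<Rightarrow> 'h" where "closure (range e) = UNIV"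
proof -
  obtain D where D: "countable D"
    "\<And>\<rho> \<epsilon>. \<rho> \<in> predual M \<Longrightarrow> \<epsilon> > 0 \<Longrightarrow> \<exists>\<sigma>\<in>D. \<forall>x\<in>M. norm x \<le> 1 \<longrightarrow> cmod (\<rho> x - \<sigma> x) \<le> \<epsilon>"
    using assms unfolding separable_predual_def by blast
  define \<rho> where "\<rho> w x = cinner (blinfun_apply x \<Omega>) (blinfun_apply w \<Omega>)" for w x :: "'h op"
  have \<rho>: "\<rho> w \<in> predual M" for w
    unfolding predual_def
  proof (intro CollectI exI conjI ballI)
    let ?\<xi> = "\<lambda>n::nat. if n = 0 then \<Omega> else 0" and ?\<eta> = "\<lambda>n::nat. if n = 0 then w \<Omega> else 0"
    show "summable (\<lambda>n. (norm (?\<xi> n))\<^sup>2)" by (rule summable_finite[of "{0}"]) auto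
    show "summable (\<lambda>n. (norm (?\<eta> n))\<^sup>2)" by (rule summable_finite[of "{0}"]) auto
    fix x :: "'h op"
    have "(\<Sum>n. cinner (x (?\<xi> n)) (?\<eta> n)) = (\<Sum>n\<in>{0}. cinner (x (?\<xi> n)) (?\<eta> n))"
      by (rule suminf_finite) auto
    then show "\<rho> w x = (\<Sum>n. cinner (blinfun_apply x (?\<xi> n)) (?\<eta> n))" by (simp add: \<rho>_def)
  qed
  \<comment> \<open>The approximating functionals in \<open>D\<close> need not have the form
    \<open>\<rho> w\<close>, so for each \<sigma>, norm bound k and precision m one operator c with
    \<open>\<rho> c\<close> near \<sigma> is selected.\<close>
  define good where "good k \<sigma> m c \<longleftrightarrow> c \<in> M \<and> norm c \<le> real k \<and>
    (\<forall>x\<in>M. norm x \<le> 1 \<longrightarrow> cmod (\<rho> c x - \<sigma> x) \<le> 1 / real (Suc m))" for k :: nat and \<sigma> and m :: nat and c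
  define S where "S = (\<lambda>(k, \<sigma>, m). blinfun_apply (SOME c. good k \<sigma> m c) \<Omega>) ` (UNIV \<times> D \<times> UNIV)"
  have "countable S" unfolding S_def using D by (intro countable_image countable_SIGMA) auto
  have "blinfun_apply w \<Omega> \<in> closure S" if w: "w \<in> M" for w
    unfolding closure_approachable
  proof (intro allI impI)
    fix \<epsilon> :: real assume \<epsilon>: "\<epsilon> > 0"
    obtain k :: nat where k: "norm w \<le> real k" using real_arch_simple by blast
    \<comment> \<open>Makes 2 (2 k + 1) / (m + 1) smaller than \<epsilon>^2: the factor 2 comes from
      the detour through \<sigma>, the factor 2 k + 1 from the scaling \<open>r\<close>.\<close>
    obtain m where m: "2 * (2 * real k + 1) / \<epsilon>\<^sup>2 < real m" using reals_Archimedean2 by blast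
    obtain \<sigma> where \<sigma>: "\<sigma> \<in> D" "\<And>x. x \<in> M \<Longrightarrow> norm x \<le> 1 \<Longrightarrow> cmod (\<rho> w x - \<sigma> x) \<le> 1 / real (Suc m)"
      using D(2)[OF \<rho>, of "1 / real (Suc m)" w] by auto
    define c where "c = (SOME c. good k \<sigma> m c)"
    have "good k \<sigma> m w" using w k \<sigma> by (simp add: good_def)
    then have c: "good k \<sigma> m c" unfolding c_def by (rule someI)
    then have cM: "c \<in> M" by (simp add: good_def)
    define v where "v = c - w"
    \<comment> \<open>Scales the difference of two operators of norm at most k into the unit ball,
      where the functionals are compared; the 1 covers k = 0.\<close>
    define r where "r = 1 / (2 * real k + 1)"
    have r: "r > 0" by (simp add: r_def add_nonneg_pos)
    have vM: "v \<in> M" using w c by (simp add: v_def good_def)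
    have "norm v \<le> 2 * real k" using norm_triangle_ineq4[of c w] c k by (simp add: v_def good_def)
    then have "norm (r *\<^sub>R v) \<le> 1" using r by (simp add: r_def field_simps)
    moreover have "r *\<^sub>R v \<in> M" using vM by simp
    ultimately have "cmod (\<rho> c (r *\<^sub>R v) - \<sigma> (r *\<^sub>R v)) \<le> 1 / real (Suc m)"
        "cmod (\<rho> w (r *\<^sub>R v) - \<sigma> (r *\<^sub>R v)) \<le> 1 / real (Suc m)"
      using c \<sigma>(2) by (auto simp: good_def)
    then have "cmod (\<rho> c (r *\<^sub>R v) - \<rho> w (r *\<^sub>R v)) \<le> 2 / real (Suc m)"
      using norm_triangle_ineq4[of "\<rho> c (r *\<^sub>R v) - \<sigma> (r *\<^sub>R v)" "\<rho> w (r *\<^sub>R v) - \<sigma> (r *\<^sub>R v)"] by simp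
    also have "\<rho> c (r *\<^sub>R v) - \<rho> w (r *\<^sub>R v) = of_real (r * (norm (v \<Omega>))\<^sup>2)"
    proof -
      have "\<rho> c (r *\<^sub>R v) - \<rho> w (r *\<^sub>R v) = cinner (of_real r *\<^sub>C v \<Omega>) (v \<Omega>)"
        by (simp add: \<rho>_def cinner_diff_right[symmetric] v_def blinfun.diff_left blinfun.scaleR_left scaleC_of_real)
      then show ?thesis by (simp add: cinner_scaleC_left cinner_self)
    qed
    finally have "r * (norm (v \<Omega>))\<^sup>2 \<le> 2 / real (Suc m)" using r by (simp add: norm_mult norm_power)
    then have "(norm (v \<Omega>))\<^sup>2 \<le> 2 * (2 * real k + 1) / real (Suc m)"
      using r by (simp add: r_def field_simps)
    also have "\<dots> < \<epsilon>\<^sup>2" using m \<epsilon> by (simp add: field_simps add_pos_pos add_strict_increasing)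
    finally have "norm (v \<Omega>) < \<epsilon>" using \<epsilon> by (simp add: power2_less_imp_less)
    moreover have "c \<Omega> \<in> S" unfolding S_def c_def using \<sigma>(1) by (intro image_eqI[of _ _ "(k, \<sigma>, m)"]) auto
    ultimately show "\<exists>y\<in>S. dist y (w \<Omega>) < \<epsilon>"
      by (intro bexI[of _ "c \<Omega>"]) (simp_all add: dist_norm v_def blinfun.diff_left)
  qed
  then have "(\<lambda>x. blinfun_apply x \<Omega>) ` M \<subseteq> closure S" by auto
  then have "closure ((\<lambda>x. blinfun_apply x \<Omega>) ` M) \<subseteq> closure S" by (simp add: closure_minimal)
  then have cl: "closure S = UNIV" using cyclic by auto
  then have "S \<noteq> {}" by auto
  then have "range (from_nat_into S) = S" using \<open>countable S\<close> by simp
  then show ?thesis using that cl by metis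
qed

end

section \<open>Measurability for the weak operator Borel structure\<close>

lemma openin_weak_operator_subset: "openin weak_operator_topology S \<Longrightarrow> S \<subseteq> bops"
  by (auto simp: weak_operator_topology_def openin_pullback_topology)

lemma space_weak_operator_borel [simp]: "space weak_operator_borel = bops"
  unfolding weak_operator_borel_def
  by (rule space_measure_of) (use openin_weak_operator_subset in auto)

lemma openin_weak_operator_sets:
  assumes "openin weak_operator_topology S" shows "S \<in> sets weak_operator_borel"
proof -
  have "sets weak_operator_borel = sigma_sets bops {S :: 'a op set. openin weak_operator_topology S}"
    unfolding weak_operator_borel_def
    by (rule sets_measure_of) (use openin_weak_operator_subset in auto)
  then show ?thesis using assms by (auto intro: sigma_sets.Basic)
qed

lemma weak_operator_coeff_measurable:
  "(\<lambda>X. cinner (blinfun_apply X x) y) \<in> borel_measurable weak_operator_borel"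
proof (rule borel_measurableI)
  fix S :: "complex set" assume "open S"
  then have "open ((\<lambda>f::'a \<times> 'a \<Rightarrow> complex. f (x, y)) -` S)"
    by (intro open_vimage continuous_on_product_coordinates)
  then have "openin weak_operator_topology ((\<lambda>T (x, y). cinner (blinfun_apply T x) y) -` ((\<lambda>f. f (x, y)) -` S) \<inter> bops)"
    unfolding weak_operator_topology_def openin_pullback_topology by auto
  from openin_weak_operator_sets[OF this]
  show "(\<lambda>X. cinner (blinfun_apply X x) y) -` S \<inter> space weak_operator_borel \<in> sets weak_operator_borel"
    by (simp add: vimage_def)
qed

text \<open>The norm need not be weakly continuous, but this describes its balls by countably many
  coefficients, which makes them measurable.\<close>

lemma norm_le_iff_coeff:
  fixes X :: "'a::chilbert_space op"
  assumes e: "closure (range e) = (UNIV :: 'a set)" and "0 \<le> r"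
  shows "norm X \<le> r \<longleftrightarrow> (\<forall>i j. cmod (cinner (X (e i)) (e j)) \<le> r * norm (e i) * norm (e j))"
proof (intro iffI allI)
  fix i j assume X: "norm X \<le> r"
  have "cmod (cinner (X (e i)) (e j)) \<le> norm (X (e i)) * norm (e j)" by (rule norm_cinner)
  also have "\<dots> \<le> (norm X * norm (e i)) * norm (e j)" by (intro mult_right_mono norm_blinfun) auto
  also have "\<dots> \<le> (r * norm (e i)) * norm (e j)" by (intro mult_right_mono X) auto
  finally show "cmod (cinner (X (e i)) (e j)) \<le> r * norm (e i) * norm (e j)" .
next
  assume b: "\<forall>i j. cmod (cinner (X (e i)) (e j)) \<le> r * norm (e i) * norm (e j)"
  have b': "cmod (cinner (X x) y) \<le> r * norm x * norm y" for x y
  proof -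
    obtain u where u: "\<And>n. u n \<in> range e" "u \<longlonglongrightarrow> x" using dense_sequence[OF e] by metis
    obtain v where v: "\<And>n. v n \<in> range e" "v \<longlonglongrightarrow> y" using dense_sequence[OF e] by metis
    show ?thesis
    proof (rule LIMSEQ_le)
      show "(\<lambda>n. cmod (cinner (X (u n)) (v n))) \<longlonglongrightarrow> cmod (cinner (X x) y)" by (intro tendsto_intros u v)
      show "(\<lambda>n. r * norm (u n) * norm (v n)) \<longlonglongrightarrow> r * norm x * norm y" by (intro tendsto_intros u v)
      have "cmod (cinner (X (u n)) (v n)) \<le> r * norm (u n) * norm (v n)" for n
        using u(1)[of n] v(1)[of n] b by auto
      then show "\<exists>N. \<forall>n\<ge>N. cmod (cinner (X (u n)) (v n)) \<le> r * norm (u n) * norm (v n)" by auto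
    qed
  qed
  show "norm X \<le> r"
  proof (rule norm_blinfun_bound[OF \<open>0 \<le> r\<close>])
    fix x
    have "norm (X x) * norm (X x) \<le> (r * norm x) * norm (X x)"
      using b'[of x "X x"] by (simp add: cinner_self norm_mult power2_eq_square)
    then show "norm (X x) \<le> r * norm x" using \<open>0 \<le> r\<close> by (cases "X x = 0") auto
  qed
qed

lemma coeff_approx:
  fixes X :: "'a::chilbert_space op"
  assumes "norm X \<le> r"
  shows "cmod (cinner (X x) y - cinner (X x') y') \<le> r * norm (x - x') * norm y + r * norm x' * norm (y - y')"
proof -
  have "cinner (X x) y - cinner (X x') y' = cinner (X (x - x')) y + cinner (X x') (y - y')"
    by (simp add: blinfun.diff_right cinner_diff_left cinner_diff_right)
  also have "cmod \<dots> \<le> norm (X (x - x')) * norm y + norm (X x') * norm (y - y')"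
    by (intro order_trans[OF norm_triangle_ineq] add_mono norm_cinner)
  also have "\<dots> \<le> (r * norm (x - x')) * norm y + (r * norm x') * norm (y - y')"
    using assms by (intro add_mono mult_right_mono order_trans[OF norm_blinfun]) auto
  finally show ?thesis .
qed

text \<open>On norm-bounded sets the weak operator topology is metrizable: it is induced by the matrix
  coefficients along a dense sequence.\<close>

lemma weak_operator_nbhd:
  fixes e :: "nat \<Rightarrow> 'a::chilbert_space"
  assumes e: "closure (range e) = UNIV" and S: "openin weak_operator_topology S"
    and X: "X \<in> S" "norm X \<le> r"
  shows "\<exists>G. open G \<and> (\<lambda>(i, j). cinner (blinfun_apply X (e i)) (e j)) \<in> G \<and>
    (\<forall>Y\<in>bops. norm Y \<le> r \<longrightarrow> (\<lambda>(i, j). cinner (blinfun_apply Y (e i)) (e j)) \<in> G \<longrightarrow> Y \<in> S)"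
proof -
  let ?f = "\<lambda>T::'a op. \<lambda>(x, y). cinner (blinfun_apply T x) y"
  let ?\<Phi> = "\<lambda>T::'a op. \<lambda>(i, j). cinner (blinfun_apply T (e i)) (e j)"
  have "0 \<le> r" using order_trans[OF norm_ge_zero X(2)] .
  obtain V where V: "open V" "S = ?f -` V \<inter> bops"
    using S unfolding weak_operator_topology_def openin_pullback_topology by auto
  have "openin (product_topology (\<lambda>_. euclidean) UNIV) V" "?f X \<in> V"
    using V X by (auto simp: open_fun_def)
  \<comment> \<open>A basic open box constrains finitely many coefficients, so neighbourhoods found
    for single coefficients can be intersected.\<close>
  from product_topology_open_contains_basis[OF this] obtain U where
    U: "?f X \<in> (\<Pi>\<^sub>E i\<in>UNIV. U i)" "\<And>i. open (U i)" "finite {i. U i \<noteq> UNIV}" "(\<Pi>\<^sub>E i\<in>UNIV. U i) \<subseteq> V"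
    by auto
  have "\<exists>G. open G \<and> ?\<Phi> X \<in> G \<and> (\<forall>Y\<in>bops. norm Y \<le> r \<longrightarrow> ?\<Phi> Y \<in> G \<longrightarrow> ?f Y p \<in> U p)" for p
  proof -
    obtain x y where p: "p = (x, y)" by (cases p)
    have "cinner (X x) y \<in> U p" using U(1) p by (auto simp: PiE_iff)
    then obtain \<epsilon> where \<epsilon>: "\<epsilon> > 0" "ball (cinner (X x) y) \<epsilon> \<subseteq> U p" using U(2) openE by metis
    \<comment> \<open>\<epsilon> is split into thirds: moving (x, y) to (e i, e j) for X, comparing
      X with Y there, and moving back for Y. Each move has two error terms, hence \<epsilon> / 6.
      The index j is chosen after i because its term contains \<open>norm (e i)\<close>; the 1
      guards against a zero denominator.\<close>
    have "\<epsilon> / 6 / (r * norm y + 1) > 0" using \<epsilon> \<open>0 \<le> r\<close> by (intro divide_pos_pos add_nonneg_pos) auto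
    then obtain i where i: "dist (e i) x < \<epsilon> / 6 / (r * norm y + 1)"
      using e closure_approachable[of x "range e"] by auto
    have "\<epsilon> / 6 / (r * norm (e i) + 1) > 0" using \<epsilon> \<open>0 \<le> r\<close> by (intro divide_pos_pos add_nonneg_pos) auto
    then obtain j where j: "dist (e j) y < \<epsilon> / 6 / (r * norm (e i) + 1)"
      using e closure_approachable[of y "range e"] by auto
    have b: "q * d \<le> \<epsilon> / 6" if "0 \<le> q" "d < \<epsilon> / 6 / (q + 1)" "0 \<le> d" for q d
    proof -
      have "q * d \<le> (q + 1) * d" using that by (intro mult_right_mono) auto
      also have "\<dots> \<le> \<epsilon> / 6" using that by (simp add: field_simps)
      finally show ?thesis .
    qed
    have near: "cmod (cinner (Y x) y - cinner (Y (e i)) (e j)) \<le> \<epsilon> / 3" if "norm Y \<le> r" for Y :: "'a op"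
      using coeff_approx[OF that, of x y "e i" "e j"] b[OF _ i] b[OF _ j] \<open>0 \<le> r\<close>
      by (simp add: dist_norm norm_minus_commute mult.commute mult.left_commute mult.assoc)
    define G where "G = (\<lambda>\<phi>::nat \<times> nat \<Rightarrow> complex. \<phi> (i, j)) -` ball (cinner (X (e i)) (e j)) (\<epsilon> / 3)"
    have "open G" unfolding G_def by (intro open_vimage open_ball continuous_on_product_coordinates)
    moreover have "?\<Phi> X \<in> G" using \<epsilon> by (simp add: G_def)
    moreover have "?f Y p \<in> U p" if Y: "norm Y \<le> r" "?\<Phi> Y \<in> G" for Y
    proof -
      have "cmod (cinner (X (e i)) (e j) - cinner (Y (e i)) (e j)) < \<epsilon> / 3"
        using Y by (simp add: G_def dist_norm)
      moreover have "cmod (cinner (X x) y - cinner (Y x) y) \<le>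
          cmod (cinner (X x) y - cinner (X (e i)) (e j)) + cmod (cinner (X (e i)) (e j) - cinner (Y (e i)) (e j))
          + cmod (cinner (Y x) y - cinner (Y (e i)) (e j))"
        by (metis (no_types, opaque_lifting) norm_diff_triangle_le norm_minus_commute order_refl add.assoc)
      ultimately have "cmod (cinner (X x) y - cinner (Y x) y) < \<epsilon>"
        using near[OF X(2)] near[OF Y(1)] by linarith
      then show ?thesis using \<epsilon> p by (auto simp: dist_norm)
    qed
    ultimately show ?thesis by blast
  qed
  then obtain G where G: "\<And>p. open (G p)" "\<And>p. ?\<Phi> X \<in> G p"
    "\<And>p Y. Y \<in> bops \<Longrightarrow> norm Y \<le> r \<Longrightarrow> ?\<Phi> Y \<in> G p \<Longrightarrow> ?f Y p \<in> U p" by metis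
  show ?thesis
  proof (intro exI[of _ "\<Inter>p\<in>{i. U i \<noteq> UNIV}. G p"] conjI ballI impI)
    show "open (\<Inter>p\<in>{i. U i \<noteq> UNIV}. G p)" using U(3) G(1) by (intro open_INT) auto
    fix Y assume Y: "Y \<in> bops" "norm Y \<le> r" "?\<Phi> Y \<in> (\<Inter>p\<in>{i. U i \<noteq> UNIV}. G p)"
    have "?f Y p \<in> U p" for p
    proof (cases "U p = UNIV")
      case False
      then have "?\<Phi> Y \<in> G p" using Y(3) by blast
      then show ?thesis by (rule G(3)[OF Y(1,2)])
    qed simp
    then have "?f Y \<in> V" using U(4) by (auto simp: PiE_iff)
    then show "Y \<in> S" using V Y by auto
  qed (use G in auto)
qed

text \<open>An open S may involve uncountably many coefficients. Its preimage is therefore cut along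
  the measurable norm balls; inside a ball it is the preimage of an open set \<open>G n\<close> of
  coefficient matrices, a Borel set in a countable product.\<close>

lemma weak_operator_measurableI:
  fixes e :: "nat \<Rightarrow> 'a::chilbert_space"
  assumes e: "closure (range e) = UNIV" and F: "F \<in> space N \<rightarrow> bops"
    and coeff: "\<And>i j. (\<lambda>w. cinner (blinfun_apply (F w) (e i)) (e j)) \<in> borel_measurable N"
  shows "F \<in> measurable N weak_operator_borel"
  unfolding weak_operator_borel_def
proof (rule measurable_measure_of)
  show "{S. openin weak_operator_topology S} \<subseteq> Pow bops" using openin_weak_operator_subset by auto
  show "F \<in> space N \<rightarrow> bops" by fact
  fix S :: "'a op set" assume "S \<in> {S. openin weak_operator_topology S}"
  then have S: "openin weak_operator_topology S" by simp
  let ?\<Phi> = "\<lambda>T::'a op. \<lambda>(i, j). cinner (blinfun_apply T (e i)) (e j)"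
  define G where "G n = \<Union>{G. open G \<and> (\<forall>Y\<in>bops. norm Y \<le> real n \<longrightarrow> ?\<Phi> Y \<in> G \<longrightarrow> Y \<in> S)}" for n
  have G: "open (G n)" for n unfolding G_def by (intro open_Union) auto
  have \<Phi>: "(\<lambda>w. ?\<Phi> (F w)) \<in> borel_measurable N"
    by (rule measurable_coordinatewise_then_product) (use coeff in \<open>auto simp: split_beta\<close>)
  have "F -` S \<inter> space N = (\<Union>n. {w \<in> space N. norm (F w) \<le> real n \<and> ?\<Phi> (F w) \<in> G n})"
  proof (intro equalityI subsetI)
    fix w assume w: "w \<in> F -` S \<inter> space N"
    obtain n where n: "norm (F w) \<le> real n" using real_arch_simple by blast
    have "?\<Phi> (F w) \<in> G n" using weak_operator_nbhd[OF e S _ n] w unfolding G_def by blast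
    then show "w \<in> (\<Union>n. {w \<in> space N. norm (F w) \<le> real n \<and> ?\<Phi> (F w) \<in> G n})" using w n by auto
  next
    fix w assume "w \<in> (\<Union>n. {w \<in> space N. norm (F w) \<le> real n \<and> ?\<Phi> (F w) \<in> G n})"
    then obtain n where w: "w \<in> space N" "norm (F w) \<le> real n" "?\<Phi> (F w) \<in> G n" by auto
    have "F w \<in> bops" using F w by auto
    then show "w \<in> F -` S \<inter> space N" using w unfolding G_def by blast
  qed
  also have "\<dots> \<in> sets N"
  proof (rule sets.countable_UN, safe)
    fix n
    have "{w \<in> space N. norm (F w) \<le> real n} =
        {w \<in> space N. \<forall>i j. cmod (cinner (F w (e i)) (e j)) \<le> real n * norm (e i) * norm (e j)}"
      using norm_le_iff_coeff[OF e, of "real n"] by auto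
    also have "\<dots> \<in> sets N" using coeff by measurable
    finally have "{w \<in> space N. norm (F w) \<le> real n} \<in> sets N" .
    moreover have "(\<lambda>w. ?\<Phi> (F w)) -` G n \<inter> space N \<in> sets N"
      by (rule measurable_sets[OF \<Phi>]) (use G in auto)
    moreover have "{w \<in> space N. norm (F w) \<le> real n \<and> ?\<Phi> (F w) \<in> G n} =
        {w \<in> space N. norm (F w) \<le> real n} \<inter> ((\<lambda>w. ?\<Phi> (F w)) -` G n \<inter> space N)" by auto
    ultimately show "{w \<in> space N. norm (F w) \<le> real n \<and> ?\<Phi> (F w) \<in> G n} \<in> sets N" by simp
  qed
  finally show "F -` S \<inter> space N \<in> sets N" .
qed

text \<open>Replace t by step functions with countably many values: each piece is a coefficient at
  fixed vectors, and continuity of c allows passage to the limit.\<close>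

lemma moving_coeff_measurable:
  fixes c :: "real \<Rightarrow> 'a::chilbert_space"
  assumes c: "continuous_on {0<..} c"
    and t: "t \<in> borel_measurable N" "\<And>w. w \<in> space N \<Longrightarrow> 0 < t w"
    and X: "X \<in> measurable N weak_operator_borel"
  shows "(\<lambda>w. cinner (blinfun_apply (X w) \<xi>) (c (t w))) \<in> borel_measurable N"
proof (rule borel_measurable_LIMSEQ_metric)
  \<comment> \<open>Rounds t up to the grid of mesh 1 / (n + 1), strictly above t and by at most one
    mesh; the sample points stay positive, where c is continuous.\<close>
  let ?q = "\<lambda>n k. (real_of_int k + 1) / real (Suc n)"
  let ?f = "\<lambda>n w. cinner (blinfun_apply (X w) \<xi>) (c (?q n \<lfloor>real (Suc n) * t w\<rfloor>))"
  fix n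
  have "(\<lambda>w. cinner (blinfun_apply (X w) \<xi>) (c (?q n k))) \<in> borel_measurable N" for k
    using measurable_compose[OF X weak_operator_coeff_measurable] .
  moreover have "(\<lambda>w. \<lfloor>real (Suc n) * t w\<rfloor>) \<in> measurable N (count_space UNIV)"
    using t(1) by measurable
  ultimately show "?f n \<in> borel_measurable N" by (rule measurable_compose_countable)
next
  let ?q = "\<lambda>n k. (real_of_int k + 1) / real (Suc n)"
  fix w assume w: "w \<in> space N"
  have q: "t w < ?q n \<lfloor>real (Suc n) * t w\<rfloor>" "?q n \<lfloor>real (Suc n) * t w\<rfloor> \<le> t w + 1 / real (Suc n)" for n
  proof -
    have "real (Suc n) * t w < real_of_int \<lfloor>real (Suc n) * t w\<rfloor> + 1" by linarith
    then show "t w < ?q n \<lfloor>real (Suc n) * t w\<rfloor>" by (simp add: field_simps del: of_nat_Suc)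
    have "real_of_int \<lfloor>real (Suc n) * t w\<rfloor> \<le> real (Suc n) * t w" by linarith
    then show "?q n \<lfloor>real (Suc n) * t w\<rfloor> \<le> t w + 1 / real (Suc n)" by (simp add: field_simps del: of_nat_Suc)
  qed
  have "(\<lambda>n. ?q n \<lfloor>real (Suc n) * t w\<rfloor>) \<longlonglongrightarrow> t w"
  proof (rule tendsto_sandwich[OF _ _ tendsto_const])
    show "(\<lambda>n. t w + 1 / real (Suc n)) \<longlonglongrightarrow> t w"
      using tendsto_add[OF tendsto_const[of "t w"] LIMSEQ_Suc[OF lim_1_over_n]] by simp
  qed (intro always_eventually allI less_imp_le[OF q(1)] q(2))+
  moreover have "isCont c (t w)"
    using c t(2)[OF w] by (simp add: continuous_on_eq_continuous_at)
  ultimately have "(\<lambda>n. c (?q n \<lfloor>real (Suc n) * t w\<rfloor>)) \<longlonglongrightarrow> c (t w)"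
    by (rule isCont_tendsto_compose[rotated])
  then show "(\<lambda>n. cinner (blinfun_apply (X w) \<xi>) (c (?q n \<lfloor>real (Suc n) * t w\<rfloor>))) \<longlonglongrightarrow>
      cinner (blinfun_apply (X w) \<xi>) (c (t w))"
    by (intro tendsto_intros)
qed

text \<open>The moving operator goes to the other slot,
  \<open>cinner (X (B x)) (adj (A t) y)\<close>; hence strong continuity is asked of the adjoints,
  while the constant \<open>B\<close> merely changes a fixed vector.\<close>

lemma fibrewise_measurable:
  fixes A :: "real \<Rightarrow> 'a::chilbert_space op" and e :: "nat \<Rightarrow> 'a"
  assumes e: "closure (range e) = UNIV"
    and A: "\<And>t. t > 0 \<Longrightarrow> A t \<in> bops" "\<And>v. continuous_on {0<..} (\<lambda>t. adj (A t) v)"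
    and B: "B \<in> bops"
    and Z: "\<And>t X. (t, X) \<in> Z \<Longrightarrow> t > 0 \<and> X \<in> bops \<and> (t, A t o\<^sub>L X o\<^sub>L B) \<in> Z'"
  shows "(\<lambda>(t, X). (t, A t o\<^sub>L X o\<^sub>L B)) \<in>
    measurable (restrict_space (borel \<Otimes>\<^sub>M weak_operator_borel) Z) (restrict_space (borel \<Otimes>\<^sub>M weak_operator_borel) Z')"
proof -
  define N where "N = restrict_space (borel \<Otimes>\<^sub>M weak_operator_borel :: (real \<times> 'a op) measure) Z"
  have sp: "w \<in> Z" if "w \<in> space N" for w using that by (auto simp: N_def space_restrict_space)
  have fst: "fst \<in> borel_measurable N" unfolding N_def by (intro measurable_restrict_space1 measurable_fst)
  have snd: "snd \<in> measurable N weak_operator_borel" unfolding N_def by (intro measurable_restrict_space1 measurable_snd)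
  have pos: "0 < fst w" "snd w \<in> bops" if "w \<in> space N" for w using Z[of "fst w" "snd w"] sp[OF that] by auto
  have "(\<lambda>w. A (fst w) o\<^sub>L snd w o\<^sub>L B) \<in> measurable N weak_operator_borel"
  proof (rule weak_operator_measurableI[OF e])
    show "(\<lambda>w. A (fst w) o\<^sub>L snd w o\<^sub>L B) \<in> space N \<rightarrow> bops" using pos A B by auto
    fix i j
    have "(\<lambda>w. cinner (blinfun_apply (snd w) (B (e i))) (adj (A (fst w)) (e j))) \<in> borel_measurable N"
      by (rule moving_coeff_measurable[OF A(2) fst pos(1) snd])
    then show "(\<lambda>w. cinner (blinfun_apply (A (fst w) o\<^sub>L snd w o\<^sub>L B) (e i)) (e j)) \<in> borel_measurable N"
      by (subst measurable_cong[where g = "\<lambda>w. cinner (blinfun_apply (snd w) (B (e i))) (adj (A (fst w)) (e j))"])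
        (use pos A(1) in \<open>auto simp: adj_cinner\<close>)
  qed
  then have "(\<lambda>w. (fst w, A (fst w) o\<^sub>L snd w o\<^sub>L B)) \<in> measurable N (borel \<Otimes>\<^sub>M weak_operator_borel)"
    by (intro measurable_Pair fst)
  then have "(\<lambda>w. (fst w, A (fst w) o\<^sub>L snd w o\<^sub>L B)) \<in> measurable N (restrict_space (borel \<Otimes>\<^sub>M weak_operator_borel) Z')"
    by (rule measurable_restrict_space2[rotated]) (use Z sp in force)
  then show ?thesis by (simp add: N_def split_beta)
qed

section \<open>Unitary families\<close>

lemma unitary_comp:
  assumes "is_unitary u" "is_unitary v" shows "is_unitary (u o\<^sub>L v)"
  using assms unitary_apply[OF assms(1)] unitary_apply[OF assms(2)]
  by (simp add: is_unitary_def[of "u o\<^sub>L v"] adj_compose unitary_bops blinfun_eq_iff)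

text \<open>Split F t (g t) as F t (g t - g s) + F t (g s); isometry controls the first
  summand.\<close>

lemma continuous_on_isometric_family:
  fixes F :: "'t::topological_space \<Rightarrow> 'a::chilbert_space op"
  assumes F: "\<And>v. continuous_on S (\<lambda>t. F t v)" and iso: "\<And>t v. t \<in> S \<Longrightarrow> norm (F t v) = norm v"
    and g: "continuous_on S g"
  shows "continuous_on S (\<lambda>t. F t (g t))"
  unfolding continuous_on_def
proof
  fix s assume s: "s \<in> S"
  have "((\<lambda>t. g t - g s) \<longlongrightarrow> g s - g s) (at s within S)"
    using g s by (intro tendsto_intros) (auto simp: continuous_on_def)
  then have "((\<lambda>t. norm (g t - g s)) \<longlongrightarrow> 0) (at s within S)" by (simp add: tendsto_norm_zero)
  then have "((\<lambda>t. norm (F t (g t - g s))) \<longlongrightarrow> 0) (at s within S)"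
    by (rule Lim_transform_eventually) (auto simp: eventually_at_filter iso)
  then have "((\<lambda>t. F t (g t - g s)) \<longlongrightarrow> 0) (at s within S)" by (rule tendsto_norm_zero_cancel)
  moreover have "((\<lambda>t. F t (g s)) \<longlongrightarrow> F s (g s)) (at s within S)"
    using F s by (auto simp: continuous_on_def)
  ultimately have "((\<lambda>t. F t (g t - g s) + F t (g s)) \<longlongrightarrow> 0 + F s (g s)) (at s within S)"
    by (rule tendsto_add)
  then show "((\<lambda>t. F t (g t)) \<longlongrightarrow> F s (g s)) (at s within S)" by (simp add: blinfun.diff_right)
qed

text \<open>Adjoints are not strongly continuous in general. For unitaries, with w =
  \<open>adj (F s) v\<close>, the norm of \<open>adj (F t) v - w\<close> equals that of
  \<open>F s w - F t w\<close>.\<close>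

lemma continuous_on_adj_unitary_family:
  fixes F :: "'t::topological_space \<Rightarrow> 'a::chilbert_space op"
  assumes F: "\<And>v. continuous_on S (\<lambda>t. F t v)" and u: "\<And>t. t \<in> S \<Longrightarrow> is_unitary (F t)"
  shows "continuous_on S (\<lambda>t. adj (F t) v)"
  unfolding continuous_on_def
proof
  fix s assume s: "s \<in> S"
  define w where "w = adj (F s) v"
  have v: "F s w = v" unfolding w_def by (rule unitary_apply[OF u[OF s]])
  have "((\<lambda>t. F t w) \<longlongrightarrow> F s w) (at s within S)" using F s by (auto simp: continuous_on_def)
  then have "((\<lambda>t. F s w - F t w) \<longlongrightarrow> F s w - F s w) (at s within S)" by (rule tendsto_diff[OF tendsto_const])
  then have "((\<lambda>t. norm (F s w - F t w)) \<longlongrightarrow> 0) (at s within S)" by (simp add: tendsto_norm_zero)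
  then have "((\<lambda>t. norm (adj (F t) v - w)) \<longlongrightarrow> 0) (at s within S)"
  proof (rule Lim_transform_eventually)
    have "norm (F s w - F t w) = norm (adj (F t) v - w)" if t: "t \<in> S" for t
    proof -
      have "norm (adj (F t) (v - F t w)) = norm (v - F t w)" by (rule unitary_norm[OF unitary_adj[OF u[OF t]]])
      then show ?thesis by (simp add: blinfun.diff_right unitary_apply[OF u[OF t]] v)
    qed
    then show "\<forall>\<^sub>F t in at s within S. norm (F s w - F t w) = norm (adj (F t) v - w)"
      by (simp add: eventually_at_filter)
  qed
  then have "((\<lambda>t. adj (F t) v - w) \<longlongrightarrow> 0) (at s within S)" by (rule tendsto_norm_zero_cancel)
  then show "((\<lambda>t. adj (F t) v) \<longlongrightarrow> adj (F s) v) (at s within S)" by (simp add: LIM_zero_iff w_def)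
qed

section \<open>Cocycle conjugate \<open>E\<^sub>0\<close>-semigroups\<close>

context trace_vna begin

text \<open>As m' runs through the commutant, J m' J runs through \<open>M\<close>, so the
  complementary relation for X says that J X J intertwines \<alpha>. The two halves of a fibre
  become one condition, imposed on X and on J X J.\<close>

lemma sps_fibre_iff:
  assumes \<alpha>: "\<And>m. m \<in> M \<Longrightarrow> \<alpha> t m \<in> M"
  shows "X \<in> sps_fibre M \<Omega> \<alpha> t \<longleftrightarrow> X \<in> bops \<and>
    (\<forall>m\<in>M. \<forall>v. blinfun_apply (\<alpha> t m) (blinfun_apply X v) = blinfun_apply X (m v)) \<and>
    (\<forall>m\<in>M. \<forall>v. blinfun_apply (\<alpha> t m) (J (X (J v))) = J (X (J (m v))))"
proof -
  have "(\<forall>m'\<in>commutant M. \<forall>v. J (\<alpha> t (J o\<^sub>L m' o\<^sub>L J) (J (X v))) = X (blinfun_apply m' v)) \<longleftrightarrow>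
    (\<forall>m\<in>M. \<forall>v. \<alpha> t m (J (X (J v))) = J (X (J (blinfun_apply m v))))" (is "?l \<longleftrightarrow> ?r")
  proof (intro iffI ballI allI)
    fix m v assume l: ?l and m: "m \<in> M"
    have "J o\<^sub>L (J o\<^sub>L m o\<^sub>L J) o\<^sub>L J = m" by (simp add: blinfun_eq_iff)
    moreover have "J (\<alpha> t (J o\<^sub>L (J o\<^sub>L m o\<^sub>L J) o\<^sub>L J) (J (X (J v)))) = X ((J o\<^sub>L m o\<^sub>L J) (J v))"
      using l conj_J_commutant[OF m] by blast
    ultimately have "J (\<alpha> t m (J (X (J v)))) = X (J (m v))" by simp
    from arg_cong[OF this, of "blinfun_apply J"]
    show "\<alpha> t m (J (X (J v))) = J (X (J (m v)))" by simp
  next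
    fix m' v assume r: ?r and m': "m' \<in> commutant M"
    have "\<alpha> t (J o\<^sub>L m' o\<^sub>L J) (J (X (J (J v)))) = J (X (J ((J o\<^sub>L m' o\<^sub>L J) (J v))))"
      using r conj_J_M[OF m'] by blast
    then show "J (\<alpha> t (J o\<^sub>L m' o\<^sub>L J) (J (X v))) = X (m' v)" by simp
  qed
  then show ?thesis
    by (auto simp: sps_fibre_def intertwiners_def complementary_def Let_def blinfun_eq_iff)
qed

lemma conj_J_unitary: assumes "is_unitary u" shows "is_unitary (J o\<^sub>L u o\<^sub>L J)"
  using assms conj_J_bops[of u] unitary_apply[OF assms]
  by (simp add: is_unitary_def[of "J o\<^sub>L u o\<^sub>L J"] adj_conj_J unitary_bops blinfun_eq_iff)

lemma conj_J_commute:
  "u \<in> M \<Longrightarrow> m \<in> M \<Longrightarrow> blinfun_apply J (u (J (blinfun_apply m v))) = blinfun_apply m (J (blinfun_apply u (J v)))"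
  using commutantD[OF conj_J_commutant, of u m v] by simp

end

section \<open>Construction of the isomorphism\<close>

context trace_aut begin

lemma cocycle_conjugate_sps:
  assumes factor: "factor M" and sep: "separable_predual M"
    and \<alpha>: "E0_semigroup M \<alpha>" and \<beta>: "E0_semigroup M \<beta>" and U: "cocycle M \<alpha> U"
    and \<beta>_eq: "\<And>t y. t \<ge> 0 \<Longrightarrow> y \<in> M \<Longrightarrow> \<beta> t y = \<theta> (perturb \<alpha> U t (\<theta>i y))"
  shows "sps_isomorphic (super_product_system M \<Omega> \<alpha>) (super_product_system M \<Omega> \<beta>)"
proof -
  obtain W where W: "is_unitary W" "\<And>x v. x \<in> M \<Longrightarrow> blinfun_apply W (blinfun_apply x v) = blinfun_apply (\<theta> x) (W v)"
    "\<And>v. blinfun_apply W (J v) = J (W v)" using implementing_unitary[OF factor] by metis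
  obtain e :: "nat \<Rightarrow> 'h" where e: "closure (range e) = UNIV" using separable_space[OF sep] by metis
  note Wb = unitary_bops[OF W(1)] and WW = unitary_apply[OF W(1)]
  have \<alpha>M: "\<alpha> t m \<in> M" and \<beta>M: "\<beta> t m \<in> M" if "t \<ge> 0" "m \<in> M" for t m
    using \<alpha> \<beta> that by (auto simp: E0_semigroup_def normal_unital_endo_def star_hom_def)
  have U1: "U t \<in> M" "is_unitary (U t)" if "t \<ge> 0" for t using U that by (auto simp: cocycle_def)
  have U2: "U s (\<alpha> s (U t) v) = U (s + t) v" if "s \<ge> 0" "t \<ge> 0" for s t v
    using U that unfolding cocycle_def by (metis blinfun_apply_blinfun_compose)
  have Ucont: "continuous_on {0..} (\<lambda>t. U t v)" for v
    using U by (simp add: cocycle_def continuous_on_strong_operator_topo_iff_coordinatewise)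
  define A where "A t = W o\<^sub>L (U t o\<^sub>L (J o\<^sub>L U t o\<^sub>L J))" for t
  have Au: "is_unitary (A t)" if "t \<ge> 0" for t
    unfolding A_def using that by (intro unitary_comp W conj_J_unitary U1)
  note Ab = unitary_bops[OF Au] and AA = unitary_apply[OF Au]
  \<comment> \<open>J exchanges the factors U t and J U t J, which commute since they lie in
    \<open>M\<close> and in its commutant.\<close>
  have AJ: "J (A t v) = A t (J v)" if t: "t \<ge> 0" for t v
    using conj_J_commute[OF U1(1)[OF t] U1(1)[OF t], of "J v"] by (simp add: A_def W(3)[symmetric])
  \<comment> \<open>U t intertwines \<open>\<alpha> t n\<close> with z, W turns z into
    \<open>\<theta> z\<close>, and J U t J passes \<open>\<alpha> t n\<close> because it lies in the
    commutant.\<close>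
  have A\<alpha>: "A t (\<alpha> t n v) = \<beta> t (\<theta> n) (A t v)" if t: "t \<ge> 0" and n: "n \<in> M" for t n v
  proof -
    define z where "z = perturb \<alpha> U t n"
    have zM: "z \<in> M" using t n by (simp add: z_def perturb_def \<alpha>M U1)
    have "\<beta> t (\<theta> n) (A t v) = \<theta> z (A t v)" using t n by (simp add: \<beta>_eq z_def)
    also have "\<dots> = W (z (U t (J (U t (J v)))))" by (simp add: A_def W(2)[OF zM])
    also have "\<dots> = W (U t (\<alpha> t n (J (U t (J v)))))"
      using t by (simp add: z_def perturb_def unitary_apply U1)
    also have "\<dots> = A t (\<alpha> t n v)"
      using conj_J_commute[OF U1(1)[OF t] \<alpha>M[OF t n], of v] by (simp add: A_def)
    finally show ?thesis by simp
  qed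
  have Wadj: "adj W (m v) = \<theta>i m (adj W v)" if "m \<in> M" for m v
    using W(2)[of "\<theta>i m" "adj W v"] that WW by (metis \<theta>_\<theta>i \<theta>i_in)
  have WadjJ: "adj W (J v) = J (adj W v)" for v using W(3)[of "adj W v"] WW by metis
  have AadjJ: "adj (A t) (J v) = J (adj (A t) v)" if "t \<ge> 0" for t v
    using AJ[OF that, of "adj (A t) v"] AA[OF that] by metis
  define V where "V t X = A t o\<^sub>L X o\<^sub>L adj W" for t X
  define V' where "V' t Y = adj (A t) o\<^sub>L Y o\<^sub>L W" for t Y
  have \<alpha>_fibre: "X \<in> sps_fibre M \<Omega> \<alpha> t \<longleftrightarrow> X \<in> bops \<and>
    (\<forall>m\<in>M. \<forall>v. \<alpha> t m (X v) = X (blinfun_apply m v)) \<and>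
    (\<forall>m\<in>M. \<forall>v. \<alpha> t m (J (X (J v))) = J (X (J (blinfun_apply m v))))" if "t \<ge> 0" for t X
    using sps_fibre_iff \<alpha>M that by blast
  have \<beta>_fibre: "X \<in> sps_fibre M \<Omega> \<beta> t \<longleftrightarrow> X \<in> bops \<and>
    (\<forall>m\<in>M. \<forall>v. \<beta> t m (X v) = X (blinfun_apply m v)) \<and>
    (\<forall>m\<in>M. \<forall>v. \<beta> t m (J (X (J v))) = J (X (J (blinfun_apply m v))))" if "t \<ge> 0" for t X
    using sps_fibre_iff \<beta>M that by blast
  have V_fibre: "V t X \<in> sps_fibre M \<Omega> \<beta> t" if t: "t \<ge> 0" and X: "X \<in> sps_fibre M \<Omega> \<alpha> t" for t X
    unfolding \<beta>_fibre[OF t]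
  proof (intro conjI ballI allI)
    note X' = X[unfolded \<alpha>_fibre[OF t]]
    show "V t X \<in> bops" using X' Ab[OF t] adj_props(1)[OF Wb] by (simp add: V_def)
    fix m v assume m: "m \<in> M"
    \<comment> \<open>Stated for a bare function x, so that it serves for X and for v \<mapsto> J (X
      (J v)).\<close>
    have key: "\<beta> t m (A t (x (adj W v))) = A t (x (adj W (m v)))"
      if "\<And>m v. m \<in> M \<Longrightarrow> \<alpha> t m (x v) = x (blinfun_apply m v)" for x v
      using A\<alpha>[OF t \<theta>i_in[OF m], of "x (adj W v)"] m that by (simp add: Wadj)
    show "\<beta> t m (V t X v) = V t X (m v)"
      using key[of "blinfun_apply X"] X' by (simp add: V_def)
    show "\<beta> t m (J (V t X (J v))) = J (V t X (J (m v)))"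
      using key[of "\<lambda>v. J (X (J v))"] X' by (simp add: V_def AJ[OF t] WadjJ)
  qed
  have V'_fibre: "V' t Y \<in> sps_fibre M \<Omega> \<alpha> t" if t: "t \<ge> 0" and Y: "Y \<in> sps_fibre M \<Omega> \<beta> t" for t Y
    unfolding \<alpha>_fibre[OF t]
  proof (intro conjI ballI allI)
    note Y' = Y[unfolded \<beta>_fibre[OF t]]
    show "V' t Y \<in> bops" using Y' adj_props(1)[OF Ab[OF t]] Wb by (simp add: V'_def)
    fix m v assume m: "m \<in> M"
    have key: "\<alpha> t m (adj (A t) (y (W v))) = adj (A t) (y (W (m v)))"
      if "\<And>m v. m \<in> M \<Longrightarrow> \<beta> t m (y v) = y (blinfun_apply m v)" for y v
    proof -
      have "A t (\<alpha> t m (adj (A t) (y (W v)))) = y (W (m v))"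
        using m that by (simp add: A\<alpha>[OF t m] AA[OF t] W(2))
      then show ?thesis using AA(1)[OF t] by metis
    qed
    show "\<alpha> t m (V' t Y v) = V' t Y (m v)"
      using key[of "blinfun_apply Y"] Y' by (simp add: V'_def)
    show "\<alpha> t m (J (V' t Y (J v))) = J (V' t Y (J (m v)))"
      using key[of "\<lambda>v. J (Y (J v))"] Y' by (simp add: V'_def AadjJ[OF t, symmetric] W(3))
  qed
  have V'V: "V' t (V t X) = X" and VV': "V t (V' t X) = X" if "t \<ge> 0" for t X
    using AA[OF that] WW by (auto simp: V_def V'_def blinfun_eq_iff)
  \<comment> \<open>\<open>ip\<close> is a definite description; its values agree as soon as the
    conditions on c coincide.\<close>
  have V_ip: "(adj (V t Y) o\<^sub>L V t X = scalar_op c) \<longleftrightarrow> (adj Y o\<^sub>L X = scalar_op c)"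
    if t: "t \<ge> 0" and Y: "Y \<in> bops" for t X Y c
  proof -
    have Wc: "W (c *\<^sub>C v) = c *\<^sub>C W v" "adj W (c *\<^sub>C v) = c *\<^sub>C adj W v" for v
      using Wb adj_props(1)[OF Wb] by (auto simp: bops_scaleC)
    have eq: "adj (V t Y) (V t X v) = W (adj Y (X (adj W v)))" for v
      using Y t AA[OF t] by (simp add: V_def adj_compose Ab Wb adj_props)
    show ?thesis
    proof
      assume l: "adj (V t Y) o\<^sub>L V t X = scalar_op c"
      show "adj Y o\<^sub>L X = scalar_op c"
      proof (rule blinfun_eqI)
        fix v
        have "W (adj Y (X v)) = c *\<^sub>C W v"
          using eq[of "W v"] arg_cong[OF l, of "\<lambda>f. blinfun_apply f (W v)"] WW by simp
        then show "(adj Y o\<^sub>L X) v = scalar_op c v" using WW(1)[of "adj Y (X v)"] by (simp add: Wc WW)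
      qed
    next
      assume r: "adj Y o\<^sub>L X = scalar_op c"
      show "adj (V t Y) o\<^sub>L V t X = scalar_op c"
      proof (rule blinfun_eqI)
        fix v
        show "(adj (V t Y) o\<^sub>L V t X) v = scalar_op c v"
          using arg_cong[OF r, of "\<lambda>f. blinfun_apply f (adj W v)"] by (simp add: eq Wc WW)
      qed
    qed
  qed
  have V_mult: "V (s + t) (X o\<^sub>L Y) = V s X o\<^sub>L V t Y"
    if s: "s \<ge> 0" and t: "t \<ge> 0" and X: "X \<in> sps_fibre M \<Omega> \<alpha> s" for s t X Y
  proof -
    note X' = X[unfolded \<alpha>_fibre[OF s]]
    \<comment> \<open>The two outer W cancel, leaving U t (J U t J) to be moved to the left of X;
      the cocycle identity \<open>U2\<close> then absorbs one factor into U s and the other into J U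
      s J.\<close>
    have *: "A s (X (adj W (A t u))) = A (s + t) (X u)" for u
    proof -
      have XJ: "X (J (U t (J u))) = J (\<alpha> s (U t) (J (X u)))"
      proof -
        have "\<alpha> s (U t) (J (X (J (J u)))) = J (X (J (U t (J u))))" using X' U1(1)[OF t] by blast
        from arg_cong[OF this, of "blinfun_apply J"] show ?thesis by simp
      qed
      have "A s (X (adj W (A t u))) = A s (X (U t (J (U t (J u)))))" by (simp add: A_def WW)
      also have "\<dots> = A s (\<alpha> s (U t) (J (\<alpha> s (U t) (J (X u)))))"
      proof -
        have "X (U t w) = \<alpha> s (U t) (X w)" for w using X' U1(1)[OF t] by auto
        then show ?thesis by (simp add: XJ)
      qed
      also have "\<dots> = W (U s (\<alpha> s (U t) (J (U s (\<alpha> s (U t) (J (X u)))))))"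
        using conj_J_commute[OF U1(1)[OF s] \<alpha>M[OF s U1(1)[OF t]]] by (simp add: A_def)
      also have "\<dots> = A (s + t) (X u)" by (simp add: U2 s t A_def)
      finally show ?thesis .
    qed
    show ?thesis by (rule blinfun_eqI) (simp add: V_def *)
  qed
  have A_cont: "continuous_on {0<..} (\<lambda>t. A t v)" for v
  proof -
    have c: "continuous_on {0<..} (\<lambda>t. U t v)" for v using Ucont by (rule continuous_on_subset) auto
    have cJ: "continuous_on {0<..} (\<lambda>t. U t (J (U t (J v))))"
      by (rule continuous_on_isometric_family[OF c]) (auto intro!: unitary_norm U1 continuous_intros c)
    have "continuous_on {0<..} (\<lambda>t. W (U t (J (U t (J v)))))" by (intro continuous_intros cJ)
    then show ?thesis by (simp add: A_def)
  qed
  have Aadj_cont: "continuous_on {0<..} (\<lambda>t. adj (A t) v)" for v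
    by (rule continuous_on_adj_unitary_family[OF A_cont Au]) auto
  define P where "P = super_product_system M \<Omega> \<alpha>"
  define Q where "Q = super_product_system M \<Omega> \<beta>"
  define ZP where "ZP = {(t, X). 0 < t \<and> X \<in> sps_fibre M \<Omega> \<alpha> t}"
  define ZQ where "ZQ = {(t, X). 0 < t \<and> X \<in> sps_fibre M \<Omega> \<beta> t}"
  have P: "total P = restrict_space (borel \<Otimes>\<^sub>M weak_operator_borel) ZP" "fibre P = sps_fibre M \<Omega> \<alpha>"
    "mult P s t X Y = X o\<^sub>L Y" "ip P t X Y = (THE c. adj Y o\<^sub>L X = scalar_op c)" for s t X Y
    by (auto simp: P_def super_product_system_def ZP_def)
  have Q: "total Q = restrict_space (borel \<Otimes>\<^sub>M weak_operator_borel) ZQ" "fibre Q = sps_fibre M \<Omega> \<beta>"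
    "mult Q s t X Y = X o\<^sub>L Y" "ip Q t X Y = (THE c. adj Y o\<^sub>L X = scalar_op c)" for s t X Y
    by (auto simp: Q_def super_product_system_def ZQ_def)
  have bopsP: "X \<in> bops" if "X \<in> sps_fibre M \<Omega> \<alpha> t" "t \<ge> 0" for X t using that \<alpha>_fibre by auto
  have bopsQ: "X \<in> bops" if "X \<in> sps_fibre M \<Omega> \<beta> t" "t \<ge> 0" for X t using that \<beta>_fibre by auto
  have spP: "space (total P) = ZP" and spQ: "space (total Q) = ZQ"
    using bopsP bopsQ by (auto simp: P Q space_restrict_space space_pair_measure ZP_def ZQ_def)
  define F where "F = (\<lambda>(t, X). (t, V t X))"
  define G where "G = (\<lambda>(t, X). (t, V' t X))"
  have bij: "bij_betw F ZP ZQ"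
    by (rule bij_betw_byWitness[of _ G])
      (auto simp: F_def G_def ZP_def ZQ_def V'V VV' intro: V_fibre V'_fibre)
  have F: "F \<in> measurable (total P) (total Q)"
    unfolding P Q F_def V_def
    by (rule fibrewise_measurable[OF e])
      (use bopsP V_fibre in \<open>auto simp: Ab Aadj_cont adj_props(1)[OF Wb] ZP_def ZQ_def V_def\<close>)
  \<comment> \<open>For the inverse the moving operator is \<open>adj (A t)\<close>, whose adjoint
    is \<open>A t\<close> again.\<close>
  have "continuous_on {0<..} (\<lambda>t. adj (adj (A t)) v)" for v
    using A_cont[of v] by (rule continuous_on_eq) (simp add: Ab)
  then have "G \<in> measurable (total Q) (total P)"
    unfolding P Q G_def V'_def
    by (intro fibrewise_measurable[OF e])
      (use bopsQ V'_fibre in \<open>auto simp: adj_props(1)[OF Ab] Wb ZP_def ZQ_def V'_def\<close>)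
  moreover have "inv_into ZP F w = G w" if "w \<in> ZQ" for w
  proof -
    have "G w \<in> ZP" "F (G w) = w" using that by (auto simp: G_def F_def ZP_def ZQ_def VV' V'_fibre)
    then show ?thesis using bij by (metis bij_betw_inv_into_left)
  qed
  ultimately have "inv_into (space (total P)) F \<in> measurable (total Q) (total P)"
    using spP spQ by (subst measurable_cong[where g = G]) auto
  then have "borel_isomorphism (total P) (total Q) F"
    using bij F spP spQ by (simp add: borel_isomorphism_def)
  moreover have "fibre_unitary P Q t (V t)" if "t > 0" for t
    unfolding fibre_unitary_def
  proof (intro conjI ballI allI)
    show "bij_betw (V t) (fibre P t) (fibre Q t)"
      unfolding P Q by (rule bij_betw_byWitness[of _ "V' t"]) (use that V_fibre V'_fibre in \<open>auto simp: V'V VV'\<close>)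
    fix X Y assume X: "X \<in> fibre P t" and Y: "Y \<in> fibre P t"
    show "V t (X + Y) = V t X + V t Y"
      by (simp add: V_def blinfun_eq_iff blinfun.add_left blinfun.add_right)
    show "V t (scale_op c X) = scale_op c (V t X)" for c
      using Ab[of t] that by (simp add: V_def blinfun_eq_iff bops_scaleC)
    show "ip Q t (V t X) (V t Y) = ip P t X Y"
      unfolding P Q using V_ip[of t Y] Y that bopsP[of Y t] by (simp add: P)
  qed
  moreover have "V (s + t) (mult P s t X Y) = mult Q s t (V s X) (V t Y)"
    if "s > 0" "t > 0" "X \<in> fibre P s" for s t X Y
    using that V_mult[of s t X Y] by (simp add: P Q)
  ultimately have "sps_isomorphism P Q F"
    unfolding sps_isomorphism_def by (auto simp: F_def intro!: exI[of _ V])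
  then show ?thesis unfolding sps_isomorphic_def P_def Q_def by blast
qed

end

theorem theorem8p11:
  fixes M :: "'h::chilbert_space op set" and \<Omega> :: 'h
    and \<alpha> \<beta> :: "real \<Rightarrow> 'h op \<Rightarrow> 'h op"
  assumes "type_II1_factor M"
    and "separable_predual M"
    and "standard_trace_vector M \<Omega>"
    and "E0_semigroup M \<alpha>"
    and "E0_semigroup M \<beta>"
    and "cocycle_conjugate M \<alpha> M \<beta>"
  shows "sps_isomorphic (super_product_system M \<Omega> \<alpha>) (super_product_system M \<Omega> \<beta>)"
proof -
  have factor: "factor M" using assms(1) by (simp add: type_II1_factor_def)
  obtain U \<theta> where U: "cocycle M \<alpha> U" and \<theta>: "star_iso M M \<theta>"
    and \<beta>: "\<And>t y. t \<ge> 0 \<Longrightarrow> y \<in> M \<Longrightarrow> \<beta> t y = \<theta> (perturb \<alpha> U t (inv_into M \<theta> y))"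
    using assms(6) unfolding cocycle_conjugate_def conjugate_def by blast
  interpret trace_aut M \<Omega> \<theta>
    using factor \<theta> assms(3) by unfold_locales (auto simp: factor_def)
  show ?thesis by (rule cocycle_conjugate_sps[OF factor assms(2,4,5) U \<beta>])
qed

end
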